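(* Let $d\ge2$ be an integer, $q_\circ(d)=\frac{2(d+1)}{d-1}$, $q\in (q_\circ(d),\infty)$, and $s_c(q,d)=\frac d2-\frac dq$. Then there is a constant $C$ (depending only on $d,q$) such that $$\Big\| \sup_{t \in \mathbb R} \big|e^{it\sqrt{-\Delta}}f\big|\Big\|_{L^{q}(\mathbb R^d)} \le C \|f\|_{\dot{H}^{s_c(q,d)}(\mathbb{R}^d)}$$ for all $f\in \dot H^{s_c(q,d)}(\mathbb R^d)$. Moreover, there is a constant $C$ (depending only on $d,q$) such that $$\Big\| \sup_{t \in \mathbb R} \big|e^{it\sqrt{-\Delta}}f\big|\Big\|_{L^{q,2}(\mathbb R^d)} \le C \|f\|_{\dot H^{s_c(q,d)}(\mathbb R^d)}$$ for all $f\in \dot H^{s_c(q,d)}(\mathbb R^d)$.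
   Context: The wave operator is $e^{it\sqrt{-\Delta}}f(x)=\frac1{(2\pi)^d}\int_{\mathbb R^d}e^{i(x\cdot\xi+t|\xi|)}\widehat f(\xi)\,d\xi$, with $\widehat f(\xi)=\int e^{-ix\cdot\xi}f(x)\,dx$. $\dot H^s(\mathbb R^d)$ is the homogeneous $L^2$ Sobolev space with norm $\|(-\Delta)^{s/2}f\|_{L^2}$, and $L^{q,r}$ denotes the Lorentz space. As usual, such maximal estimates may be read as a priori estimates for Schwartz functions $f$ with constants independent of $f$, extended to the whole Sobolev space by density. *)

theory Defs
  imports "HOL-Analysis.Analysis"
begin

section \<open>Schwartz functions\<close>

definition partial_deriv :: "'d::finite \<Rightarrow> (real^'d \<Rightarrow> complex) \<Rightarrow> real^'d \<Rightarrow> complex" where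
  "partial_deriv j f x = frechet_derivative f (at x) (axis j 1)"

primrec partial_derivs :: "'d::finite list \<Rightarrow> (real^'d \<Rightarrow> complex) \<Rightarrow> real^'d \<Rightarrow> complex" where
  "partial_derivs [] f = f"
| "partial_derivs (j # js) f = partial_deriv j (partial_derivs js f)"

text \<open>Total differentiability of all iterated partial derivatives is smoothness. A multi-index is
  represented by a list of directions.\<close>

definition schwartz :: "(real^'d::finite \<Rightarrow> complex) \<Rightarrow> bool" where
  "schwartz f \<longleftrightarrow>
     (\<forall>js. (\<forall>x. partial_derivs js f differentiable (at x)) \<and>
           (\<forall>k::nat. bounded (range (\<lambda>x. norm x ^ k *\<^sub>R partial_derivs js f x))))"

section \<open>Fourier transform and Fourier multipliers\<close>

definition fourier :: "(real^'d::finite \<Rightarrow> complex) \<Rightarrow> real^'d \<Rightarrow> complex" where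
  "fourier f \<xi> = (LINT x|lborel. exp (- \<i> * complex_of_real (x \<bullet> \<xi>)) * f x)"

definition wave_op :: "real \<Rightarrow> (real^'d::finite \<Rightarrow> complex) \<Rightarrow> real^'d \<Rightarrow> complex" where
  "wave_op t f x =
     complex_of_real (1 / (2 * pi) ^ CARD('d)) *
     (LINT \<xi>|lborel. exp (\<i> * complex_of_real (x \<bullet> \<xi> + t * norm \<xi>)) * fourier f \<xi>)"

text \<open>The multiplier \<open>(-\<Delta>)\<^bsup>s/2\<^esup>\<close>, with symbol \<open>\<bar>\<xi>\<bar>\<^sup>s\<close>.\<close>

definition laplacian_half_power :: "real \<Rightarrow> (real^'d::finite \<Rightarrow> complex) \<Rightarrow> real^'d \<Rightarrow> complex" where
  "laplacian_half_power s f x =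
     complex_of_real (1 / (2 * pi) ^ CARD('d)) *
     (LINT \<xi>|lborel. exp (\<i> * complex_of_real (x \<bullet> \<xi>)) *
        complex_of_real (norm \<xi> powr s) * fourier f \<xi>)"

section \<open>Lebesgue and Lorentz norms\<close>

text \<open>Norms take values in \<open>[0,\<infinity>]\<close> and are applied to \<open>[0,\<infinity>]\<close>-valued functions, since a supremum
  over all times may a priori be infinite. Real powers are only used for positive exponents.\<close>

definition ennreal_powr :: "ennreal \<Rightarrow> real \<Rightarrow> ennreal" where
  "ennreal_powr a p = (if a = \<infinity> then \<infinity> else ennreal (enn2real a powr p))"

definition Lp_norm :: "real \<Rightarrow> (real^'d::finite \<Rightarrow> ennreal) \<Rightarrow> ennreal" where
  "Lp_norm p g = ennreal_powr (\<integral>\<^sup>+ x. ennreal_powr (g x) p \<partial>lborel) (1 / p)"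

text \<open>The Lorentz quasi-norm of \<open>L\<^bsup>p,r\<^esup>\<close> for \<open>r < \<infinity>\<close>, in terms of the distribution function:
  \<open>p\<^bsup>1/r\<^esup> (\<integral>\<^sub>0\<^sup>\<infinity> (a |{g > a}|\<^bsup>1/p\<^esup>)\<^sup>r da/a)\<^bsup>1/r\<^esup>\<close>. With this normalisation it coincides with
  \<open>(\<integral>\<^sub>0\<^sup>\<infinity> (\<tau>\<^bsup>1/p\<^esup> g\<^sup>*(\<tau>))\<^sup>r d\<tau>/\<tau>)\<^bsup>1/r\<^esup>\<close>, where \<open>g\<^sup>*\<close> is the decreasing rearrangement of \<open>g\<close>.\<close>

definition Lorentz_norm :: "real \<Rightarrow> real \<Rightarrow> (real^'d::finite \<Rightarrow> ennreal) \<Rightarrow> ennreal" where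
  "Lorentz_norm p r g =
     ennreal_powr
       (ennreal p * (\<integral>\<^sup>+ a. ennreal (a powr (r - 1)) *
          ennreal_powr (emeasure lborel {x. ennreal a < g x}) (r / p) * indicator {0<..} a \<partial>lborel))
       (1 / r)"

section \<open>Homogeneous Sobolev spaces and the maximal function\<close>

definition Hdot_norm :: "real \<Rightarrow> (real^'d::finite \<Rightarrow> complex) \<Rightarrow> ennreal" where
  "Hdot_norm s f = Lp_norm 2 (\<lambda>x. ennreal (cmod (laplacian_half_power s f x)))"

text \<open>The space \<open>\<dot>H\<^sup>s\<close> is the completion of the Schwartz functions in the norm \<^const>\<open>Hdot_norm\<close>, so
  its elements are represented by Cauchy sequences \<open>F\<close> of Schwartz functions; the norm of the element
  is the limit of the norms of \<open>F n\<close>.\<close>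

definition Hdot_Cauchy :: "real \<Rightarrow> (nat \<Rightarrow> real^'d::finite \<Rightarrow> complex) \<Rightarrow> bool" where
  "Hdot_Cauchy s F \<longleftrightarrow>
     (\<forall>n. schwartz (F n)) \<and>
     (\<forall>e>0. \<exists>N. \<forall>m\<ge>N. \<forall>n\<ge>N. Hdot_norm s (\<lambda>x. F m x - F n x) < ennreal e)"

definition Hdot_limit_norm :: "real \<Rightarrow> (nat \<Rightarrow> real^'d::finite \<Rightarrow> complex) \<Rightarrow> ennreal" where
  "Hdot_limit_norm s F = lim (\<lambda>n. Hdot_norm s (F n))"

definition sup_time :: "(real \<Rightarrow> real^'d::finite \<Rightarrow> complex) \<Rightarrow> real^'d \<Rightarrow> ennreal" where
  "sup_time u x = (SUP t. ennreal (cmod (u t x)))"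

text \<open>The extension by density of the wave evolution to the element represented by \<open>F\<close>: a function
  \<open>u\<close> to which the evolutions of \<open>F n\<close> converge in \<open>L\<^sup>q\<^sub>x(L\<^sup>\<infinity>\<^sub>t)\<close>. Outside a null set of \<open>x\<close>, this
  determines \<open>u t x\<close> for all \<open>t\<close> simultaneously, hence also the supremum over \<open>t\<close>. Continuity in \<open>t\<close>
  makes that supremum a measurable function of \<open>x\<close>.\<close>

definition wave_extension ::
    "real \<Rightarrow> (nat \<Rightarrow> real^'d::finite \<Rightarrow> complex) \<Rightarrow> (real \<Rightarrow> real^'d \<Rightarrow> complex) \<Rightarrow> bool" where
  "wave_extension q F u \<longleftrightarrow>
     (\<forall>t. u t \<in> borel_measurable lborel) \<and>
     (\<forall>x. continuous_on UNIV (\<lambda>t. u t x)) \<and>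
     (\<lambda>n. Lp_norm q (sup_time (\<lambda>t x. wave_op t (F n) x - u t x))) \<longlonglongrightarrow> 0"

section \<open>Exponents\<close>

definition q_circ :: "nat \<Rightarrow> real" where
  "q_circ d = 2 * (real d + 1) / (real d - 1)"

definition s_crit :: "real \<Rightarrow> nat \<Rightarrow> real" where
  "s_crit q d = real d / 2 - real d / q"

end

theory Submission
  imports Defs "HOL-Probability.Characteristic_Functions" "HOL-Probability.Sinc_Integral" "HOL-Complex_Analysis.Conformal_Mappings"
begin

text \<open>
  The wave kernel damped by \<open>e\<^bsup>-\<rho>|\<xi>|\<^esup>\<close> is the Poisson kernel at the complex time \<open>y = \<rho> - \<i> t\<close>, namely
  \<open>c y (y\<^sup>2 + |x|\<^sup>2)\<^bsup>-(d+1)/2\<^esup>\<close>, so its size is at most \<open>\<rho>\<^bsup>-(d+1)/2\<^esup> |y|\<^bsup>-(d-1)/2\<^esup>\<close>. For a measurable choice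
  of times \<open>t(x)\<close> on a set of measure \<open>M\<close>, dualise and expand the square: pairs of points whose times
  are close are controlled by \<open>L\<^sup>2\<close> orthogonality, the others by the decay of the kernel. Balancing the
  two gives a restricted weak type estimate at the endpoint \<open>p = 2(d+1)/(d-1)\<close> for each dyadic frequency.

  To sum over frequencies, split at \<open>|\<xi>| = 2\<^sup>N\<close>. The low part is bounded in \<open>L\<^sup>\<infinity>\<close> by \<open>2\<^bsup>Nd/q\<^esup> c(N)\<close>, where \<open>c(N)\<^sup>2\<close>
  is the energy near frequency \<open>2\<^sup>N\<close> with power-like tails, and the high part has weak \<open>L\<^sup>p\<close> norm
  at most a multiple of \<open>2\<^bsup>Nd/q - Nd/p\<^esup> c(N)\<close>. Hence the maximal function exceeds a multiple of \<open>2\<^bsup>Nd/q\<^esup> c(N)\<close> only on a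
  set of measure at most a multiple of \<open>2\<^bsup>-Nd\<^esup>\<close>, and both norms follow since \<open>\<Sum>\<^sub>N c(N)\<^sup>2\<close> is comparable to the
  Sobolev norm squared.
\<close>

section \<open>Fourier transform and Plancherel inequalities\<close>

text \<open>The endpoint exponent is forced by the balance. For a set of measure M and frequencies
  of size 1/\<rho>, pairs fewer than L time steps of length \<rho> apart cost L M, the others M^2
  \<rho>^(-d) L^(-(d-1)/2). Equality holds at L = (M/\<rho>^d)^(2/(d+1)) and yields M^(1 + 2/(d+1)),
  the square of M^(1/p') for p = 2(d+1)/(d-1). This endpoint bound has no decay to spare for the sum
  over frequencies. The condition q > p says s > d/(d+1); it leaves room for an \<epsilon> on both
  sides, 2 s + 2 \<epsilon> < d for the low part and 2 s - 2 \<epsilon> > 2d/(d+1) for the high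
  part. The energies c(N)^2 therefore carry the weights |\<xi>|^(2 \<epsilon>) and |\<xi>|^(-2
  \<epsilon>) on the two sides of 2^N. Both the level and the dual estimate contain c(N), which
  cancels; the measure bound 2^(-N d) is thus independent of the data. The second Lorentz index is 2
  because a level enters by its square, hence linearly in the energy. Exponential damping is chosen
  because its kernel has a closed form, from which the decay is read off. Plancherel enters as two
  separate inequalities: an upper one for the dual functions, a lower one to compare the energy of
  the data with the Sobolev norm.\<close>

definition ft :: "('a::euclidean_space \<Rightarrow> complex) \<Rightarrow> 'a \<Rightarrow> complex" where
  "ft \<phi> \<xi> = (LINT x|lborel. cis (x \<bullet> \<xi>) * \<phi> x)"

lemma borel_measurable_cis [measurable (raw)]:
  "f \<in> borel_measurable M \<Longrightarrow> (\<lambda>x. cis (f x)) \<in> borel_measurable M"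
  by (simp add: cis_conv_exp)

lemma borel_measurable_cnj [measurable (raw)]:
  "f \<in> borel_measurable M \<Longrightarrow> (\<lambda>x. cnj (f x)) \<in> borel_measurable M"
  by (rule measurable_compose[OF _ borel_measurable_continuous_onI]) (auto intro: continuous_intros)

section \<open>Product integrals and Gaussians\<close>

lemma
  fixes f :: "'a::euclidean_space \<Rightarrow> real \<Rightarrow> 'b::{real_normed_field,banach,second_countable_topology}"
  assumes f: "\<And>b. b \<in> Basis \<Longrightarrow> integrable lborel (f b)"
  shows integrable_lborel_prod: "integrable lborel (\<lambda>x. \<Prod>b\<in>Basis. f b (x \<bullet> b))"
    and integral_lborel_prod: "(LINT x|lborel. (\<Prod>b\<in>Basis. f b (x \<bullet> b))) = (\<Prod>b\<in>Basis. (LINT t|lborel. f b t))"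
proof -
  interpret product_sigma_finite "\<lambda>_::'a. lborel::real measure" ..
  let ?T = "\<lambda>h::'a \<Rightarrow> real. \<Sum>b\<in>Basis. h b *\<^sub>R b"
  have [measurable]: "f b \<in> borel_measurable borel" if "b \<in> Basis" for b
    using f[OF that] by (simp add: borel_measurable_integrable)
  have T[measurable]: "?T \<in> (\<Pi>\<^sub>M b\<in>Basis. lborel) \<rightarrow>\<^sub>M borel"
    by measurable
  have F[measurable]: "(\<lambda>x. \<Prod>b\<in>Basis. f b (x \<bullet> b)) \<in> borel_measurable borel"
    by measurable
  have eq: "(\<Prod>b\<in>Basis. f b (?T h \<bullet> b)) = (\<Prod>b\<in>Basis. f b (h b))" for h
    by (intro prod.cong refl) (simp add: inner_sum_left_Basis)
  show "integrable lborel (\<lambda>x. \<Prod>b\<in>Basis. f b (x \<bullet> b))"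
    by (subst lborel_eq, subst integrable_distr_eq[OF T F])
       (unfold eq, intro product_integrable_prod f, auto)
  show "(LINT x|lborel. (\<Prod>b\<in>Basis. f b (x \<bullet> b))) = (\<Prod>b\<in>Basis. (LINT t|lborel. f b t))"
    by (subst lborel_eq, subst integral_distr[OF T F])
       (unfold eq, intro product_integral_prod f, auto)
qed

text \<open>This is the characteristic function of the standard normal law, rescaled: with
  \<open>c = sqrt (2 * a)\<close> the substitution y = c \<xi> turns
  \<open>std_normal_density\<close> into a multiple of the Gaussian with parameter
  \<open>a\<close>.\<close>

lemma
  fixes a x :: real
  assumes a: "a > 0"
  shows integrable_gaussian_1d: "integrable lborel (\<lambda>\<xi>. cis (x * \<xi>) * complex_of_real (exp (- a * \<xi>\<^sup>2)))"
    and integral_gaussian_1d: "(LINT \<xi>|lborel. cis (x * \<xi>) * complex_of_real (exp (- a * \<xi>\<^sup>2)))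
       = complex_of_real (sqrt (pi / a) * exp (- x\<^sup>2 / (4 * a)))"
proof -
  define c where "c = sqrt (2 * a)"
  have c: "c > 0" "c\<^sup>2 = 2 * a" using a by (auto simp: c_def)
  let ?g = "\<lambda>y. std_normal_density y *\<^sub>R cis (x / c * y)"
  have intg: "integrable lborel ?g"
    by (rule Bochner_Integration.integrable_bound[of _ std_normal_density])
      (auto simp: normal_density_nonneg)
  have eq: "?g (0 + c * \<xi>) = complex_of_real (1 / sqrt (2 * pi)) * (cis (x * \<xi>) * complex_of_real (exp (- a * \<xi>\<^sup>2)))" for \<xi>
    using c by (auto simp: normal_density_def scaleR_conv_of_real power_mult_distrib field_simps)
  have "integrable lborel (\<lambda>\<xi>. ?g (0 + c * \<xi>))"
    using lborel_integrable_real_affine[OF intg, of c 0] c by simp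
  from integrable_mult_right[OF this[unfolded eq], of "complex_of_real (sqrt (2 * pi))"]
  show "integrable lborel (\<lambda>\<xi>. cis (x * \<xi>) * complex_of_real (exp (- a * \<xi>\<^sup>2)))"
    by (simp flip: mult.assoc of_real_mult)
  have "(LINT y|lborel. ?g y) = char std_normal_distribution (x / c)"
    unfolding char_def by (subst integral_density) (auto simp: normal_density_nonneg cis_conv_exp mult.commute)
  also have "\<dots> = complex_of_real (exp (- (x / c)\<^sup>2 / 2))"
    by (simp add: char_std_normal_distribution)
  finally have "complex_of_real (exp (- (x / c)\<^sup>2 / 2)) = c *\<^sub>R (LINT \<xi>|lborel. ?g (0 + c * \<xi>))"
    using lborel_integral_real_affine[of c ?g 0] c by simp
  also have "(LINT \<xi>|lborel. ?g (0 + c * \<xi>)) = complex_of_real (1 / sqrt (2 * pi)) *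
      (LINT \<xi>|lborel. cis (x * \<xi>) * complex_of_real (exp (- a * \<xi>\<^sup>2)))"
    unfolding eq by simp
  finally have "(LINT \<xi>|lborel. cis (x * \<xi>) * complex_of_real (exp (- a * \<xi>\<^sup>2))) =
      complex_of_real (sqrt (2 * pi) / c * exp (- (x / c)\<^sup>2 / 2))"
    using c by (simp add: scaleR_conv_of_real field_simps)
  also have "sqrt (2 * pi) / c = sqrt (pi / a)"
    by (simp add: c_def flip: real_sqrt_divide)
  also have "- (x / c)\<^sup>2 / 2 = - x\<^sup>2 / (4 * a)"
    using c by (simp add: power_divide)
  finally show "(LINT \<xi>|lborel. cis (x * \<xi>) * complex_of_real (exp (- a * \<xi>\<^sup>2)))
       = complex_of_real (sqrt (pi / a) * exp (- x\<^sup>2 / (4 * a)))" .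
qed

lemma cis_sum: "finite A \<Longrightarrow> cis (\<Sum>a\<in>A. f a) = (\<Prod>a\<in>A. cis (f a))"
  by (induction A rule: finite_induct) (auto simp flip: cis_mult)

lemma norm_sq_Basis: "(norm (x::'a::euclidean_space))\<^sup>2 = (\<Sum>b\<in>Basis. (x \<bullet> b)\<^sup>2)"
  by (subst power2_norm_eq_inner, subst euclidean_inner) (simp add: power2_eq_square)

text \<open>Phase and Gaussian both factor over the coordinates, so the one-dimensional formula
  applies in each of them.\<close>

lemma
  fixes x :: "'a::euclidean_space"
  assumes a: "a > 0"
  shows integrable_cis_gaussian: "integrable lborel (\<lambda>\<xi>. cis (x \<bullet> \<xi>) * complex_of_real (exp (- a * (norm \<xi>)\<^sup>2)))"
    and integral_cis_gaussian: "(LINT \<xi>|lborel. cis (x \<bullet> \<xi>) * complex_of_real (exp (- a * (norm \<xi>)\<^sup>2)))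
       = complex_of_real (sqrt (pi / a) ^ DIM('a) * exp (- (norm x)\<^sup>2 / (4 * a)))"
proof -
  have eq: "cis (x \<bullet> \<xi>) * complex_of_real (exp (- a * (norm \<xi>)\<^sup>2)) =
     (\<Prod>b\<in>Basis. cis ((x \<bullet> b) * (\<xi> \<bullet> b)) * complex_of_real (exp (- a * (\<xi> \<bullet> b)\<^sup>2)))" for \<xi>
    by (simp add: prod.distrib norm_sq_Basis euclidean_inner[of x \<xi>] cis_sum sum_distrib_left exp_sum
        flip: of_real_prod sum_negf)
  show "integrable lborel (\<lambda>\<xi>. cis (x \<bullet> \<xi>) * complex_of_real (exp (- a * (norm \<xi>)\<^sup>2)))"
    unfolding eq by (rule integrable_lborel_prod) (rule integrable_gaussian_1d[OF a])
  have "(LINT \<xi>|lborel. cis (x \<bullet> \<xi>) * complex_of_real (exp (- a * (norm \<xi>)\<^sup>2)))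
    = (\<Prod>b\<in>Basis. complex_of_real (sqrt (pi / a) * exp (- (x \<bullet> b)\<^sup>2 / (4 * a))))"
    unfolding eq by (subst integral_lborel_prod[OF integrable_gaussian_1d[OF a]]) (simp only: integral_gaussian_1d[OF a])
  also have "\<dots> = complex_of_real (sqrt (pi / a) ^ DIM('a) * exp (- (norm x)\<^sup>2 / (4 * a)))"
    by (simp add: prod.distrib norm_sq_Basis exp_sum sum_divide_distrib flip: of_real_prod sum_negf)
  finally show "(LINT \<xi>|lborel. cis (x \<bullet> \<xi>) * complex_of_real (exp (- a * (norm \<xi>)\<^sup>2)))
       = complex_of_real (sqrt (pi / a) ^ DIM('a) * exp (- (norm x)\<^sup>2 / (4 * a)))" .
qed

lemma ft_gaussian:
  assumes "a > 0"
  shows "ft (\<lambda>\<xi>. complex_of_real (exp (- a * (norm \<xi>)\<^sup>2))) (x::'a::euclidean_space)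
       = complex_of_real (sqrt (pi / a) ^ DIM('a) * exp (- (norm x)\<^sup>2 / (4 * a)))"
  using integral_cis_gaussian[OF assms, of x] by (simp add: ft_def inner_commute)

lemma
  assumes a: "a > 0"
  shows integrable_gaussian: "integrable lborel (\<lambda>\<xi>::'a::euclidean_space. exp (- a * (norm \<xi>)\<^sup>2))"
    and integral_gaussian: "(LINT \<xi>::'a|lborel. exp (- a * (norm \<xi>)\<^sup>2)) = sqrt (pi / a) ^ DIM('a)"
proof -
  show "integrable lborel (\<lambda>\<xi>::'a::euclidean_space. exp (- a * (norm \<xi>)\<^sup>2))"
    using integrable_norm[OF integrable_cis_gaussian[OF a, of "0::'a"]] by (simp del: of_real_exp)
  show "(LINT \<xi>::'a|lborel. exp (- a * (norm \<xi>)\<^sup>2)) = sqrt (pi / a) ^ DIM('a)"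
    using integral_cis_gaussian[OF a, of "0::'a"]
    by (simp del: of_real_exp of_real_power of_real_mult)
qed

text \<open>The product \<open>\<phi> x * w \<xi>\<close> is integrable on the product space and
  dominates the integrand, as the kernel has modulus at most one. The exchanges of spatial and
  frequency integrals in \<open>ft_bilinear\<close> and \<open>high_frequency_bound\<close> are
  instances.\<close>

lemma bounded_kernel_Fubini:
  fixes e :: "'a::euclidean_space \<Rightarrow> 'b::euclidean_space \<Rightarrow> complex"
  assumes \<phi>: "integrable lborel \<phi>" and w: "integrable lborel w"
    and e[measurable]: "(\<lambda>(x, \<xi>). e x \<xi>) \<in> borel_measurable (lborel \<Otimes>\<^sub>M lborel)"
    and e1: "\<And>x \<xi>. norm (e x \<xi>) \<le> 1"
  shows "(LINT \<xi>|lborel. w \<xi> * (LINT x|lborel. e x \<xi> * \<phi> x)) = (LINT x|lborel. \<phi> x * (LINT \<xi>|lborel. e x \<xi> * w \<xi>))"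
proof -
  have [measurable]: "\<phi> \<in> borel_measurable borel" "w \<in> borel_measurable borel"
    using \<phi> w by (auto dest: borel_measurable_integrable)
  have i0: "integrable (lborel \<Otimes>\<^sub>M lborel) (\<lambda>(x, \<xi>). \<phi> x * w \<xi>)"
  proof (rule lborel_pair.Fubini_integrable)
    show "integrable lborel (\<lambda>x. LINT y|lborel. norm (case (x, y) of (x, \<xi>) \<Rightarrow> \<phi> x * w \<xi>))"
      using \<phi> by (simp add: norm_mult)
    show "AE x in lborel. integrable lborel (\<lambda>y. case (x, y) of (x, \<xi>) \<Rightarrow> \<phi> x * w \<xi>)"
      using w by simp
  qed measurable
  have int: "integrable (lborel \<Otimes>\<^sub>M lborel) (\<lambda>(x, \<xi>). e x \<xi> * (\<phi> x * w \<xi>))"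
    by (rule Bochner_Integration.integrable_bound[OF i0])
       (auto simp: norm_mult split: prod.split intro!: AE_I2 mult_left_le_one_le e1)
  have "(LINT \<xi>|lborel. w \<xi> * (LINT x|lborel. e x \<xi> * \<phi> x)) = (LINT \<xi>|lborel. (LINT x|lborel. e x \<xi> * (\<phi> x * w \<xi>)))"
    by (simp add: mult_ac flip: integral_mult_right_zero)
  also have "\<dots> = (LINT x|lborel. (LINT \<xi>|lborel. e x \<xi> * (\<phi> x * w \<xi>)))"
    using lborel_pair.Fubini_integral[OF int] by simp
  also have "\<dots> = (LINT x|lborel. \<phi> x * (LINT \<xi>|lborel. e x \<xi> * w \<xi>))"
    by (simp add: mult_ac flip: integral_mult_right_zero)
  finally show ?thesis .
qed

lemma ft_measurable [measurable]:
  assumes [measurable]: "\<phi> \<in> borel_measurable borel"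
  shows "ft \<phi> \<in> borel_measurable borel"
  unfolding ft_def[abs_def] by measurable

lemma norm_ft_le: "norm (ft \<phi> \<xi>) \<le> (LINT x|lborel. norm (\<phi> x))"
  unfolding ft_def by (rule order_trans[OF integral_norm_bound]) (simp add: norm_mult)

text \<open>Expanding both transforms and integrating in \<xi> first leaves the transform of
  \<open>w\<close> at \<open>x - y\<close>. A weighted inner product in frequency thus becomes a
  double integral with a convolution kernel, which can be estimated by its mass (as in
  \<open>Plancherel_le\<close>) or by its supremum (as in \<open>ft_bilinear_bound\<close>).\<close>

lemma ft_bilinear:
  fixes \<phi> \<psi> w :: "'a::euclidean_space \<Rightarrow> complex"
  assumes \<phi>: "integrable lborel \<phi>" and \<psi>: "integrable lborel \<psi>" and w: "integrable lborel w"
  shows "(LINT \<xi>|lborel. ft \<phi> \<xi> * cnj (ft \<psi> \<xi>) * w \<xi>) = 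
      (LINT x|lborel. \<phi> x * (LINT y|lborel. cnj (\<psi> y) * ft w (x - y)))"
proof -
  have [measurable]: "\<phi> \<in> borel_measurable borel" "w \<in> borel_measurable borel" "\<psi> \<in> borel_measurable borel"
    using \<phi> w \<psi> by (auto dest: borel_measurable_integrable)
  have w': "integrable lborel (\<lambda>\<xi>. cnj (ft \<psi> \<xi>) * w \<xi>)"
    by (rule Bochner_Integration.integrable_bound[OF integrable_mult_right[OF w, of "LINT x|lborel. norm (\<psi> x)"]])
       (auto simp: norm_mult intro!: mult_right_mono norm_ft_le order_trans[OF norm_ft_le])
  have "(LINT \<xi>|lborel. ft \<phi> \<xi> * cnj (ft \<psi> \<xi>) * w \<xi>) = (LINT \<xi>|lborel. (cnj (ft \<psi> \<xi>) * w \<xi>) * (LINT x|lborel. cis (x \<bullet> \<xi>) * \<phi> x))"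
    by (simp add: ft_def mult_ac)
  also have "\<dots> = (LINT x|lborel. \<phi> x * (LINT \<xi>|lborel. cis (x \<bullet> \<xi>) * (cnj (ft \<psi> \<xi>) * w \<xi>)))"
    by (rule bounded_kernel_Fubini[OF \<phi> w']) auto
  also have "(\<lambda>x. LINT \<xi>|lborel. cis (x \<bullet> \<xi>) * (cnj (ft \<psi> \<xi>) * w \<xi>)) = (\<lambda>x. LINT y|lborel. cnj (\<psi> y) * ft w (x - y))"
  proof
    fix x
    have "(LINT \<xi>|lborel. cis (x \<bullet> \<xi>) * (cnj (ft \<psi> \<xi>) * w \<xi>)) =
       (LINT \<xi>|lborel. w \<xi> * (LINT y|lborel. cis ((x - y) \<bullet> \<xi>) * cnj (\<psi> y)))"
    proof (rule Bochner_Integration.integral_cong[OF refl])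
      fix \<xi>
      have "cnj (ft \<psi> \<xi>) = (LINT y|lborel. cnj (cis (y \<bullet> \<xi>) * \<psi> y))"
        unfolding ft_def by (rule integral_bounded_linear'[symmetric, OF bounded_linear_cnj bounded_linear_cnj]) simp
      then have "cis (x \<bullet> \<xi>) * cnj (ft \<psi> \<xi>) = (LINT y|lborel. cis (x \<bullet> \<xi>) * cnj (cis (y \<bullet> \<xi>) * \<psi> y))"
        by simp
      also have "\<dots> = (LINT y|lborel. cis ((x - y) \<bullet> \<xi>) * cnj (\<psi> y))"
        by (simp add: cis_cnj inner_diff_left cis_mult flip: mult.assoc)
      finally show "cis (x \<bullet> \<xi>) * (cnj (ft \<psi> \<xi>) * w \<xi>) = w \<xi> * (LINT y|lborel. cis ((x - y) \<bullet> \<xi>) * cnj (\<psi> y))"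
        by (simp add: mult_ac)
    qed
    also have "\<dots> = (LINT y|lborel. cnj (\<psi> y) * (LINT \<xi>|lborel. cis ((x - y) \<bullet> \<xi>) * w \<xi>))"
      by (rule bounded_kernel_Fubini[OF _ w]) (use \<psi> in auto)
    finally show "(LINT \<xi>|lborel. cis (x \<bullet> \<xi>) * (cnj (ft \<psi> \<xi>) * w \<xi>)) = (LINT y|lborel. cnj (\<psi> y) * ft w (x - y))"
      by (simp add: ft_def inner_commute)
  qed
  finally show ?thesis .
qed

lemma
  fixes t :: "'a::euclidean_space"
  assumes c: "c \<noteq> 0"
  shows nn_integral_lborel_affine: "f \<in> borel_measurable borel \<Longrightarrow>
      (\<integral>\<^sup>+x. f x \<partial>lborel) = ennreal (\<bar>c\<bar> ^ DIM('a)) * (\<integral>\<^sup>+x. f (t + c *\<^sub>R x) \<partial>lborel)"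
    and integral_lborel_affine: "g \<in> borel_measurable borel \<Longrightarrow>
      (LINT x|lborel. g x) = \<bar>c\<bar> ^ DIM('a) *\<^sub>R (LINT x|lborel. (g (t + c *\<^sub>R x) :: complex))"
proof -
  show "(\<integral>\<^sup>+x. f x \<partial>lborel) = ennreal (\<bar>c\<bar> ^ DIM('a)) * (\<integral>\<^sup>+x. f (t + c *\<^sub>R x) \<partial>lborel)"
    if [measurable]: "f \<in> borel_measurable borel" for f
    by (subst lborel_affine[OF c, of t])
       (simp add: nn_integral_density nn_integral_distr nn_integral_cmult)
  show "(LINT x|lborel. g x) = \<bar>c\<bar> ^ DIM('a) *\<^sub>R (LINT x|lborel. (g (t + c *\<^sub>R x) :: complex))"
    if [measurable]: "g \<in> borel_measurable borel" for g
    by (subst lborel_affine[OF c, of t]) (simp add: integral_density integral_distr)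
qed

lemma norm_integral_le_nn_integral:
  fixes f :: "'b \<Rightarrow> 'c::{banach,second_countable_topology}"
  shows "ennreal (norm (integral\<^sup>L M f)) \<le> (\<integral>\<^sup>+x. ennreal (norm (f x)) \<partial>M)"
  by (cases "integrable M f") (auto simp: integral_norm_bound_ennreal not_integrable_integral_eq)

lemma ennreal_two_mult_le: "2 * (x * y) \<le> x\<^sup>2 + (y::ennreal)\<^sup>2"
proof (cases "x = top \<or> y = top")
  case False
  then obtain a b where ab: "x = ennreal a" "y = ennreal b" "a \<ge> 0" "b \<ge> 0"
    by (metis ennreal_cases)
  have "2 * (a * b) \<le> a\<^sup>2 + b\<^sup>2"
    using sum_squares_bound[of a b] by simp
  then have "ennreal (2 * (a * b)) \<le> ennreal (a\<^sup>2 + b\<^sup>2)"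
    by (rule ennreal_leI)
  then show ?thesis
    using ab by (simp add: ennreal_mult ennreal_power)
qed auto

text \<open>The inequality 2 f(x) f(y) <= f(x)^2 + f(y)^2 decouples the variables; in each half the
  kernel is integrated over the variable that no longer occurs, and by reflection or translation
  this gives its full mass.\<close>

lemma nn_integral_convolution_le:
  fixes f k :: "'a::euclidean_space \<Rightarrow> ennreal"
  assumes [measurable]: "f \<in> borel_measurable borel" "k \<in> borel_measurable borel"
  shows "(\<integral>\<^sup>+x. \<integral>\<^sup>+y. f x * f y * k (x - y) \<partial>lborel \<partial>lborel) \<le> (\<integral>\<^sup>+z. k z \<partial>lborel) * (\<integral>\<^sup>+x. (f x)\<^sup>2 \<partial>lborel)"
proof -
  define I where "I = (\<integral>\<^sup>+z. k z \<partial>lborel)"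
  have I1: "(\<integral>\<^sup>+y. k (x - y) \<partial>lborel) = I" for x
    using nn_integral_lborel_affine[of "-1" k x] by (simp add: I_def)
  have I2: "(\<integral>\<^sup>+x. k (x - y) \<partial>lborel) = I" for y
    using nn_integral_lborel_affine[of "1" k "-y"] by (simp add: I_def)
  have "2 * (\<integral>\<^sup>+x. \<integral>\<^sup>+y. f x * f y * k (x - y) \<partial>lborel \<partial>lborel) = 
      (\<integral>\<^sup>+x. \<integral>\<^sup>+y. 2 * (f x * f y) * k (x - y) \<partial>lborel \<partial>lborel)"
    by (simp add: nn_integral_cmult mult.assoc)
  also have "\<dots> \<le> (\<integral>\<^sup>+x. \<integral>\<^sup>+y. ((f x)\<^sup>2 + (f y)\<^sup>2) * k (x - y) \<partial>lborel \<partial>lborel)"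
    by (intro nn_integral_mono mult_right_mono ennreal_two_mult_le) auto
  also have "\<dots> = (\<integral>\<^sup>+x. \<integral>\<^sup>+y. (f x)\<^sup>2 * k (x - y) \<partial>lborel \<partial>lborel) + (\<integral>\<^sup>+x. \<integral>\<^sup>+y. (f y)\<^sup>2 * k (x - y) \<partial>lborel \<partial>lborel)"
    by (simp add: distrib_right nn_integral_add)
  also have "(\<integral>\<^sup>+x. \<integral>\<^sup>+y. (f x)\<^sup>2 * k (x - y) \<partial>lborel \<partial>lborel) = I * (\<integral>\<^sup>+x. (f x)\<^sup>2 \<partial>lborel)"
    by (simp add: nn_integral_cmult nn_integral_multc I1 mult.commute)
  also have "(\<integral>\<^sup>+x. \<integral>\<^sup>+y. (f y)\<^sup>2 * k (x - y) \<partial>lborel \<partial>lborel) = (\<integral>\<^sup>+y. \<integral>\<^sup>+x. (f y)\<^sup>2 * k (x - y) \<partial>lborel \<partial>lborel)"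
    by (rule lborel_pair.Fubini'[symmetric]) measurable
  also have "\<dots> = I * (\<integral>\<^sup>+x. (f x)\<^sup>2 \<partial>lborel)"
    by (simp add: nn_integral_cmult nn_integral_multc I2 mult.commute)
  finally have "2 * (\<integral>\<^sup>+x. \<integral>\<^sup>+y. f x * f y * k (x - y) \<partial>lborel \<partial>lborel) \<le> 2 * (I * (\<integral>\<^sup>+x. (f x)\<^sup>2 \<partial>lborel))"
    by (simp add: mult_2)
  then show ?thesis
    unfolding I_def by (subst (asm) ennreal_mult_le_mult_iff) auto
qed

text \<open>The transform of a Gaussian is a Gaussian whose total mass (2 pi)^d does not depend on
  the width. This is the source of the constant in \<open>Plancherel_le\<close>.\<close>

lemma gaussian_scaled_mass: 
  assumes "a > 0" shows "sqrt (pi / a) ^ d * sqrt (pi / (1 / (4 * a))) ^ d = (2 * pi) ^ d"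
proof -
  have "sqrt (pi / a) * sqrt (pi / (1 / (4 * a))) = sqrt ((2 * pi)\<^sup>2)"
    unfolding real_sqrt_mult[symmetric] using assms by (simp add: power2_eq_square field_simps)
  then have "sqrt (pi / a) * sqrt (pi / (1 / (4 * a))) = 2 * pi"
    by (simp only: real_sqrt_abs) simp
  then show ?thesis unfolding power_mult_distrib[symmetric] by metis
qed

section \<open>Plancherel's theorem as two inequalities\<close>

lemma integrable_ft_sq_mult:
  assumes \<phi>: "integrable lborel \<phi>" and w: "integrable lborel (w :: 'a::euclidean_space \<Rightarrow> real)"
  shows "integrable lborel (\<lambda>\<xi>. (norm (ft \<phi> \<xi>))\<^sup>2 * w \<xi>)"
proof -
  have [measurable]: "\<phi> \<in> borel_measurable borel" "w \<in> borel_measurable borel"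
    using \<phi> w by (auto dest: borel_measurable_integrable)
  show ?thesis
    by (rule Bochner_Integration.integrable_bound[OF integrable_mult_right[OF w, of "(LINT x|lborel. norm (\<phi> x))\<^sup>2"]])
       (auto simp: abs_mult intro!: mult_right_mono power_mono norm_ft_le)
qed

lemma integral_ft_sq_mult:
  assumes \<phi>: "integrable lborel \<phi>" and w: "integrable lborel (w :: 'a::euclidean_space \<Rightarrow> real)"
  shows "complex_of_real (LINT \<xi>|lborel. (norm (ft \<phi> \<xi>))\<^sup>2 * w \<xi>) =
     (LINT x|lborel. \<phi> x * (LINT y|lborel. cnj (\<phi> y) * ft (\<lambda>\<xi>. complex_of_real (w \<xi>)) (x - y)))"
proof -
  have "complex_of_real (LINT \<xi>|lborel. (norm (ft \<phi> \<xi>))\<^sup>2 * w \<xi>) = (LINT \<xi>|lborel. ft \<phi> \<xi> * cnj (ft \<phi> \<xi>) * complex_of_real (w \<xi>))"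
    unfolding integral_complex_of_real[symmetric] by (simp only: of_real_mult complex_norm_square)
  also have "\<dots> = (LINT x|lborel. \<phi> x * (LINT y|lborel. cnj (\<phi> y) * ft (\<lambda>\<xi>. complex_of_real (w \<xi>)) (x - y)))"
    using w by (intro ft_bilinear \<phi>) auto
  finally show ?thesis .
qed

text \<open>A Gaussian weight makes the frequency integral finite and turns it into a double
  integral against a Gaussian of mass (2 pi)^d, bounded by
  \<open>nn_integral_convolution_le\<close>. The bound is uniform in the weight, so Fatou's lemma
  removes it.\<close>

lemma Plancherel_le:
  fixes \<phi> :: "'a::euclidean_space \<Rightarrow> complex"
  assumes \<phi>: "integrable lborel \<phi>"
  shows "(\<integral>\<^sup>+\<xi>. ennreal ((norm (ft \<phi> \<xi>))\<^sup>2) \<partial>lborel) \<le> ennreal ((2 * pi) ^ DIM('a)) * (\<integral>\<^sup>+x. ennreal ((norm (\<phi> x))\<^sup>2) \<partial>lborel)"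
    (is "_ \<le> ?B")
proof -
  have [measurable]: "\<phi> \<in> borel_measurable borel"
    using \<phi> by (auto dest: borel_measurable_integrable)
  have *: "(\<integral>\<^sup>+\<xi>. ennreal ((norm (ft \<phi> \<xi>))\<^sup>2 * exp (- a * (norm \<xi>)\<^sup>2)) \<partial>lborel) \<le> ?B" if a: "a > 0" for a
  proof -
    define \<Gamma> where "\<Gamma> z = sqrt (pi / a) ^ DIM('a) * exp (- (norm z)\<^sup>2 / (4 * a))" for z :: 'a
    have \<Gamma>0: "\<Gamma> z \<ge> 0" for z using a by (simp add: \<Gamma>_def)
    have [measurable]: "\<Gamma> \<in> borel_measurable borel" unfolding \<Gamma>_def by measurable
    have a4: "1 / (4 * a) > 0" using a by simp
    have \<Gamma>eq: "\<Gamma> = (\<lambda>z. sqrt (pi / a) ^ DIM('a) * exp (- (1 / (4 * a)) * (norm z)\<^sup>2))"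
      by (simp add: \<Gamma>_def fun_eq_iff)
    have "integrable lborel \<Gamma>"
      unfolding \<Gamma>eq by (intro integrable_mult_right integrable_gaussian[OF a4])
    then have "(\<integral>\<^sup>+z. ennreal (\<Gamma> z) \<partial>lborel) = ennreal (LINT z|lborel. \<Gamma> z)"
      using \<Gamma>0 by (intro nn_integral_eq_integral) auto
    also have "(LINT z|lborel. \<Gamma> z) = (2 * pi) ^ DIM('a)"
      unfolding \<Gamma>eq integral_mult_right_zero integral_gaussian[OF a4] gaussian_scaled_mass[OF a] ..
    finally have I: "(\<integral>\<^sup>+z. ennreal (\<Gamma> z) \<partial>lborel) = ennreal ((2 * pi) ^ DIM('a))" .
    have "(\<integral>\<^sup>+\<xi>. ennreal ((norm (ft \<phi> \<xi>))\<^sup>2 * exp (- a * (norm \<xi>)\<^sup>2)) \<partial>lborel) = 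
       ennreal (LINT \<xi>|lborel. (norm (ft \<phi> \<xi>))\<^sup>2 * exp (- a * (norm \<xi>)\<^sup>2))"
      using integrable_ft_sq_mult[OF \<phi> integrable_gaussian[OF a]] by (intro nn_integral_eq_integral) auto
    also have "\<dots> = ennreal (norm (complex_of_real (LINT \<xi>|lborel. (norm (ft \<phi> \<xi>))\<^sup>2 * exp (- a * (norm \<xi>)\<^sup>2))))"
      by (simp only: norm_of_real) (simp add: integral_nonneg_AE)
    also have "\<dots> = ennreal (norm (LINT x|lborel. \<phi> x * (LINT y|lborel. cnj (\<phi> y) * complex_of_real (\<Gamma> (x - y)))))"
      by (simp only: integral_ft_sq_mult[OF \<phi> integrable_gaussian[OF a]] ft_gaussian[OF a] \<Gamma>_def)
    also have "\<dots> \<le> (\<integral>\<^sup>+x. ennreal (norm (\<phi> x)) * ennreal (norm (LINT y|lborel. cnj (\<phi> y) * complex_of_real (\<Gamma> (x - y)))) \<partial>lborel)"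
      by (rule order_trans[OF norm_integral_le_nn_integral]) (simp add: norm_mult ennreal_mult)
    also have "\<dots> \<le> (\<integral>\<^sup>+x. ennreal (norm (\<phi> x)) * (\<integral>\<^sup>+y. ennreal (norm (\<phi> y)) * ennreal (\<Gamma> (x - y)) \<partial>lborel) \<partial>lborel)"
      by (intro nn_integral_mono mult_left_mono order_trans[OF norm_integral_le_nn_integral])
         (auto simp: norm_mult ennreal_mult \<Gamma>0)
    also have "\<dots> = (\<integral>\<^sup>+x. \<integral>\<^sup>+y. ennreal (norm (\<phi> x)) * ennreal (norm (\<phi> y)) * ennreal (\<Gamma> (x - y)) \<partial>lborel \<partial>lborel)"
      by (simp add: nn_integral_cmult mult.assoc)
    also have "\<dots> \<le> ?B"
      using nn_integral_convolution_le[of "\<lambda>x. ennreal (norm (\<phi> x))" "\<lambda>x. ennreal (\<Gamma> x)"]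
      by (simp add: I ennreal_power)
    finally show ?thesis .
  qed
  have lim: "(\<lambda>n. ennreal ((norm (ft \<phi> \<xi>))\<^sup>2 * exp (- (1 / real (Suc n)) * (norm \<xi>)\<^sup>2))) \<longlonglongrightarrow> ennreal ((norm (ft \<phi> \<xi>))\<^sup>2)" for \<xi>
  proof -
    have "(\<lambda>n. (norm (ft \<phi> \<xi>))\<^sup>2 * exp (- (1 / real (Suc n)) * (norm \<xi>)\<^sup>2)) \<longlonglongrightarrow> (norm (ft \<phi> \<xi>))\<^sup>2 * exp (- 0 * (norm \<xi>)\<^sup>2)"
      by (intro tendsto_intros LIMSEQ_Suc[OF lim_1_over_n])
    then show ?thesis by (intro tendsto_ennrealI) simp
  qed
  have "(\<integral>\<^sup>+\<xi>. ennreal ((norm (ft \<phi> \<xi>))\<^sup>2) \<partial>lborel) = 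
     (\<integral>\<^sup>+\<xi>. liminf (\<lambda>n. ennreal ((norm (ft \<phi> \<xi>))\<^sup>2 * exp (- (1 / real (Suc n)) * (norm \<xi>)\<^sup>2))) \<partial>lborel)"
    by (intro nn_integral_cong lim_imp_Liminf[symmetric] lim) auto
  also have "\<dots> \<le> liminf (\<lambda>n. (\<integral>\<^sup>+\<xi>. ennreal ((norm (ft \<phi> \<xi>))\<^sup>2 * exp (- (1 / real (Suc n)) * (norm \<xi>)\<^sup>2)) \<partial>lborel))"
    by (intro nn_integral_liminf) measurable
  also have "\<dots> \<le> ?B"
    by (intro order_trans[OF Liminf_mono[OF always_eventually[OF allI[OF *]]]]) (auto simp: Liminf_const)
  finally show ?thesis .
qed

text \<open>For the lower bound an estimate of the kernel is not enough: the Gaussian has to act as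
  an approximate identity and the limit has to be identified. Continuity of \<open>g\<close> gives
  pointwise convergence of the averages \<open>J n\<close>, boundedness a dominating
  function.\<close>

lemma Plancherel_ge:
  fixes g :: "'a::euclidean_space \<Rightarrow> complex"
  assumes g: "integrable lborel g" and bdd: "\<And>x. norm (g x) \<le> B" and cont: "continuous_on UNIV g"
  shows "ennreal ((2 * pi) ^ DIM('a)) * (\<integral>\<^sup>+x. ennreal ((norm (g x))\<^sup>2) \<partial>lborel) \<le> (\<integral>\<^sup>+\<xi>. ennreal ((norm (ft g \<xi>))\<^sup>2) \<partial>lborel)"
proof -
  have [measurable]: "g \<in> borel_measurable borel"
    using g by (auto dest: borel_measurable_integrable)
  have B: "B \<ge> 0" using bdd[of 0] norm_ge_zero order_trans by blast
  \<comment> \<open>The kernel exp(-|x - y|^2 / (4 a)) has width 2 sqrt(a). This choice makes the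
    width 1 / (n + 1), so that y = x + z / (n + 1) turns the kernel into the fixed profile
    \<open>E\<close>.\<close>
  define a where "a n = (1 / real (Suc n))\<^sup>2 / 4" for n
  have a: "a n > 0" for n by (simp add: a_def)
  have a2: "2 * sqrt (a n) = 1 / real (Suc n)" for n
  proof -
    have "sqrt (a n) = 1 / real (Suc n) / 2"
      by (rule real_sqrt_unique) (auto simp: a_def power2_eq_square field_simps)
    then show ?thesis by (simp add: field_simps)
  qed
  define E where "E z = exp (- (norm z)\<^sup>2)" for z :: 'a
  have E0: "E z \<ge> 0" for z by (simp add: E_def)
  have [measurable]: "E \<in> borel_measurable borel" unfolding E_def by measurable
  have intE: "integrable lborel E" and E1: "(LINT z|lborel. E z) = sqrt pi ^ DIM('a)"
    using integrable_gaussian[of 1, where 'a='a] integral_gaussian[of 1, where 'a='a] by (simp_all add: E_def[abs_def])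
  \<comment> \<open>What is left of the amplitude sqrt(pi / a)^d after the Jacobian (2 sqrt a)^d;
    multiplied by the mass sqrt(pi)^d of \<open>E\<close> it becomes (2 pi)^d.\<close>
  define c0 where "c0 = sqrt (4 * pi) ^ DIM('a)"
  define J where "J n x = (LINT z|lborel. cnj (g (x + (1 / real (Suc n)) *\<^sub>R z)) * complex_of_real (E z))" for n x
  have I: "complex_of_real (LINT \<xi>|lborel. (norm (ft g \<xi>))\<^sup>2 * exp (- a n * (norm \<xi>)\<^sup>2)) = complex_of_real c0 * (LINT x|lborel. g x * J n x)" for n
  proof -
    have "complex_of_real (LINT \<xi>|lborel. (norm (ft g \<xi>))\<^sup>2 * exp (- a n * (norm \<xi>)\<^sup>2)) =
      (LINT x|lborel. g x * (LINT y|lborel. cnj (g y) * complex_of_real (sqrt (pi / a n) ^ DIM('a) * exp (- (norm (x - y))\<^sup>2 / (4 * a n)))))"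
      by (simp only: integral_ft_sq_mult[OF g integrable_gaussian[OF a]] ft_gaussian[OF a])
    also have "(\<lambda>x. LINT y|lborel. cnj (g y) * complex_of_real (sqrt (pi / a n) ^ DIM('a) * exp (- (norm (x - y))\<^sup>2 / (4 * a n))))
       = (\<lambda>x. complex_of_real c0 * J n x)"
    proof
      fix x :: 'a
      have c: "sqrt (pi / a n) ^ DIM('a) * (1 / real (Suc n)) ^ DIM('a) = c0"
        unfolding c0_def power_mult_distrib[symmetric] a2[symmetric] using a[of n]
        by (simp add: real_sqrt_divide real_sqrt_mult)
      have nz: "norm (x - (x + (1 / real (Suc n)) *\<^sub>R z)) = norm ((1 / real (Suc n)) *\<^sub>R z)" for z :: 'a
        by simp
      have e: "exp (- (norm ((1 / real (Suc n)) *\<^sub>R z))\<^sup>2 / (4 * a n)) = E z" for z :: 'a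
        unfolding a2[symmetric] using a[of n] by (simp add: E_def power_mult_distrib)
      have "(LINT y|lborel. cnj (g y) * complex_of_real (sqrt (pi / a n) ^ DIM('a) * exp (- (norm (x - y))\<^sup>2 / (4 * a n)))) =
        \<bar>1 / real (Suc n)\<bar> ^ DIM('a) *\<^sub>R (LINT z|lborel. cnj (g (x + (1 / real (Suc n)) *\<^sub>R z)) *
          complex_of_real (sqrt (pi / a n) ^ DIM('a) * exp (- (norm (x - (x + (1 / real (Suc n)) *\<^sub>R z)))\<^sup>2 / (4 * a n))))"
        by (rule integral_lborel_affine) (auto)
      also have "(\<lambda>z. cnj (g (x + (1 / real (Suc n)) *\<^sub>R z)) *
          complex_of_real (sqrt (pi / a n) ^ DIM('a) * exp (- (norm (x - (x + (1 / real (Suc n)) *\<^sub>R z)))\<^sup>2 / (4 * a n))))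
          = (\<lambda>z. complex_of_real (sqrt (pi / a n) ^ DIM('a)) * (cnj (g (x + (1 / real (Suc n)) *\<^sub>R z)) * complex_of_real (E z)))"
        unfolding nz e of_real_mult by (simp only: mult.left_commute)
      also have "\<bar>1 / real (Suc n)\<bar> ^ DIM('a) *\<^sub>R (LINT z|lborel. complex_of_real (sqrt (pi / a n) ^ DIM('a)) * (cnj (g (x + (1 / real (Suc n)) *\<^sub>R z)) * complex_of_real (E z)))
         = complex_of_real c0 * J n x"
        unfolding integral_mult_right_zero J_def c[symmetric] by (simp add: scaleR_conv_of_real mult_ac)
      finally show "(LINT y|lborel. cnj (g y) * complex_of_real (sqrt (pi / a n) ^ DIM('a) * exp (- (norm (x - y))\<^sup>2 / (4 * a n)))) = complex_of_real c0 * J n x" .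
    qed
    finally show ?thesis by (simp add: mult.left_commute)
  qed
  have J: "(\<lambda>n. J n x) \<longlonglongrightarrow> cnj (g x) * complex_of_real (sqrt pi ^ DIM('a))" for x
  proof -
    have "(\<lambda>n. J n x) \<longlonglongrightarrow> (LINT z|lborel. cnj (g x) * complex_of_real (E z))"
      unfolding J_def
    proof (rule integral_dominated_convergence[where w="\<lambda>z. B * E z"])
      show "AE z in lborel. (\<lambda>n. cnj (g (x + (1 / real (Suc n)) *\<^sub>R z)) * complex_of_real (E z)) \<longlonglongrightarrow> cnj (g x) * complex_of_real (E z)"
      proof (rule AE_I2)
        fix z
        have "(\<lambda>n. x + (1 / real (Suc n)) *\<^sub>R z) \<longlonglongrightarrow> x + 0 *\<^sub>R z"
          by (intro tendsto_intros LIMSEQ_Suc[OF lim_1_over_n])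
        then have "(\<lambda>n. g (x + (1 / real (Suc n)) *\<^sub>R z)) \<longlonglongrightarrow> g x"
          using cont by (intro continuous_on_tendsto_compose[OF cont]) auto
        then show "(\<lambda>n. cnj (g (x + (1 / real (Suc n)) *\<^sub>R z)) * complex_of_real (E z)) \<longlonglongrightarrow> cnj (g x) * complex_of_real (E z)"
          by (intro tendsto_intros)
      qed
    qed (auto simp: norm_mult E0 intro!: mult_right_mono bdd integrable_mult_right intE)
    then show ?thesis using E1 intE by simp
  qed
  have Jb: "norm (J n x) \<le> B * sqrt pi ^ DIM('a)" for n x
  proof -
    have iJ: "integrable lborel (\<lambda>z. cnj (g (x + (1 / real (Suc n)) *\<^sub>R z)) * complex_of_real (E z))"
      by (rule Bochner_Integration.integrable_bound[OF integrable_mult_right[OF intE, of B]])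
        (auto simp: norm_mult E0 abs_mult intro!: mult_right_mono order_trans[OF bdd])
    have "norm (J n x) \<le> (LINT z|lborel. norm (cnj (g (x + (1 / real (Suc n)) *\<^sub>R z)) * complex_of_real (E z)))"
      unfolding J_def by (rule integral_norm_bound)
    also have "\<dots> \<le> (LINT z|lborel. B * E z)"
      by (rule integral_mono[OF integrable_norm[OF iJ] integrable_mult_right[OF intE]])
        (auto simp: norm_mult E0 intro!: mult_right_mono bdd)
    finally have "norm (J n x) \<le> (LINT z|lborel. B * E z)" .
    then show ?thesis by (simp add: E1)
  qed
  have [measurable]: "J n \<in> borel_measurable borel" for n
    unfolding J_def[abs_def] by measurable
  have "(\<lambda>n. (LINT x|lborel. g x * J n x)) \<longlonglongrightarrow> (LINT x|lborel. g x * (cnj (g x) * complex_of_real (sqrt pi ^ DIM('a))))"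
  proof (rule integral_dominated_convergence[where w="\<lambda>x. norm (g x) * (B * sqrt pi ^ DIM('a))"])
    show "AE x in lborel. (\<lambda>n. g x * J n x) \<longlonglongrightarrow> g x * (cnj (g x) * complex_of_real (sqrt pi ^ DIM('a)))"
      by (intro AE_I2 tendsto_intros J)
  qed (use g in \<open>auto simp: norm_mult intro!: mult_left_mono Jb\<close>)
  then have "(\<lambda>n. complex_of_real (LINT \<xi>|lborel. (norm (ft g \<xi>))\<^sup>2 * exp (- a n * (norm \<xi>)\<^sup>2))) \<longlonglongrightarrow> 
     complex_of_real c0 * (LINT x|lborel. g x * (cnj (g x) * complex_of_real (sqrt pi ^ DIM('a))))"
    unfolding I by (intro tendsto_intros)
  also have "(LINT x|lborel. g x * (cnj (g x) * complex_of_real (sqrt pi ^ DIM('a)))) = 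
     complex_of_real (sqrt pi ^ DIM('a) * (LINT x|lborel. (norm (g x))\<^sup>2))"
    unfolding of_real_mult integral_complex_of_real[symmetric] complex_norm_square
    by (simp only: mult.assoc[symmetric] integral_mult_left_zero) (rule mult.commute)
  also have "complex_of_real c0 * complex_of_real (sqrt pi ^ DIM('a) * (LINT x|lborel. (norm (g x))\<^sup>2)) =
      complex_of_real ((2 * pi) ^ DIM('a) * (LINT x|lborel. (norm (g x))\<^sup>2))"
  proof -
    have "c0 * sqrt pi ^ DIM('a) = (2 * pi) ^ DIM('a)"
    proof -
      have "sqrt (4 * pi) * sqrt pi = 2 * pi" by (simp add: real_sqrt_mult mult.assoc)
      then show ?thesis unfolding c0_def power_mult_distrib[symmetric] by simp
    qed
    then show ?thesis by (simp flip: of_real_mult mult.assoc)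
  qed
  finally have lim: "(\<lambda>n. LINT \<xi>|lborel. (norm (ft g \<xi>))\<^sup>2 * exp (- a n * (norm \<xi>)\<^sup>2)) \<longlonglongrightarrow> (2 * pi) ^ DIM('a) * (LINT x|lborel. (norm (g x))\<^sup>2)"
    by (rule tendsto_of_real_iff[THEN iffD1])
  \<comment> \<open>The weight is at most one, so every damped energy lies below the full one, and
    the bound passes to the limit.\<close>
  have "ennreal (LINT \<xi>|lborel. (norm (ft g \<xi>))\<^sup>2 * exp (- a n * (norm \<xi>)\<^sup>2)) \<le> (\<integral>\<^sup>+\<xi>. ennreal ((norm (ft g \<xi>))\<^sup>2) \<partial>lborel)" for n
  proof -
    have "ennreal (LINT \<xi>|lborel. (norm (ft g \<xi>))\<^sup>2 * exp (- a n * (norm \<xi>)\<^sup>2)) = (\<integral>\<^sup>+\<xi>. ennreal ((norm (ft g \<xi>))\<^sup>2 * exp (- a n * (norm \<xi>)\<^sup>2)) \<partial>lborel)"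
      using integrable_ft_sq_mult[OF g integrable_gaussian[OF a]] by (intro nn_integral_eq_integral[symmetric]) auto
    also have "\<dots> \<le> (\<integral>\<^sup>+\<xi>. ennreal ((norm (ft g \<xi>))\<^sup>2) \<partial>lborel)"
      using a[of n] by (intro nn_integral_mono ennreal_leI mult_right_le_one_le) (auto simp: less_imp_le)
    finally show ?thesis .
  qed
  then have "ennreal ((2 * pi) ^ DIM('a) * (LINT x|lborel. (norm (g x))\<^sup>2)) \<le> (\<integral>\<^sup>+\<xi>. ennreal ((norm (ft g \<xi>))\<^sup>2) \<partial>lborel)"
    by (intro LIMSEQ_le_const2[OF tendsto_ennrealI[OF lim]]) auto
  moreover have "integrable lborel (\<lambda>x. (norm (g x))\<^sup>2)"
  proof (rule Bochner_Integration.integrable_bound[OF integrable_mult_right[OF integrable_norm[OF g], of B]])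
    show "AE x in lborel. norm ((norm (g x))\<^sup>2) \<le> norm (B * norm (g x))"
      using B by (auto simp: power2_eq_square intro!: mult_right_mono bdd)
  qed measurable
  then have "(\<integral>\<^sup>+x. ennreal ((norm (g x))\<^sup>2) \<partial>lborel) = ennreal (LINT x|lborel. (norm (g x))\<^sup>2)"
    by (intro nn_integral_eq_integral) auto
  ultimately show ?thesis
    by (simp add: ennreal_mult integral_nonneg_AE)
qed

section \<open>The Poisson kernel at complex times\<close>

text \<open>The substitution \<open>w = u - b / u\<close> reduces the integral to a Gaussian, up to the term carrying
  \<open>b / u\<^sup>2\<close>, which equals the integral itself by \<open>u \<mapsto> b / u\<close>.\<close>

lemma subordination_cov:
  fixes b :: real
  assumes b: "b > 0"
  defines "h \<equiv> \<lambda>u::real. exp (- (u - b / u)\<^sup>2)"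
  shows "h absolutely_integrable_on {0<..}" "integral {0<..} h = sqrt pi / 2"
proof -
  have hm: "h \<in> borel_measurable borel" unfolding h_def by measurable
  define g where "g u = u - b / u" for u :: real
  have g_img: "g ` {0<..} = UNIV"
  proof (intro equalityI subset_UNIV subsetI)
    fix w :: real
    define u where "u = (w + sqrt (w\<^sup>2 + 4 * b)) / 2"
    have s: "sqrt (w\<^sup>2 + 4 * b) > \<bar>w\<bar>" using b by (intro real_less_rsqrt) auto
    have "- w < sqrt (w\<^sup>2 + 4 * b)" using s by (simp add: abs_less_iff)
    then have u: "u > 0" by (simp add: u_def)
    have "(sqrt (w\<^sup>2 + 4 * b))\<^sup>2 = w\<^sup>2 + 4 * b" using b by simp
    then have "u * u = w * u + b" by (simp add: u_def field_simps power2_eq_square)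
    then have "g u = w" using u by (simp add: g_def field_simps)
    then show "w \<in> g ` {0<..}" using u by auto
  qed
  have g_inj: "inj_on g {0<..}"
  proof (rule inj_onI)
    fix x y assume xy: "x \<in> {0<..}" "y \<in> {0<..}" "g x = g y"
    then have "(x - y) * (x * y + b) = 0" by (auto simp: g_def field_simps)
    moreover have "x * y + b > 0" using xy b by (auto intro!: add_pos_pos)
    ultimately show "x = y" by auto
  qed
  have g_der: "(g has_field_derivative (1 + b / u\<^sup>2)) (at u within {0<..})" if "u \<in> {0<..}" for u
    unfolding g_def using that by (auto intro!: derivative_eq_intros simp: power2_eq_square)
  have gauss: "(\<lambda>w::real. exp (- w\<^sup>2)) absolutely_integrable_on UNIV \<and> integral UNIV (\<lambda>w::real. exp (- w\<^sup>2)) = sqrt pi"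
  proof -
    have i: "integrable lborel (\<lambda>w::real. exp (- w\<^sup>2))" and v: "(LINT w::real|lborel. exp (- w\<^sup>2)) = sqrt pi"
      using integrable_gaussian[of 1, where 'a=real] integral_gaussian[of 1, where 'a=real] by simp_all
    have a: "(\<lambda>w::real. exp (- w\<^sup>2)) absolutely_integrable_on UNIV"
      using i by (simp add: set_integrable_def integrable_completion)
    moreover have "integral UNIV (\<lambda>w::real. exp (- w\<^sup>2)) = sqrt pi"
      using v integral_lborel[OF i] by simp
    ultimately show ?thesis by blast
  qed
  have A: "(\<lambda>u. \<bar>1 + b / u\<^sup>2\<bar> * h u) absolutely_integrable_on {0<..} \<and> integral {0<..} (\<lambda>u. \<bar>1 + b / u\<^sup>2\<bar> * h u) = sqrt pi"
    using has_absolute_integral_change_of_variables_1'[OF _ g_der g_inj, of "\<lambda>w. exp (- w\<^sup>2)" "sqrt pi"] gauss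
    unfolding g_img by (simp add: h_def g_def)
  \<comment> \<open>Since 1 + b / u^2 >= 1, \<open>h\<close> is dominated by the integrand of
    \<open>A\<close>.\<close>
  have h_int: "h absolutely_integrable_on {0<..}"
  proof (rule measurable_bounded_by_integrable_imp_absolutely_integrable[OF _ _ conjunct1[OF A, THEN set_lebesgue_integral_eq_integral(1)]])
    show "h \<in> borel_measurable (lebesgue_on {0<..})"
      using hm by (auto intro!: measurable_restrict_space1 measurable_completion)
    show "norm (h u) \<le> \<bar>1 + b / u\<^sup>2\<bar> * h u" if "u \<in> {0<..}" for u
      using that b by (simp add: h_def)
  qed auto
  show "h absolutely_integrable_on {0<..}" by (fact h_int)
  have "(\<lambda>u. \<bar>1 + b / u\<^sup>2\<bar> * h u - h u) absolutely_integrable_on {0<..}"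
    using A h_int by (intro set_integral_diff(1)) auto
  then have B1: "(\<lambda>u. \<bar>b / u\<^sup>2\<bar> * h u) absolutely_integrable_on {0<..}"
    by (rule absolutely_integrable_spike[OF _ negligible_empty]) (use b in \<open>auto simp: algebra_simps\<close>)
  have "integral {0<..} (\<lambda>u. \<bar>b / u\<^sup>2\<bar> * h u) = integral {0<..} (\<lambda>u. \<bar>1 + b / u\<^sup>2\<bar> * h u - h u)"
    using b by (intro Henstock_Kurzweil_Integration.integral_cong) (simp add: algebra_simps)
  also have "\<dots> = sqrt pi - integral {0<..} h"
    using A h_int by (subst Henstock_Kurzweil_Integration.integral_diff) (auto intro: set_lebesgue_integral_eq_integral(1))
  finally have B2: "integral {0<..} (\<lambda>u. \<bar>b / u\<^sup>2\<bar> * h u) = sqrt pi - integral {0<..} h" .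
  \<comment> \<open>The map u -> - b / u has derivative b / u^2 and leaves \<open>h\<close>
    unchanged, but lands on the negative half-line; evenness of \<open>h\<close> brings the integral
    back. So the integral I of \<open>h\<close> satisfies I = sqrt pi - I.\<close>
  have im2: "(\<lambda>u. - b / u) ` {0<..} = {..<0}"
  proof (intro equalityI subsetI)
    fix w :: real assume w: "w \<in> {..<0}"
    then have "w = - b / (- b / w)" "- b / w \<in> {0<..}" using b by (auto simp: field_simps)
    then show "w \<in> (\<lambda>u. - b / u) ` {0<..}" by blast
  qed (use b in auto)
  have inj2: "inj_on (\<lambda>u. - b / u) {0<..}" using b by (auto simp: inj_on_def field_simps)
  have der2: "((\<lambda>u. - b / u) has_field_derivative (b / u\<^sup>2)) (at u within {0<..})" if "u \<in> {0<..}" for u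
    using that by (auto intro!: derivative_eq_intros simp: power2_eq_square)
  have h2: "h (- b / u) = h u" if "u > 0" for u
  proof -
    have "(- b / u - b / (- b / u))\<^sup>2 = (u - b / u)\<^sup>2" using that b by (simp add: field_simps power2_eq_square)
    then show ?thesis by (simp add: h_def)
  qed
  have B1': "(\<lambda>u. \<bar>b / u\<^sup>2\<bar> * h (- b / u)) absolutely_integrable_on {0<..}"
    by (rule absolutely_integrable_spike[OF B1 negligible_empty]) (use h2 in auto)
  have B2': "integral {0<..} (\<lambda>u. \<bar>b / u\<^sup>2\<bar> * h (- b / u)) = sqrt pi - integral {0<..} h"
    unfolding B2[symmetric] by (intro Henstock_Kurzweil_Integration.integral_cong) (use h2 in auto)
  have C: "h absolutely_integrable_on {..<0} \<and> integral {..<0} h = sqrt pi - integral {0<..} h"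
    using has_absolute_integral_change_of_variables_1'[OF _ der2 inj2, of h "sqrt pi - integral {0<..} h"] B1' B2'
    unfolding im2 by simp
  have "integral {..<0} h = integral {0<..} h"
  proof -
    have im3: "uminus ` {0<..} = {..<0::real}"
      by (auto simp: image_iff intro: bexI[of _ "- _"])
    have inj3: "inj_on uminus {0::real<..}" by (simp add: inj_on_def)
    have der3: "(uminus has_field_derivative - 1) (at u within {0<..})" for u :: real
      by (auto intro!: derivative_eq_intros)
    have "(\<lambda>u. \<bar>-1\<bar> * h (- u)) absolutely_integrable_on {0<..} \<and> integral {0<..} (\<lambda>u. \<bar>-1\<bar> * h (- u)) = integral {..<0} h"
      using has_absolute_integral_change_of_variables_1'[OF _ der3 inj3, of h "integral {..<0} h"] C
      unfolding im3 by simp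
    moreover have "h (- u) = h u" for u
    proof -
      have "(- u - b / (- u))\<^sup>2 = (u - b / u)\<^sup>2" by (simp add: power2_eq_square algebra_simps)
      then show ?thesis by (simp add: h_def)
    qed
    ultimately show ?thesis by simp
  qed
  with C show "integral {0<..} h = sqrt pi / 2" by simp
qed

text \<open>Completing the square gives -u^2 - c^2/(4 u^2) = -c - (u - c/(2 u))^2, the integrand of
  \<open>subordination_cov\<close> with \<open>b = c / 2\<close>. Its purpose is to write exp(-c) as
  a superposition of the functions exp(-c^2/(4 u^2)), which are Gaussian in c.\<close>

lemma subordination:
  fixes c :: real
  assumes c: "c \<ge> 0"
  shows "has_bochner_integral lborel (\<lambda>u. indicator {0<..} u * exp (- u\<^sup>2 - c\<^sup>2 / (4 * u\<^sup>2))) (sqrt pi / 2 * exp (- c))"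
proof (cases "c = 0")
  \<comment> \<open>The substitution requires b > 0; at c = 0 the integrand is half a
    Gaussian.\<close>
  case True
  have "has_bochner_integral lborel (\<lambda>u::real. indicator {0<..} u * exp (- u\<^sup>2)) (sqrt pi / 2)"
    by (rule has_bochner_integralI_AE[OF gaussian_moment_0])
      (auto intro!: AE_I[where N="{0}"] split: split_indicator)
  then show ?thesis using True by simp
next
  case False
  define b where "b = c / 2"
  have b: "b > 0" using False c by (simp add: b_def)
  have eq: "indicator {0<..} u * exp (- u\<^sup>2 - c\<^sup>2 / (4 * u\<^sup>2)) = exp (- c) * (indicator {0<..} u *\<^sub>R exp (- (u - b / u)\<^sup>2))" for u
  proof (cases "u > 0")
    case True
    have "- u\<^sup>2 - c\<^sup>2 / (4 * u\<^sup>2) = - c + - (u - b / u)\<^sup>2"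
      using True by (simp add: b_def power2_eq_square field_simps)
    then show ?thesis using True by (simp flip: exp_add)
  qed simp
  note S = subordination_cov[OF b]
  have m: "(\<lambda>u. indicator {0<..} u *\<^sub>R exp (- (u - b / u)\<^sup>2)) \<in> borel_measurable lborel" by measurable
  have "integrable lborel (\<lambda>u. indicator {0<..} u *\<^sub>R exp (- (u - b / u)\<^sup>2))"
    using S(1) m by (simp add: set_integrable_def integrable_completion)
  moreover have "(LINT u|lborel. indicator {0<..} u *\<^sub>R exp (- (u - b / u)\<^sup>2)) = sqrt pi / 2"
    using set_lebesgue_integral_eq_integral(2)[OF S(1)] S(2) m by (simp add: set_lebesgue_integral_def integral_completion)
  ultimately have "has_bochner_integral lborel (\<lambda>u. exp (- c) * (indicator {0<..} u *\<^sub>R exp (- (u - b / u)\<^sup>2))) (exp (- c) * (sqrt pi / 2))"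
    by (intro has_bochner_integral_mult_right) (auto simp: has_bochner_integral_iff)
  then show ?thesis unfolding eq by (simp add: mult.commute)
qed

lemma integrable_power_gaussian: "integrable lborel (\<lambda>u::real. indicator {0<..} u * u ^ d * exp (- k * u\<^sup>2))" if "k > 0"
proof -
  have "integrable lborel (\<lambda>x::real. std_normal_density x * x ^ d)"
    by (rule integrable_std_normal_moment)
  from lborel_integrable_real_affine[OF this, of "sqrt (2 * k)" 0] that
  have "integrable lborel (\<lambda>x::real. std_normal_density (sqrt (2 * k) * x) * (sqrt (2 * k) * x) ^ d)" by simp
  then have "integrable lborel (\<lambda>x::real. (sqrt (2 * pi) / sqrt (2 * k) ^ d) * (std_normal_density (sqrt (2 * k) * x) * (sqrt (2 * k) * x) ^ d))"
    by (intro integrable_mult_right)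
  also have "(\<lambda>x::real. (sqrt (2 * pi) / sqrt (2 * k) ^ d) * (std_normal_density (sqrt (2 * k) * x) * (sqrt (2 * k) * x) ^ d)) = (\<lambda>x. x ^ d * exp (- k * x\<^sup>2))"
  proof
    fix x :: real
    have "std_normal_density (sqrt (2 * k) * x) = exp (- k * x\<^sup>2) / sqrt (2 * pi)"
      using that by (simp add: normal_density_def power_mult_distrib[of "sqrt (2 * k)" x 2])
    moreover have "sqrt (2 * k) ^ d > 0" "k \<noteq> 0" using that by simp_all
    ultimately show "(sqrt (2 * pi) / sqrt (2 * k) ^ d) * (std_normal_density (sqrt (2 * k) * x) * (sqrt (2 * k) * x) ^ d) = x ^ d * exp (- k * x\<^sup>2)"
      unfolding power_mult_distrib by (simp del: real_sqrt_mult)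
  qed
  finally have i: "integrable lborel (\<lambda>x::real. x ^ d * exp (- k * x\<^sup>2))" .
  show ?thesis
    using integrable_mult_indicator[OF _ i, of "{0<..}"] by (simp add: mult.assoc)
qed

text \<open>The integral equals Gamma((d+1)/2) / 2, so this is 2^d pi^((d-1)/2) Gamma((d+1)/2), the
  classical Poisson constant times (2 pi)^d for the unnormalised transform.\<close>

definition poisson_const :: "nat \<Rightarrow> real" where
  "poisson_const d = 2 / sqrt pi * (2 * sqrt pi) ^ d * (LINT u|lborel. indicator {0<..} u * u ^ d * exp (- u\<^sup>2))"

text \<open>Subordination with \<open>c = y * norm \<xi>\<close> makes the integrand Gaussian in
  \<xi>. After the exchange of integrals the one over \<xi> is explicit and a single integral in u
  is left.\<close>

lemma poisson_kernel_real:
  fixes x :: "'a::euclidean_space"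
  assumes y: "y > 0"
  shows "integrable lborel (\<lambda>\<xi>. cis (x \<bullet> \<xi>) * complex_of_real (exp (- y * norm \<xi>)))"
    and "(LINT \<xi>|lborel. cis (x \<bullet> \<xi>) * complex_of_real (exp (- y * norm \<xi>)))
       = complex_of_real (poisson_const DIM('a) * y / sqrt (y\<^sup>2 + (norm x)\<^sup>2) ^ (DIM('a) + 1))"
proof -
  let ?d = "DIM('a)"
  define f :: "real \<Rightarrow> 'a \<Rightarrow> complex" where
    "f u \<xi> = cis (x \<bullet> \<xi>) * complex_of_real (indicator {0<..} u * exp (- u\<^sup>2 - (y * norm \<xi>)\<^sup>2 / (4 * u\<^sup>2)))" for u \<xi>
  have [measurable]: "(\<lambda>(u, \<xi>). f u \<xi>) \<in> borel_measurable (lborel \<Otimes>\<^sub>M lborel)"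
    unfolding f_def by measurable
  have [measurable]: "f u \<in> borel_measurable borel" for u
    unfolding f_def[abs_def] by measurable
  define a where "a u = y\<^sup>2 / (4 * u\<^sup>2)" for u
  have a: "a u > 0" if "u > 0" for u using that y by (simp add: a_def)
  have f_eq: "f u \<xi> = complex_of_real (indicator {0<..} u * exp (- u\<^sup>2)) * (cis (x \<bullet> \<xi>) * complex_of_real (exp (- a u * (norm \<xi>)\<^sup>2)))" for u \<xi>
  proof -
    have "- u\<^sup>2 - (y * norm \<xi>)\<^sup>2 / (4 * u\<^sup>2) = - u\<^sup>2 + (- a u * (norm \<xi>)\<^sup>2)"
      by (simp add: a_def power_mult_distrib)
    then show ?thesis unfolding f_def by (simp only: exp_add of_real_mult mult_ac)
  qed
  have sq: "sqrt (pi / a u) = 2 * sqrt pi * u / y" if "u > 0" for u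
    using that y by (simp add: a_def real_sqrt_divide real_sqrt_mult)
  have f_int: "integrable lborel (f u)" for u
  proof (cases "u > 0")
    case True then show ?thesis unfolding f_eq[abs_def] by (intro integrable_mult_right integrable_cis_gaussian a)
  qed (simp add: f_def[abs_def])
  \<comment> \<open>The transformed Gaussian contributes |x|^2 / (4 a) = u^2 |x|^2 / y^2 to the
    exponent; together with u^2 this is k u^2.\<close>
  define k where "k = 1 + (norm x)\<^sup>2 / y\<^sup>2"
  have k: "k > 0" unfolding k_def by (simp add: add_pos_nonneg)
  have f_norm: "(LINT \<xi>|lborel. norm (f u \<xi>)) = (2 * sqrt pi / y) ^ ?d * (indicator {0<..} u * u ^ ?d * exp (- 1 * u\<^sup>2))" for u
  proof (cases "u > 0")
    case True
    have "(LINT \<xi>|lborel. norm (f u \<xi>)) = exp (- u\<^sup>2) * (LINT \<xi>::'a|lborel. exp (- a u * (norm \<xi>)\<^sup>2))"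
      unfolding f_eq using True by (simp add: norm_mult del: of_real_exp)
    also have "\<dots> = (2 * sqrt pi / y) ^ ?d * (indicator {0<..} u * u ^ ?d * exp (- 1 * u\<^sup>2))"
      using True by (simp only: integral_gaussian[OF a[OF True]] sq[OF True]) (simp add: power_mult_distrib power_divide)
    finally show ?thesis .
  qed (simp add: f_def)
  have f_val: "(LINT \<xi>|lborel. f u \<xi>) = complex_of_real ((2 * sqrt pi / y) ^ ?d * (indicator {0<..} u * u ^ ?d * exp (- k * u\<^sup>2)))" for u
  proof (cases "u > 0")
    case True
    have e: "exp (- u\<^sup>2) * exp (- (norm x)\<^sup>2 / (4 * a u)) = exp (- k * u\<^sup>2)"
    proof -
      have "- u\<^sup>2 + (- (norm x)\<^sup>2 / (4 * a u)) = - k * u\<^sup>2"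
        unfolding a_def k_def using True y by (simp add: field_simps)
      then show ?thesis by (simp only: exp_add[symmetric])
    qed
    have "(LINT \<xi>|lborel. f u \<xi>) = complex_of_real (exp (- u\<^sup>2)) * complex_of_real (sqrt (pi / a u) ^ ?d * exp (- (norm x)\<^sup>2 / (4 * a u)))"
      unfolding f_eq using True integral_cis_gaussian[OF a[OF True], of x] by simp
    also have "\<dots> = complex_of_real (sqrt (pi / a u) ^ ?d * exp (- k * u\<^sup>2))"
      by (simp only: e[symmetric] of_real_mult mult_ac)
    also have "\<dots> = complex_of_real ((2 * sqrt pi / y) ^ ?d * (indicator {0<..} u * u ^ ?d * exp (- k * u\<^sup>2)))"
      using True by (simp only: sq[OF True]) (simp add: power_mult_distrib power_divide)
    finally show ?thesis .
  qed (simp add: f_def)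
  have pair: "integrable (lborel \<Otimes>\<^sub>M lborel) (\<lambda>(u, \<xi>). f u \<xi>)"
  proof (rule lborel_pair.Fubini_integrable)
    show "integrable lborel (\<lambda>u. LINT \<xi>|lborel. norm (case (u, \<xi>) of (u, \<xi>) \<Rightarrow> f u \<xi>))"
      unfolding split_conv f_norm by (intro integrable_mult_right integrable_power_gaussian) simp
  qed (auto simp: f_int)
  have inner: "has_bochner_integral lborel (\<lambda>u. f u \<xi>) (cis (x \<bullet> \<xi>) * complex_of_real (sqrt pi / 2 * exp (- (y * norm \<xi>))))" for \<xi>
    unfolding f_def by (intro has_bochner_integral_mult_right has_bochner_integral_of_real subordination) (use y in auto)
  have inner': "(LINT u|lborel. f u \<xi>) = cis (x \<bullet> \<xi>) * complex_of_real (sqrt pi / 2 * exp (- (y * norm \<xi>)))" for \<xi>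
    using inner by (simp add: has_bochner_integral_iff)
  have "integrable lborel (\<lambda>\<xi>. LINT u|lborel. f u \<xi>)"
    using lborel_pair.integrable_snd[OF pair] by simp
  moreover have inner2: "cis (x \<bullet> \<xi>) * complex_of_real (exp (- y * norm \<xi>)) = complex_of_real (2 / sqrt pi) * (LINT u|lborel. f u \<xi>)" for \<xi>
    unfolding inner' by simp
  ultimately show "integrable lborel (\<lambda>\<xi>. cis (x \<bullet> \<xi>) * complex_of_real (exp (- y * norm \<xi>)))"
    unfolding inner2 by (intro integrable_mult_right)
  have "(LINT \<xi>|lborel. cis (x \<bullet> \<xi>) * complex_of_real (exp (- y * norm \<xi>))) = 
     complex_of_real (2 / sqrt pi) * (LINT \<xi>|lborel. (LINT u|lborel. f u \<xi>))"
    unfolding inner2 by (rule integral_mult_right_zero)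
  also have "(LINT \<xi>|lborel. (LINT u|lborel. f u \<xi>)) = (LINT u|lborel. (LINT \<xi>|lborel. f u \<xi>))"
    by (rule lborel_pair.Fubini_integral[OF pair])
  also have "\<dots> = complex_of_real ((2 * sqrt pi / y) ^ ?d * (LINT u|lborel. indicator {0<..} u * u ^ ?d * exp (- k * u\<^sup>2)))"
    unfolding f_val integral_complex_of_real integral_mult_right_zero ..
  finally have 1: "(LINT \<xi>|lborel. cis (x \<bullet> \<xi>) * complex_of_real (exp (- y * norm \<xi>))) =
    complex_of_real (2 / sqrt pi * (2 * sqrt pi / y) ^ ?d * (LINT u|lborel. indicator {0<..} u * u ^ ?d * exp (- k * u\<^sup>2)))"
    by (simp add: mult.assoc)
  \<comment> \<open>Rescaling by sqrt k yields one factor sqrt k from the Jacobian and d of them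
    from u^d; hence the power d + 1 in the kernel.\<close>
  have "(LINT u|lborel. indicator {0<..} u * u ^ ?d * exp (- u\<^sup>2)) = 
     sqrt k * (LINT u|lborel. indicator {0<..} (sqrt k * u) * (sqrt k * u) ^ ?d * exp (- (sqrt k * u)\<^sup>2))"
    using lborel_integral_real_affine[of "sqrt k" "\<lambda>u. indicator {0<..} u * u ^ ?d * exp (- u\<^sup>2)" 0] k by simp
  also have "(\<lambda>u. indicator {0<..} (sqrt k * u) * (sqrt k * u) ^ ?d * exp (- (sqrt k * u)\<^sup>2)) = 
      (\<lambda>u. sqrt k ^ ?d * (indicator {0<..} u * u ^ ?d * exp (- k * u\<^sup>2)))"
    using k by (auto simp: fun_eq_iff power_mult_distrib zero_less_mult_iff split: split_indicator)
  finally have "(LINT u|lborel. indicator {0<..} u * u ^ ?d * exp (- k * u\<^sup>2)) = (LINT u|lborel. indicator {0<..} u * u ^ ?d * exp (- u\<^sup>2)) / sqrt k ^ (?d + 1)"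
    using k by simp
  note 2 = this
  have "sqrt k = sqrt (y\<^sup>2 + (norm x)\<^sup>2) / y"
    using y by (intro real_sqrt_unique) (auto simp: k_def power_divide field_simps)
  then have 3: "sqrt k ^ (?d + 1) = sqrt (y\<^sup>2 + (norm x)\<^sup>2) ^ (?d + 1) / y ^ (?d + 1)"
    by (simp only: power_divide)
  have "y\<^sup>2 + (norm x)\<^sup>2 > 0" using y by (simp add: add_pos_nonneg)
  then have "2 / sqrt pi * (2 * sqrt pi / y) ^ ?d * (LINT u|lborel. indicator {0<..} u * u ^ ?d * exp (- k * u\<^sup>2)) =
    poisson_const ?d * y / sqrt (y\<^sup>2 + (norm x)\<^sup>2) ^ (?d + 1)"
    unfolding 2 3 poisson_const_def using y by (simp add: power_divide)
  then show "(LINT \<xi>|lborel. cis (x \<bullet> \<xi>) * complex_of_real (exp (- y * norm \<xi>)))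
       = complex_of_real (poisson_const ?d * y / sqrt (y\<^sup>2 + (norm x)\<^sup>2) ^ (?d + 1))"
    unfolding 1 by simp
qed


section \<open>Continuation of the kernel to complex times\<close>

lemma integrable_exp_norm: "integrable lborel (\<lambda>\<xi>::'a::euclidean_space. exp (- a * norm \<xi>))" if "a > 0"
  using integrable_norm[OF poisson_kernel_real(1)[OF that, of "0::'a"]] by (simp del: of_real_exp)

lemma norm_exp_scaled: "norm (exp (- y * complex_of_real r)) = exp (- Re y * r)"
  by (simp add: norm_exp_eq_Re)

lemma exp_scaled_diff_bound:
  assumes "\<alpha> \<ge> 0" "r \<ge> 0" "Re y \<ge> \<alpha>" "Re z \<ge> \<alpha>"
  shows "norm (exp (- y * complex_of_real r) - exp (- z * complex_of_real r)) \<le> r * exp (- \<alpha> * r) * norm (y - z)"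
proof (rule field_differentiable_bound[where S="{z. Re z \<ge> \<alpha>}" and f'="\<lambda>z. - of_real r * exp (- z * complex_of_real r)"])
  show "((\<lambda>z. exp (- z * complex_of_real r)) has_field_derivative - of_real r * exp (- z * complex_of_real r)) (at z within {z. \<alpha> \<le> Re z})" for z
    by (auto intro!: derivative_eq_intros)
  show "norm (- of_real r * exp (- z * complex_of_real r)) \<le> r * exp (- \<alpha> * r)" if "z \<in> {z. \<alpha> \<le> Re z}" for z
    using that assms by (simp only: norm_mult norm_exp_scaled) (auto intro!: mult_left_mono mult_right_mono)
qed (use assms in \<open>auto intro: convex_halfspace_Re_ge\<close>)

text \<open>Difference quotients at y are dominated by one integrable function, so the integral may
  be differentiated. Half of \<open>Re y\<close> is kept as damping for all nearby points, and half
  of that again pays for the factor |\<xi>| produced by differentiation.\<close>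

lemma poisson_kernel_holomorphic:
  fixes x :: "'a::euclidean_space"
  shows "(\<lambda>y. LINT \<xi>|lborel. cis (x \<bullet> \<xi>) * exp (- y * complex_of_real (norm \<xi>))) holomorphic_on {y. 0 < Re y}"
    (is "?F holomorphic_on _")
proof (rule holomorphic_onI, goal_cases)
  case (1 y)
  define \<alpha> where "\<alpha> = Re y / 2"
  have \<alpha>: "\<alpha> > 0" "Re y \<ge> \<alpha>" using 1 by (auto simp: \<alpha>_def)
  have int: "integrable lborel (\<lambda>\<xi>. cis (x \<bullet> \<xi>) * exp (- z * complex_of_real (norm \<xi>)))" if "Re z > 0" for z
    by (rule Bochner_Integration.integrable_bound[OF integrable_exp_norm[OF that]])
       (auto simp: norm_mult norm_exp_scaled simp del: mult_minus_left)
  define D where "D = (LINT \<xi>|lborel. cis (x \<bullet> \<xi>) * (- complex_of_real (norm \<xi>) * exp (- y * complex_of_real (norm \<xi>))))"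
  have "((\<lambda>z. (?F z - ?F y) / (z - y)) \<longlongrightarrow> D) (at y)"
  proof (rule iffD2[OF tendsto_at_iff_sequentially], intro allI impI)
    fix X assume X: "\<forall>i. X i \<in> UNIV - {y}" "X \<longlonglongrightarrow> y"
    have "\<forall>\<^sub>F n in sequentially. Re (X n) > \<alpha>"
      using tendsto_Re[OF X(2)] by (rule order_tendstoD) (use \<alpha> 1 in \<open>simp add: \<alpha>_def\<close>)
    then obtain N where N: "\<And>n. n \<ge> N \<Longrightarrow> Re (X n) > \<alpha>"
      by (auto simp: eventually_sequentially)
    define Y where "Y n = X (n + N)" for n
    have Y: "Y \<longlonglongrightarrow> y" "Y n \<noteq> y" "Re (Y n) > \<alpha>" for n
      unfolding Y_def[abs_def] using X N by (auto intro: LIMSEQ_ignore_initial_segment)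
    let ?q = "\<lambda>n \<xi>. cis (x \<bullet> \<xi>) * ((exp (- Y n * complex_of_real (norm \<xi>)) - exp (- y * complex_of_real (norm \<xi>))) / (Y n - y))"
    have "(\<lambda>n. LINT \<xi>|lborel. ?q n \<xi>) \<longlonglongrightarrow> D"
      unfolding D_def
    proof (rule integral_dominated_convergence[where w="\<lambda>\<xi>. 2 / \<alpha> * exp (- (\<alpha> / 2) * norm \<xi>)"])
      show "integrable lborel (\<lambda>\<xi>::'a. 2 / \<alpha> * exp (- (\<alpha> / 2) * norm \<xi>))"
        using \<alpha> by (intro integrable_mult_right integrable_exp_norm) simp
      show "AE \<xi> in lborel. (\<lambda>n. ?q n \<xi>) \<longlonglongrightarrow> cis (x \<bullet> \<xi>) * (- complex_of_real (norm \<xi>) * exp (- y * complex_of_real (norm \<xi>)))"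
      proof (intro AE_I2 tendsto_mult tendsto_const)
        fix \<xi> :: 'a
        have "((\<lambda>z. exp (- z * complex_of_real (norm \<xi>))) has_field_derivative - complex_of_real (norm \<xi>) * exp (- y * complex_of_real (norm \<xi>))) (at y)"
          by (auto intro!: derivative_eq_intros)
        then have "((\<lambda>z. (exp (- z * complex_of_real (norm \<xi>)) - exp (- y * complex_of_real (norm \<xi>))) / (z - y)) \<longlongrightarrow> - complex_of_real (norm \<xi>) * exp (- y * complex_of_real (norm \<xi>))) (at y)"
          by (simp add: has_field_derivative_iff)
        then show "(\<lambda>n. (exp (- Y n * complex_of_real (norm \<xi>)) - exp (- y * complex_of_real (norm \<xi>))) / (Y n - y)) \<longlonglongrightarrow> - complex_of_real (norm \<xi>) * exp (- y * complex_of_real (norm \<xi>))"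
          using Y unfolding tendsto_at_iff_sequentially comp_def by auto
      qed
      show "AE \<xi> in lborel. norm (?q n \<xi>) \<le> 2 / \<alpha> * exp (- (\<alpha> / 2) * norm \<xi>)" for n
      proof (rule AE_I2)
        fix \<xi> :: 'a
        let ?r = "norm \<xi>"
        have e: "\<alpha> / 2 * ?r \<le> exp (\<alpha> / 2 * ?r)"
          using exp_ge_add_one_self[of "\<alpha> / 2 * ?r"] by linarith
        have "norm (?q n \<xi>) = norm (exp (- Y n * complex_of_real ?r) - exp (- y * complex_of_real ?r)) / norm (Y n - y)"
          by (simp add: norm_mult norm_divide)
        also have "\<dots> \<le> (?r * exp (- \<alpha> * ?r) * norm (Y n - y)) / norm (Y n - y)"
          using \<alpha> Y(3)[of n] by (intro divide_right_mono exp_scaled_diff_bound) auto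
        also have "\<dots> = ?r * exp (- \<alpha> * ?r)" using Y(2)[of n] by simp
        also have "\<dots> = (2 / \<alpha>) * (\<alpha> / 2 * ?r) * exp (- \<alpha> * ?r)" using \<alpha> by simp
        also have "\<dots> \<le> (2 / \<alpha>) * exp (\<alpha> / 2 * ?r) * exp (- \<alpha> * ?r)"
          using \<alpha> by (intro mult_right_mono mult_left_mono e) auto
        also have "\<dots> = 2 / \<alpha> * exp (- (\<alpha> / 2) * ?r)"
          by (simp add: mult.assoc flip: exp_add)
        finally show "norm (?q n \<xi>) \<le> 2 / \<alpha> * exp (- (\<alpha> / 2) * norm \<xi>)" .
      qed
    qed measurable
    also have "(\<lambda>n. LINT \<xi>|lborel. ?q n \<xi>) = (\<lambda>n. (?F (Y n) - ?F y) / (Y n - y))"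
    proof
      fix n
      have Yp: "Re (Y n) > 0" using Y(3)[of n] \<alpha> by simp
      have "?F (Y n) - ?F y = (LINT \<xi>|lborel. cis (x \<bullet> \<xi>) * exp (- Y n * complex_of_real (norm \<xi>)) - cis (x \<bullet> \<xi>) * exp (- y * complex_of_real (norm \<xi>)))"
        by (rule Bochner_Integration.integral_diff[symmetric, OF int int]) (use Yp 1 in auto)
      then show "(LINT \<xi>|lborel. ?q n \<xi>) = (?F (Y n) - ?F y) / (Y n - y)"
        by (simp only: times_divide_eq_right right_diff_distrib integral_divide_zero)
    qed
    finally have "(\<lambda>n. (?F (X (n + N)) - ?F y) / (X (n + N) - y)) \<longlonglongrightarrow> D" by (simp only: Y_def)
    then show "((\<lambda>z. (?F z - ?F y) / (z - y)) \<circ> X) \<longlonglongrightarrow> D"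
      unfolding comp_def by (rule LIMSEQ_offset)
  qed
  then have "(?F has_field_derivative D) (at y)" by (simp add: has_field_derivative_iff)
  then show ?case
    using field_differentiable_at_within field_differentiable_def by blast
qed

text \<open>Keeps the argument of \<open>csqrt\<close> off its branch cut: the imaginary part is 2
  Re y Im y, so a real value forces y to be real, and then the value is positive.\<close>

lemma half_plane_sum_squares:
  assumes "Re y > 0" shows "y\<^sup>2 + (complex_of_real n)\<^sup>2 \<notin> \<real>\<^sub>\<le>\<^sub>0"
proof
  assume "y\<^sup>2 + (complex_of_real n)\<^sup>2 \<in> \<real>\<^sub>\<le>\<^sub>0"
  then have *: "Re (y\<^sup>2 + (complex_of_real n)\<^sup>2) \<le> 0" "Im (y\<^sup>2 + (complex_of_real n)\<^sup>2) = 0"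
    by (simp_all add: complex_nonpos_Reals_iff)
  then have "Im y = 0" using assms by (simp add: power2_eq_square)
  then have "(Re y)\<^sup>2 + n\<^sup>2 \<le> 0" using *(1) by (simp add: power2_eq_square)
  moreover have "(Re y)\<^sup>2 > 0" using assms by simp
  ultimately show False using zero_le_power2[of n] by linarith
qed

text \<open>Both sides are holomorphic in the right half-plane and agree on the positive reals,
  which accumulate at 1, so the identity theorem applies.\<close>

lemma poisson_kernel_complex:
  fixes x :: "'a::euclidean_space"
  assumes y: "Re y > 0"
  shows "(LINT \<xi>|lborel. cis (x \<bullet> \<xi>) * exp (- y * complex_of_real (norm \<xi>))) = 
    complex_of_real (poisson_const DIM('a)) * y / csqrt (y\<^sup>2 + (complex_of_real (norm x))\<^sup>2) ^ (DIM('a) + 1)"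
    (is "?F y = ?G y")
proof -
  have "?F y - ?G y = 0"
  proof (rule analytic_continuation[where f="\<lambda>y. ?F y - ?G y" and S="{y. 0 < Re y}" and U="complex_of_real ` {0<..}" and \<xi>=1])
    have "?G holomorphic_on {y. 0 < Re y}"
    proof -
      have "z\<^sup>2 + (complex_of_real (norm x))\<^sup>2 \<noteq> 0" if "Re z > 0" for z
        using half_plane_sum_squares[OF that, of "norm x"] by auto
      then show ?thesis
        using half_plane_sum_squares by (intro holomorphic_intros) auto
    qed
    then show "(\<lambda>y. ?F y - ?G y) holomorphic_on {y. 0 < Re y}"
      by (intro holomorphic_on_diff poisson_kernel_holomorphic)
    show "1 islimpt complex_of_real ` {0<..}"
    proof -
      have "complex_of_real (1 + e / 2) \<in> complex_of_real ` {0<..} \<and> complex_of_real (1 + e / 2) \<noteq> 1 \<and> dist (complex_of_real (1 + e / 2)) 1 < e"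
        if "e > 0" for e :: real
      proof (intro conjI imageI)
        show "dist (complex_of_real (1 + e / 2)) 1 < e"
          using that by (simp add: dist_norm norm_divide)
      qed (use that in auto)
      then show ?thesis unfolding islimpt_approachable by blast
    qed
    show "?F z - ?G z = 0" if "z \<in> complex_of_real ` {0<..}" for z
    proof -
      from that obtain r where r: "z = complex_of_real r" "r > 0" by auto
      have "?F z = (LINT \<xi>|lborel. cis (x \<bullet> \<xi>) * complex_of_real (exp (- r * norm \<xi>)))"
        unfolding r by (simp flip: exp_of_real)
      also have "\<dots> = ?G z"
      proof -
        have "csqrt ((complex_of_real r)\<^sup>2 + (complex_of_real (norm x))\<^sup>2) = complex_of_real (sqrt (r\<^sup>2 + (norm x)\<^sup>2))"
          by (subst of_real_sqrt) simp_all
        then show ?thesis unfolding poisson_kernel_real(2)[OF r(2)] r by simp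
      qed
      finally show ?thesis by simp
    qed
  qed (use y in \<open>auto intro: open_halfspace_Re_gt convex_connected convex_halfspace_Re_gt\<close>)
  then show ?thesis by simp
qed

lemma poisson_const_nonneg: "poisson_const d \<ge> 0"
  unfolding poisson_const_def by (intro mult_nonneg_nonneg integral_nonneg_AE) (auto split: split_indicator)

text \<open>Since \<open>y\<^sup>2 + \<bar>x\<bar>\<^sup>2 = (y + \<i>\<bar>x\<bar>) (y - \<i>\<bar>x\<bar>)\<close>, one factor is at least \<open>\<bar>y\<bar>\<close> and the other one at
  least \<open>Re y\<close>; for \<open>y = \<rho> - \<i> t\<close> this is the dispersive decay \<open>t\<^bsup>-(d-1)/2\<^esup>\<close> of the wave kernel.\<close>

lemma norm_poisson_kernel_le:
  fixes x :: "'a::euclidean_space"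
  assumes y: "Re y > 0"
  shows "norm (ft (\<lambda>\<xi>. exp (- y * complex_of_real (norm \<xi>))) x) \<le> 
     poisson_const DIM('a) * norm y / sqrt (Re y * norm y) ^ (DIM('a) + 1)"
proof -
  define n where "n = norm x"
  have "Re y * norm y \<le> norm (y\<^sup>2 + (complex_of_real n)\<^sup>2)"
  proof -
    have e: "y\<^sup>2 + (complex_of_real n)\<^sup>2 = (y + \<i> * n) * (y - \<i> * n)"
      by (simp add: power2_eq_square algebra_simps)
    have n: "n \<ge> 0" by (simp add: n_def)
    have 1: "Re y \<le> norm (y + \<i> * n)" "Re y \<le> norm (y - \<i> * n)"
      using complex_Re_le_cmod[of "y + \<i> * n"] complex_Re_le_cmod[of "y - \<i> * n"] by auto
    \<comment> \<open>Moving the imaginary part away from 0 increases the modulus. The sign of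
      \<open>Im y\<close> decides which factor is at least |y|; the other one is bounded below by
      \<open>Re y\<close>.\<close>
    have mono: "norm y \<le> norm z" if "Re y = Re z" "\<bar>Im y\<bar> \<le> \<bar>Im z\<bar>" for z
      using that by (auto simp: cmod_def intro!: real_sqrt_le_mono abs_le_square_iff[THEN iffD1])
    show ?thesis
    proof (cases "Im y \<ge> 0")
      case True
      then have "norm y \<le> norm (y + \<i> * n)" using n by (intro mono) auto
      then have "norm y * Re y \<le> norm (y + \<i> * n) * norm (y - \<i> * n)"
        using 1 y by (intro mult_mono) auto
      then show ?thesis unfolding e norm_mult by (simp add: mult.commute)
    next
      case False
      then have "norm y \<le> norm (y - \<i> * n)" using n by (intro mono) auto
      then have "Re y * norm y \<le> norm (y + \<i> * n) * norm (y - \<i> * n)"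
        using 1 y by (intro mult_mono) auto
      then show ?thesis unfolding e norm_mult .
    qed
  qed
  then have "sqrt (Re y * norm y) ^ (DIM('a) + 1) \<le> norm (csqrt (y\<^sup>2 + (complex_of_real n)\<^sup>2)) ^ (DIM('a) + 1)"
    unfolding norm_csqrt using y by (intro power_mono) auto
  moreover have "sqrt (Re y * norm y) ^ (DIM('a) + 1) > 0"
  proof -
    have "norm y > 0" using y by auto
    then show ?thesis using y by simp
  qed
  moreover have "ft (\<lambda>\<xi>. exp (- y * complex_of_real (norm \<xi>))) x = complex_of_real (poisson_const DIM('a)) * y / csqrt (y\<^sup>2 + (complex_of_real n)\<^sup>2) ^ (DIM('a) + 1)"
    using poisson_kernel_complex[OF y, of x] by (simp add: ft_def inner_commute n_def)
  ultimately show ?thesis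
    by (simp only: norm_divide norm_mult norm_of_real norm_power abs_of_nonneg[OF poisson_const_nonneg])
       (intro divide_left_mono mult_nonneg_nonneg poisson_const_nonneg mult_pos_pos, auto)
qed

section \<open>Dual estimate at one frequency scale\<close>

text \<open>In terms of the sums over groups with equal \<open>l\<close> this is a quadratic form
  with the banded matrix |u - v| < L. Each row has at most 2 L entries, so the arithmetic-geometric
  inequality bounds the form by its diagonal.\<close>

lemma near_pairs_bound:
  fixes l :: "'i \<Rightarrow> int" and g :: "'i \<Rightarrow> complex"
  assumes fin: "finite I"
  shows "norm (\<Sum>i\<in>I. \<Sum>j\<in>I. if \<bar>l i - l j\<bar> < int L then g i * cnj (g j) else 0) \<le>
     2 * real L * (\<Sum>v\<in>l ` I. (norm (\<Sum>i\<in>{i\<in>I. l i = v}. g i))\<^sup>2)"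
proof -
  define V where "V = l ` I"
  define G where "G v = (\<Sum>i\<in>{i\<in>I. l i = v}. g i)" for v
  define near where "near u v = (if \<bar>u - v\<bar> < int L then 1 else 0 :: real)" for u v
  have V: "finite V" using fin by (simp add: V_def)
  have grp: "(\<Sum>i\<in>I. h i) = (\<Sum>v\<in>V. \<Sum>i\<in>{i\<in>I. l i = v}. h i)" for h :: "'i \<Rightarrow> complex"
    using sum.group[OF fin V, of l h] by (simp add: V_def)
  have "(\<Sum>i\<in>I. \<Sum>j\<in>I. if \<bar>l i - l j\<bar> < int L then g i * cnj (g j) else 0) =
     (\<Sum>i\<in>I. \<Sum>j\<in>I. of_real (near (l i) (l j)) * (g i * cnj (g j)))"
    by (intro sum.cong refl) (simp add: near_def)
  also have "\<dots> = (\<Sum>u\<in>V. \<Sum>i\<in>{i\<in>I. l i = u}. \<Sum>v\<in>V. \<Sum>j\<in>{j\<in>I. l j = v}. of_real (near u v) * (g i * cnj (g j)))"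
    by (subst grp, subst grp) (intro sum.cong refl, auto)
  also have "\<dots> = (\<Sum>u\<in>V. \<Sum>v\<in>V. of_real (near u v) * (G u * cnj (G v)))"
  proof -
    have GG: "of_real c * (G u * cnj (G v)) = (\<Sum>i\<in>{i\<in>I. l i = u}. \<Sum>j\<in>{j\<in>I. l j = v}. of_real c * (g i * cnj (g j)))" for c u v
      by (simp only: G_def cnj_sum sum_product) (simp only: sum_distrib_left)
    show ?thesis unfolding GG by (intro sum.cong refl) (rule sum.swap)
  qed
  finally have "norm (\<Sum>i\<in>I. \<Sum>j\<in>I. if \<bar>l i - l j\<bar> < int L then g i * cnj (g j) else 0) \<le>
      (\<Sum>u\<in>V. \<Sum>v\<in>V. near u v * (norm (G u) * norm (G v)))"
    by (simp only:) (intro sum_norm_le order_trans[OF norm_sum] sum_mono, simp add: norm_mult near_def)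
  also have "\<dots> \<le> (\<Sum>u\<in>V. \<Sum>v\<in>V. near u v * ((norm (G u))\<^sup>2 / 2 + (norm (G v))\<^sup>2 / 2))"
  proof (intro sum_mono mult_left_mono)
    show "norm (G u) * norm (G v) \<le> (norm (G u))\<^sup>2 / 2 + (norm (G v))\<^sup>2 / 2" for u v
      using sum_squares_bound[of "norm (G u)" "norm (G v)"] by simp
  qed (simp add: near_def)
  also have "\<dots> = (\<Sum>u\<in>V. \<Sum>v\<in>V. near u v * ((norm (G u))\<^sup>2 / 2)) + (\<Sum>u\<in>V. \<Sum>v\<in>V. near u v * ((norm (G v))\<^sup>2 / 2))"
    by (simp add: distrib_left sum.distrib)
  also have "(\<Sum>u\<in>V. \<Sum>v\<in>V. near u v * ((norm (G v))\<^sup>2 / 2)) = (\<Sum>u\<in>V. \<Sum>v\<in>V. near u v * ((norm (G u))\<^sup>2 / 2))"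
    by (subst sum.swap) (simp add: near_def abs_minus_commute)
  also have "(\<Sum>u\<in>V. \<Sum>v\<in>V. near u v * ((norm (G u))\<^sup>2 / 2)) + (\<Sum>u\<in>V. \<Sum>v\<in>V. near u v * ((norm (G u))\<^sup>2 / 2)) =
     (\<Sum>u\<in>V. (\<Sum>v\<in>V. near u v) * (norm (G u))\<^sup>2)"
    by (simp add: sum_distrib_right flip: sum.distrib)
  also have "\<dots> \<le> (\<Sum>u\<in>V. (2 * real L) * (norm (G u))\<^sup>2)"
  proof (intro sum_mono mult_right_mono)
    fix u
    have "(\<Sum>v\<in>V. near u v) = real (card {v \<in> V. \<bar>u - v\<bar> < int L})"
      using V by (simp add: near_def sum.If_cases Int_def)
    also have "card {v \<in> V. \<bar>u - v\<bar> < int L} \<le> card {u - int L<..<u + int L}"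
      by (intro card_mono) auto
    also have "\<dots> \<le> 2 * L" by simp
    finally show "(\<Sum>v\<in>V. near u v) \<le> 2 * real L" by simp
  qed simp
  finally show ?thesis by (simp add: sum_distrib_left V_def G_def)
qed

lemma powr_half_nat: "sqrt z ^ n = z powr (real n / 2)" if "z > 0"
  using that by (simp add: powr_powr flip: powr_half_sqrt powr_realpow)

text \<open>In \<open>norm_poisson_kernel_le\<close> the modulus of y enters with the exponent
  -(d-1)/2 <= 0, so the lower bound |y| >= \<rho> T suffices. It may come from the real part 4
  \<rho> or from the time difference.\<close>

lemma wave_kernel_bound:
  fixes x :: "'a::euclidean_space"
  assumes \<rho>: "\<rho> > 0" and T: "T > 0" "\<rho> * T \<le> max (4 * \<rho>) \<bar>\<tau>\<bar>"
  shows "norm (ft (\<lambda>\<xi>. exp (- Complex (4 * \<rho>) (- \<tau>) * complex_of_real (norm \<xi>))) x) \<le> 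
    poisson_const DIM('a) * T powr (- (real DIM('a) - 1) / 2) / \<rho> ^ DIM('a)"
proof -
  let ?d = "real DIM('a)"
  define y where "y = Complex (4 * \<rho>) (- \<tau>)"
  define n where "n = norm y"
  have "Re y \<le> n" "\<bar>Im y\<bar> \<le> n" unfolding n_def by (rule complex_Re_le_cmod abs_Im_le_cmod)+
  then have n: "\<rho> * T \<le> n" "n > 0" using T \<rho> by (auto simp: y_def)
  have d: "?d \<ge> 1" by (simp add: Suc_leI)
  have "norm (ft (\<lambda>\<xi>. exp (- y * complex_of_real (norm \<xi>))) x) \<le> poisson_const DIM('a) * n / sqrt (4 * \<rho> * n) ^ (DIM('a) + 1)"
    using norm_poisson_kernel_le[of y x] \<rho> by (simp add: y_def n_def)
  also have "\<dots> = poisson_const DIM('a) * (n / (4 * \<rho> * n) powr ((?d + 1) / 2))"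
    using \<rho> n by (subst powr_half_nat) (auto simp: add.commute)
  also have "n / (4 * \<rho> * n) powr ((?d + 1) / 2) = (4 * \<rho>) powr (- (?d + 1) / 2) * n powr (- (?d - 1) / 2)"
  proof -
    have "n / n powr ((?d + 1) / 2) = n powr 1 / n powr ((?d + 1) / 2)" using n by simp
    also have "\<dots> = n powr (- (?d - 1) / 2)"
      unfolding powr_diff[symmetric] by (rule arg_cong[where f="(powr) n"]) (simp add: field_simps)
    finally have 1: "n / n powr ((?d + 1) / 2) = n powr (- (?d - 1) / 2)" .
    have 2: "(4 * \<rho>) powr (- (?d + 1) / 2) = 1 / (4 * \<rho>) powr ((?d + 1) / 2)"
      by (simp only: minus_divide_left[symmetric] powr_minus_divide)
    have "n / (4 * \<rho> * n) powr ((?d + 1) / 2) = 1 / (4 * \<rho>) powr ((?d + 1) / 2) * (n / n powr ((?d + 1) / 2))"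
      using \<rho> n by (subst powr_mult) auto
    then show ?thesis unfolding 1 2 .
  qed
  also have "\<dots> \<le> \<rho> powr (- (?d + 1) / 2) * (\<rho> * T) powr (- (?d - 1) / 2)"
    using \<rho> T n d by (intro mult_mono powr_mono2') auto
  also have "\<dots> = T powr (- (?d - 1) / 2) / \<rho> ^ DIM('a)"
  proof -
    have "\<rho> powr (- (?d + 1) / 2) * \<rho> powr (- (?d - 1) / 2) = \<rho> powr (- ?d)"
      unfolding powr_add[symmetric] by (rule arg_cong[where f="(powr) \<rho>"]) (simp add: field_simps)
    also have "\<dots> = 1 / \<rho> ^ DIM('a)" using \<rho> by (simp add: powr_minus_divide powr_realpow)
    finally have "\<rho> powr (- (?d + 1) / 2) * \<rho> powr (- (?d - 1) / 2) = 1 / \<rho> ^ DIM('a)" .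
    moreover have "(\<rho> * T) powr (- (?d - 1) / 2) = \<rho> powr (- (?d - 1) / 2) * T powr (- (?d - 1) / 2)"
      using \<rho> T by (intro powr_mult)
    ultimately show ?thesis by (simp add: mult.assoc[symmetric])
  qed
  finally show ?thesis using poisson_const_nonneg[of "DIM('a)"] by (simp add: y_def mult_left_mono)
qed

text \<open>The kernel is measured by its supremum and the two functions in L^1; this is the form in
  which the decay of the wave kernel enters.\<close>

lemma ft_bilinear_bound:
  fixes \<phi> \<psi> w :: "'a::euclidean_space \<Rightarrow> complex"
  assumes \<phi>: "integrable lborel \<phi>" and \<psi>: "integrable lborel \<psi>" and w: "integrable lborel w"
    and K: "\<And>x. norm (ft w x) \<le> K"
  shows "norm (LINT \<xi>|lborel. ft \<phi> \<xi> * cnj (ft \<psi> \<xi>) * w \<xi>) \<le> K * (LINT x|lborel. norm (\<phi> x)) * (LINT x|lborel. norm (\<psi> x))"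
proof -
  have [measurable]: "\<phi> \<in> borel_measurable borel" "\<psi> \<in> borel_measurable borel"
    using \<phi> \<psi> by (auto dest: borel_measurable_integrable)
  have K0: "K \<ge> 0" using K[of 0] norm_ge_zero order_trans by blast
  have i: "(\<integral>\<^sup>+x. ennreal (norm (\<theta> x)) \<partial>lborel) = ennreal (LINT x|lborel. norm (\<theta> x))" if "integrable lborel \<theta>" for \<theta> :: "'a \<Rightarrow> complex"
    using that by (intro nn_integral_eq_integral) auto
  have "ennreal (norm (LINT \<xi>|lborel. ft \<phi> \<xi> * cnj (ft \<psi> \<xi>) * w \<xi>)) \<le> (\<integral>\<^sup>+x. ennreal (norm (\<phi> x)) * ennreal (norm (LINT y|lborel. cnj (\<psi> y) * ft w (x - y))) \<partial>lborel)"
    unfolding ft_bilinear[OF \<phi> \<psi> w]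
    by (rule order_trans[OF norm_integral_le_nn_integral]) (simp add: norm_mult ennreal_mult)
  also have "\<dots> \<le> (\<integral>\<^sup>+x. ennreal (norm (\<phi> x)) * (\<integral>\<^sup>+y. ennreal (norm (\<psi> y)) * ennreal K \<partial>lborel) \<partial>lborel)"
    by (intro nn_integral_mono mult_left_mono order_trans[OF norm_integral_le_nn_integral])
       (auto simp: norm_mult K0 simp flip: ennreal_mult intro!: ennreal_leI mult_left_mono K)
  also have "\<dots> = ennreal (K * (LINT x|lborel. norm (\<phi> x)) * (LINT x|lborel. norm (\<psi> x)))"
    using K0 by (simp add: nn_integral_multc nn_integral_cmult i[OF \<phi>] i[OF \<psi>] ennreal_mult mult_ac integral_nonneg_AE)
  finally show ?thesis
    using K0 by (subst (asm) ennreal_le_iff) (auto intro!: mult_nonneg_nonneg integral_nonneg_AE)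
qed

lemma ft_sum:
  assumes "\<And>i. i \<in> I \<Longrightarrow> integrable lborel (\<phi> i)"
  shows "ft (\<lambda>x. \<Sum>i\<in>I. c i * \<phi> i x) \<xi> = (\<Sum>i\<in>I. c i * ft (\<phi> i) \<xi>)"
proof -
  have int: "integrable lborel (\<lambda>x. cis (x \<bullet> \<xi>) * \<phi> i x)" if "i \<in> I" for i
    by (rule Bochner_Integration.integrable_bound[OF assms[OF that]])
       (use borel_measurable_integrable[OF assms[OF that]] in \<open>auto simp: norm_mult\<close>)
  have "ft (\<lambda>x. \<Sum>i\<in>I. c i * \<phi> i x) \<xi> = (LINT x|lborel. (\<Sum>i\<in>I. c i * (cis (x \<bullet> \<xi>) * \<phi> i x)))"
    unfolding ft_def by (simp add: sum_distrib_left mult_ac)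
  also have "\<dots> = (\<Sum>i\<in>I. c i * ft (\<phi> i) \<xi>)"
    unfolding ft_def using int by (subst Bochner_Integration.integral_sum) auto
  finally show ?thesis .
qed

lemma exp_term_le:
  assumes "z \<ge> (0::real)" shows "z ^ n / fact n \<le> exp z"
proof -
  have "z ^ n / fact n = (\<Sum>k\<in>{n}. z ^ k /\<^sub>R fact k)" by (simp add: divide_inverse mult.commute)
  also have "\<dots> \<le> (\<Sum>k. z ^ k /\<^sub>R fact k)"
    by (rule sum_le_suminf) (use assms summable_exp_generic[of z] in auto)
  finally show ?thesis by (simp add: exp_def)
qed

text \<open>Time intervals of length \<open>\<rho>\<close> cost only a constant, because on the support of the weight the
  Taylor series of the time factor converges geometrically.\<close>

lemma short_time_bound:
  fixes A :: "'i \<Rightarrow> 'a::euclidean_space set" and \<phi> :: "'i \<Rightarrow> 'a \<Rightarrow> complex"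
  assumes I: "finite I" and disj: "disjoint_family_on A I"
    and A: "\<And>i. i \<in> I \<Longrightarrow> A i \<in> sets borel" "\<And>i. i \<in> I \<Longrightarrow> emeasure lborel (A i) < \<infinity>"
    and \<phi>: "\<And>i. i \<in> I \<Longrightarrow> \<phi> i \<in> borel_measurable borel" "\<And>i x. i \<in> I \<Longrightarrow> norm (\<phi> i x) \<le> indicator (A i) x"
    and \<rho>: "\<rho> > 0" and t: "\<And>i. i \<in> I \<Longrightarrow> a \<le> t i \<and> t i \<le> a + \<rho>"
  shows "(\<integral>\<^sup>+\<xi>. ennreal ((norm (\<Sum>i\<in>I. cis (t i * norm \<xi>) * ft (\<phi> i) \<xi>))\<^sup>2 * exp (- (4 * \<rho>) * norm \<xi>)) \<partial>lborel)
    \<le> ennreal (4 * (2 * pi) ^ DIM('a)) * (\<Sum>i\<in>I. emeasure lborel (A i))"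
proof -
  \<comment> \<open>Times relative to the interval in units of \<rho>, so that all powers
    \<open>s i ^ n\<close> stay in [0,1].\<close>
  define s where "s i = (t i - a) / \<rho>" for i
  have s: "0 \<le> s i" "s i \<le> 1" if "i \<in> I" for i using t[OF that] \<rho> by (auto simp: s_def field_simps)
  \<comment> \<open>The spatial function that collects the Taylor terms of order n from all i.
    Because the sets are disjoint it is bounded by an indicator, uniformly in n and however many
    times occur.\<close>
  define \<psi> where "\<psi> n x = (\<Sum>i\<in>I. of_real (s i ^ n) * \<phi> i x)" for n x
  have \<phi>_int: "integrable lborel (\<phi> i)" if "i \<in> I" for i
  proof (rule Bochner_Integration.integrable_bound[of _ "indicator (A i) :: 'a \<Rightarrow> real"])
    show "integrable lborel (indicator (A i) :: 'a \<Rightarrow> real)"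
      using A[OF that] by (intro integrable_real_indicator) auto
  qed (use \<phi> that in auto)
  have \<psi>_int: "integrable lborel (\<psi> n)" for n
    unfolding \<psi>_def[abs_def] by (intro Bochner_Integration.integrable_sum integrable_mult_right \<phi>_int)
  have [measurable]: "\<psi> n \<in> borel_measurable borel" for n
    using \<psi>_int[of n] by (auto dest: borel_measurable_integrable)
  have \<psi>_le: "norm (\<psi> n x) \<le> indicator (\<Union>i\<in>I. A i) x" for n x
  proof -
    have "norm (\<psi> n x) \<le> (\<Sum>i\<in>I. indicator (A i) x)"
      unfolding \<psi>_def
    proof (rule sum_norm_le)
      fix i assume i: "i \<in> I"
      have "s i ^ n \<le> 1" using s[OF i] by (simp add: power_le_one)
      then have "s i ^ n * norm (\<phi> i x) \<le> 1 * indicator (A i) x"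
        using \<phi>(2)[OF i, of x] s[OF i] by (intro mult_mono) auto
      then show "norm (of_real (s i ^ n) * \<phi> i x) \<le> indicator (A i) x"
        using s[OF i] by (simp add: norm_mult norm_power)
    qed
    also have "\<dots> = indicator (\<Union>i\<in>I. A i) x"
      by (rule indicator_UN_disjoint[OF I disj, symmetric])
    finally show ?thesis .
  qed
  define b where "b n \<xi> = norm (ft (\<psi> n) \<xi>)" for n \<xi>
  have b0: "b n \<xi> \<ge> 0" for n \<xi> by (simp add: b_def)
  define B where "B = (LINT x|lborel. (indicator (\<Union>i\<in>I. A i) x :: real))"
  have finU: "emeasure lborel (\<Union>i\<in>I. A i) < \<infinity>"
    using A I by (intro le_less_trans[OF emeasure_subadditive_finite]) (auto simp: ennreal_sum_less_top less_top)
  have b_le: "b n \<xi> \<le> B" for n \<xi>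
    unfolding b_def B_def
  proof (rule order_trans[OF norm_ft_le integral_mono])
    show "integrable lborel (indicator (\<Union>i\<in>I. A i) :: 'a \<Rightarrow> real)"
      using A I finU by (intro integrable_real_indicator) auto
  qed (use \<psi>_int \<psi>_le in auto)
  have pt: "(norm (\<Sum>i\<in>I. cis (t i * norm \<xi>) * ft (\<phi> i) \<xi>))\<^sup>2 * exp (- (4 * \<rho>) * norm \<xi>) \<le> 2 * (\<Sum>n. (1 / 2) ^ n * (b n \<xi>)\<^sup>2)"
    and summ2: "summable (\<lambda>n. (1 / 2) ^ n * (b n \<xi>)\<^sup>2)" for \<xi>
  proof -
    define r where "r = norm \<xi>"
    have r: "r \<ge> 0" by (simp add: r_def)
    let ?c = "\<lambda>n. (\<i> * of_real (\<rho> * r)) ^ n /\<^sub>R fact n"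
    have "(\<lambda>n. \<Sum>i\<in>I. (?c n * of_real (s i ^ n)) * ft (\<phi> i) \<xi>) sums (\<Sum>i\<in>I. cis ((t i - a) * r) * ft (\<phi> i) \<xi>)"
    proof (intro sums_sum sums_mult2)
      fix i
      have "(\<lambda>n. (\<i> * of_real ((t i - a) * r)) ^ n /\<^sub>R fact n) sums exp (\<i> * of_real ((t i - a) * r))"
        by (rule exp_converges)
      moreover have "(\<i> * of_real ((t i - a) * r)) ^ n /\<^sub>R fact n = ?c n * of_real (s i ^ n)" for n
      proof -
        have "complex_of_real ((t i - a) * r) = of_real (\<rho> * r) * of_real (s i)"
          using \<rho> by (simp add: s_def)
        then show ?thesis
          by (simp only: mult.assoc[symmetric] power_mult_distrib of_real_power mult_scaleR_left)
      qed
      ultimately show "(\<lambda>n. ?c n * of_real (s i ^ n)) sums cis ((t i - a) * r)"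
        by (simp add: cis_conv_exp)
    qed
    also have "(\<lambda>n. \<Sum>i\<in>I. (?c n * of_real (s i ^ n)) * ft (\<phi> i) \<xi>) = (\<lambda>n. ?c n * ft (\<psi> n) \<xi>)"
      unfolding \<psi>_def by (subst ft_sum[OF \<phi>_int]) (auto simp: sum_distrib_left mult.assoc)
    finally have S: "(\<lambda>n. ?c n * ft (\<psi> n) \<xi>) sums (\<Sum>i\<in>I. cis ((t i - a) * r) * ft (\<phi> i) \<xi>)" .
    have "cis (t i * r) = cis (a * r) * cis ((t i - a) * r)" for i
      by (simp add: cis_mult algebra_simps)
    then have "(\<Sum>i\<in>I. cis (t i * r) * ft (\<phi> i) \<xi>) = cis (a * r) * (\<Sum>i\<in>I. cis ((t i - a) * r) * ft (\<phi> i) \<xi>)"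
      by (simp add: sum_distrib_left mult.assoc)
    then have "norm (\<Sum>i\<in>I. cis (t i * r) * ft (\<phi> i) \<xi>) = norm (\<Sum>n. ?c n * ft (\<psi> n) \<xi>)"
      using sums_unique[OF S] by (simp add: norm_mult)
    then have eq: "norm (\<Sum>i\<in>I. cis (t i * r) * ft (\<phi> i) \<xi>) * exp (- (2 * \<rho>) * r) = norm (\<Sum>n. of_real (exp (- (2 * \<rho>) * r)) * (?c n * ft (\<psi> n) \<xi>))"
      using sums_summable[OF S] by (subst suminf_mult) (auto simp: norm_mult mult.commute simp del: of_real_exp)
    \<comment> \<open>The factor exp(-2 \<rho> r) absorbs (2 \<rho> r)^n / n! and leaves the
      geometric factor 2^-n; the full weight exp(-4 \<rho> r) is its square.\<close>
    have term_le: "norm (of_real (exp (- (2 * \<rho>) * r)) * (?c n * ft (\<psi> n) \<xi>)) \<le> (1 / 2) ^ n * b n \<xi>" for n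
    proof -
      have "(2 * \<rho> * r) ^ n / fact n \<le> exp (2 * \<rho> * r)" using \<rho> r by (intro exp_term_le) simp
      then have "(1 / 2) ^ n * ((2 * \<rho> * r) ^ n / fact n) * exp (- (2 * \<rho>) * r) \<le> (1 / 2) ^ n * exp (2 * \<rho> * r) * exp (- (2 * \<rho>) * r)"
        by (intro mult_right_mono mult_left_mono) auto
      also have "\<dots> = (1 / 2) ^ n" by (simp add: mult.assoc flip: exp_add)
      also have "(1 / 2) ^ n * ((2 * \<rho> * r) ^ n / fact n) = (\<rho> * r) ^ n / fact n"
        by (simp add: power_mult_distrib power_divide)
      finally have "(\<rho> * r) ^ n / fact n * exp (- (2 * \<rho>) * r) * b n \<xi> \<le> (1 / 2) ^ n * b n \<xi>"
        by (intro mult_right_mono b0)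
      moreover have "norm (?c n) = (\<rho> * r) ^ n / fact n"
        using \<rho> r by (simp add: norm_power norm_mult divide_inverse mult.commute)
      then have "norm (of_real (exp (- (2 * \<rho>) * r)) * (?c n * ft (\<psi> n) \<xi>)) = (\<rho> * r) ^ n / fact n * exp (- (2 * \<rho>) * r) * b n \<xi>"
        by (simp only: norm_mult norm_of_real abs_exp_cancel b_def mult_ac)
      ultimately show ?thesis by simp
    qed
    have exp4: "(exp (- (2 * \<rho>) * r))\<^sup>2 = exp (- (4 * \<rho>) * r)"
      by (simp add: power2_eq_square flip: exp_add)
    have summ1: "summable (\<lambda>n. (1 / 2) ^ n * b n \<xi>)"
      by (rule summable_comparison_test'[of "\<lambda>n. (1 / 2) ^ n * B" 0])
         (auto intro!: summable_mult2 summable_geometric mult_left_mono simp: abs_mult b0 b_le)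
    show summ2: "summable (\<lambda>n. (1 / 2) ^ n * (b n \<xi>)\<^sup>2)"
      by (rule summable_comparison_test'[of "\<lambda>n. (1 / 2) ^ n * B\<^sup>2" 0])
         (auto intro!: summable_mult2 summable_geometric mult_left_mono power_mono simp: abs_mult b0 b_le)
    have "norm (\<Sum>n. of_real (exp (- (2 * \<rho>) * r)) * (?c n * ft (\<psi> n) \<xi>)) \<le> (\<Sum>n. (1 / 2) ^ n * b n \<xi>)"
      by (rule norm_suminf_le[OF term_le summ1])
    then have "(norm (\<Sum>i\<in>I. cis (t i * r) * ft (\<phi> i) \<xi>) * exp (- (2 * \<rho>) * r))\<^sup>2 \<le> (\<Sum>n. (1 / 2) ^ n * b n \<xi>)\<^sup>2"
      unfolding eq by (intro power_mono) auto
    also have "\<dots> \<le> 2 * (\<Sum>n. (1 / 2) ^ n * (b n \<xi>)\<^sup>2)"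
    proof (rule LIMSEQ_le_const2)
      show "(\<lambda>N. (\<Sum>n<N. (1 / 2) ^ n * b n \<xi>)\<^sup>2) \<longlonglongrightarrow> (\<Sum>n. (1 / 2) ^ n * b n \<xi>)\<^sup>2"
        by (intro tendsto_intros summable_LIMSEQ summ1)
      \<comment> \<open>Cauchy-Schwarz with the weight 2^-n shared equally between the two factors;
        the total weight is at most 2.\<close>
      have "(\<Sum>n<N. (1 / 2) ^ n * b n \<xi>)\<^sup>2 \<le> 2 * (\<Sum>n. (1 / 2) ^ n * (b n \<xi>)\<^sup>2)" for N
      proof -
        have sq: "sqrt ((1 / 2) ^ n) * sqrt ((1 / 2) ^ n) = (1 / 2) ^ n" for n
          by (rule real_sqrt_mult_self[THEN trans]) simp
        have "(\<Sum>n<N. (1 / 2) ^ n * b n \<xi>)\<^sup>2 = (\<Sum>n<N. sqrt ((1 / 2) ^ n) * (sqrt ((1 / 2) ^ n) * b n \<xi>))\<^sup>2"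
          unfolding mult.assoc[symmetric] sq ..
        also have "\<dots> \<le> (\<Sum>n<N. (sqrt ((1 / 2) ^ n))\<^sup>2) * (\<Sum>n<N. (sqrt ((1 / 2) ^ n) * b n \<xi>)\<^sup>2)"
          by (rule Cauchy_Schwarz_ineq_sum)
        also have "\<dots> = (\<Sum>n<N. (1 / 2) ^ n) * (\<Sum>n<N. (1 / 2) ^ n * (b n \<xi>)\<^sup>2)"
          unfolding power_mult_distrib power2_eq_square[of "sqrt _"] sq ..
        also have "\<dots> \<le> 2 * (\<Sum>n. (1 / 2) ^ n * (b n \<xi>)\<^sup>2)"
        proof (rule mult_mono)
          have "(\<Sum>n<N. (1 / 2 :: real) ^ n) \<le> (\<Sum>n. (1 / 2) ^ n)"
            by (intro sum_le_suminf summable_geometric) auto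
          then show "(\<Sum>n<N. (1 / 2 :: real) ^ n) \<le> 2" by (simp add: suminf_geometric)
          show "(\<Sum>n<N. (1 / 2) ^ n * (b n \<xi>)\<^sup>2) \<le> (\<Sum>n. (1 / 2) ^ n * (b n \<xi>)\<^sup>2)"
            by (intro sum_le_suminf summ2) auto
        qed (auto intro!: sum_nonneg)
        finally show ?thesis .
      qed
      then show "\<exists>N. \<forall>n\<ge>N. (\<Sum>n<n. (1 / 2) ^ n * b n \<xi>)\<^sup>2 \<le> 2 * (\<Sum>n. (1 / 2) ^ n * (b n \<xi>)\<^sup>2)" by blast
    qed
    finally show "(norm (\<Sum>i\<in>I. cis (t i * norm \<xi>) * ft (\<phi> i) \<xi>))\<^sup>2 * exp (- (4 * \<rho>) * norm \<xi>) \<le> 2 * (\<Sum>n. (1 / 2) ^ n * (b n \<xi>)\<^sup>2)"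
      unfolding power_mult_distrib r_def exp4[unfolded r_def] .
  qed
  have "(\<integral>\<^sup>+\<xi>. ennreal ((norm (\<Sum>i\<in>I. cis (t i * norm \<xi>) * ft (\<phi> i) \<xi>))\<^sup>2 * exp (- (4 * \<rho>) * norm \<xi>)) \<partial>lborel)
    \<le> (\<integral>\<^sup>+\<xi>. 2 * (\<Sum>n. ennreal ((1 / 2) ^ n) * ennreal ((b n \<xi>)\<^sup>2)) \<partial>lborel)"
  proof (rule nn_integral_mono)
    fix \<xi> :: 'a
    have "2 * (\<Sum>n. ennreal ((1 / 2) ^ n) * ennreal ((b n \<xi>)\<^sup>2)) = ennreal (2 * (\<Sum>n. (1 / 2) ^ n * (b n \<xi>)\<^sup>2))"
      using suminf_ennreal_eq[OF _ summable_sums[OF summ2[of \<xi>]]] summ2[of \<xi>]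
      by (simp add: ennreal_mult suminf_nonneg)
    then show "ennreal ((norm (\<Sum>i\<in>I. cis (t i * norm \<xi>) * ft (\<phi> i) \<xi>))\<^sup>2 * exp (- (4 * \<rho>) * norm \<xi>)) \<le> 2 * (\<Sum>n. ennreal ((1 / 2) ^ n) * ennreal ((b n \<xi>)\<^sup>2))"
      using ennreal_leI[OF pt[of \<xi>]] by simp
  qed
  also have "\<dots> = 2 * (\<Sum>n. ennreal ((1 / 2) ^ n) * (\<integral>\<^sup>+\<xi>. ennreal ((norm (ft (\<psi> n) \<xi>))\<^sup>2) \<partial>lborel))"
    by (simp add: b_def nn_integral_cmult nn_integral_suminf)
  \<comment> \<open>Plancherel for each order separately: every \<open>\<psi> n\<close> has energy
    at most the measure of the union, and the sum over the orders gives the second factor 2 of the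
    constant 4.\<close>
  also have "\<dots> \<le> 2 * (\<Sum>n. ennreal ((1 / 2) ^ n) * (ennreal ((2 * pi) ^ DIM('a)) * (\<Sum>i\<in>I. emeasure lborel (A i))))"
  proof (intro mult_left_mono suminf_le)
    fix n
    have "(\<integral>\<^sup>+x. ennreal ((norm (\<psi> n x))\<^sup>2) \<partial>lborel) \<le> (\<integral>\<^sup>+x. indicator (\<Union>i\<in>I. A i) x \<partial>lborel)"
    proof (rule nn_integral_mono)
      fix x :: 'a
      have "(norm (\<psi> n x))\<^sup>2 \<le> (indicator (\<Union>i\<in>I. A i) x)\<^sup>2"
        by (intro power_mono \<psi>_le) simp
      also have "\<dots> = indicator (\<Union>i\<in>I. A i) x" by (simp split: split_indicator)
      finally show "ennreal ((norm (\<psi> n x))\<^sup>2) \<le> indicator (\<Union>i\<in>I. A i) x"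
        by (metis ennreal_indicator ennreal_leI)
    qed
    also have "\<dots> = emeasure lborel (\<Union>i\<in>I. A i)"
      using A I by (intro nn_integral_indicator) auto
    also have "\<dots> \<le> (\<Sum>i\<in>I. emeasure lborel (A i))"
      using A I by (intro emeasure_subadditive_finite) auto
    finally show "(\<integral>\<^sup>+\<xi>. ennreal ((norm (ft (\<psi> n) \<xi>))\<^sup>2) \<partial>lborel) \<le> ennreal ((2 * pi) ^ DIM('a)) * (\<Sum>i\<in>I. emeasure lborel (A i))"
      by (intro order_trans[OF Plancherel_le[OF \<psi>_int]] mult_left_mono) auto
  qed auto
  also have "\<dots> = 2 * ((\<Sum>n. ennreal ((1 / 2) ^ n)) * (ennreal ((2 * pi) ^ DIM('a)) * (\<Sum>i\<in>I. emeasure lborel (A i))))"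
    by simp
  also have "(\<Sum>n. ennreal ((1 / 2) ^ n)) = ennreal 2"
    by (rule suminf_ennreal_eq) (use geometric_sums[of "1/2::real"] in auto)
  finally show ?thesis by (simp add: ennreal_mult mult.assoc[symmetric])
qed


text \<open>With \<open>X\<close> and \<open>T\<close> as in \<open>wave_dual_bound\<close>: near
  pairs give 2 L times 4 (2 pi)^d M with L <= 2 X, hence the 16; far pairs give the kernel constant,
  and T >= X / 2 produces the power of 2.\<close>

definition dual_const :: "nat \<Rightarrow> real" where
  "dual_const d = 16 * (2 * pi) ^ d + poisson_const d * 2 powr ((real d - 1) / 2)"

text \<open>Near pairs of time intervals are controlled by orthogonality in \<open>L\<^sup>2\<close> and far pairs by the decay of
  the kernel; the threshold \<open>L\<close> balances the two contributions.\<close>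

lemma wave_dual_bound:
  fixes A :: "'i \<Rightarrow> 'a::euclidean_space set" and \<phi> :: "'i \<Rightarrow> 'a \<Rightarrow> complex"
  assumes I: "finite I" and disj: "disjoint_family_on A I"
    and A: "\<And>i. i \<in> I \<Longrightarrow> A i \<in> sets borel" "\<And>i. i \<in> I \<Longrightarrow> emeasure lborel (A i) < \<infinity>"
    and \<phi>: "\<And>i. i \<in> I \<Longrightarrow> \<phi> i \<in> borel_measurable borel" "\<And>i x. i \<in> I \<Longrightarrow> norm (\<phi> i x) \<le> indicator (A i) x"
    and \<rho>: "\<rho> > 0"
  defines "M \<equiv> \<Sum>i\<in>I. measure lborel (A i)"
  shows "(\<integral>\<^sup>+\<xi>. ennreal ((norm (\<Sum>i\<in>I. cis (t i * norm \<xi>) * ft (\<phi> i) \<xi>))\<^sup>2 * exp (- (4 * \<rho>) * norm \<xi>)) \<partial>lborel)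
    \<le> ennreal (dual_const DIM('a) * M * (M / \<rho> ^ DIM('a)) powr (2 / (real DIM('a) + 1)))"
proof -
  let ?d = "real DIM('a)"
  \<comment> \<open>Since M / \<rho>^d = X^((d+1)/2), the near contribution L M and the far
    contribution M^2 \<rho>^(-d) L^(-(d-1)/2) both become M X for L comparable to X.\<close>
  define X where "X = (M / \<rho> ^ DIM('a)) powr (2 / (?d + 1))"
  \<comment> \<open>Rounding down allows L = 0 for small X; then every pair counts as far, and the
    maximum in \<open>T\<close> keeps the kernel bound meaningful.\<close>
  define L where "L = nat \<lfloor>2 * X\<rfloor>"
  define T where "T = max 1 (real L / 2)"
  define l where "l i = \<lfloor>t i / \<rho>\<rfloor>" for i
  define w where "w \<tau> \<xi> = exp (- Complex (4 * \<rho>) (- \<tau>) * complex_of_real (norm \<xi>))" for \<tau> and \<xi> :: 'a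
  define g where "g \<xi> i = cis (t i * norm \<xi>) * ft (\<phi> i) \<xi>" for \<xi> i
  define e where "e \<xi> = exp (- (4 * \<rho>) * norm \<xi>)" for \<xi> :: 'a
  define Kb where "Kb = poisson_const DIM('a) * T powr (- (?d - 1) / 2) / \<rho> ^ DIM('a)"
  have d: "?d \<ge> 1" by (simp add: Suc_leI)
  have X0: "X \<ge> 0" by (simp add: X_def)
  have M0: "M \<ge> 0" by (simp add: M_def sum_nonneg)
  have L: "real L \<le> 2 * X" "real L \<ge> 2 * X - 1" using X0 by (auto simp: L_def)
  have T: "T \<ge> 1" "T \<ge> X / 2" using L by (auto simp: T_def)
  have Kb0: "Kb \<ge> 0" using poisson_const_nonneg[of "DIM('a)"] \<rho> by (simp add: Kb_def)
  have [measurable]: "\<phi> i \<in> borel_measurable borel" if "i \<in> I" for i by (rule \<phi>(1)[OF that])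
  have w_eq: "w \<tau> \<xi> = cis (\<tau> * norm \<xi>) * of_real (e \<xi>)" for \<tau> \<xi>
  proof -
    have "- Complex (4 * \<rho>) (- \<tau>) * complex_of_real (norm \<xi>) = \<i> * of_real (\<tau> * norm \<xi>) + of_real (- (4 * \<rho>) * norm \<xi>)"
      by (simp add: complex_eq_iff)
    then show ?thesis unfolding w_def e_def cis_conv_exp by (simp only: exp_add exp_of_real)
  qed
  have [measurable]: "e \<in> borel_measurable borel" unfolding e_def by measurable
  have e0: "e \<xi> > 0" for \<xi> by (simp add: e_def)
  have e_int: "integrable lborel e" unfolding e_def[abs_def] using \<rho> by (intro integrable_exp_norm) simp
  have w_int: "integrable lborel (w \<tau>)" for \<tau>
    by (rule Bochner_Integration.integrable_bound[OF e_int]) (auto simp: w_eq[abs_def] norm_mult)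
  have \<phi>_int: "integrable lborel (\<phi> i)" and \<phi>_m: "(LINT x|lborel. norm (\<phi> i x)) \<le> measure lborel (A i)" if "i \<in> I" for i
  proof -
    have ind: "integrable lborel (indicator (A i) :: 'a \<Rightarrow> real)"
      using A[OF that] by (intro integrable_real_indicator) auto
    show i: "integrable lborel (\<phi> i)"
      by (rule Bochner_Integration.integrable_bound[OF ind]) (use \<phi> that in auto)
    have "(LINT x|lborel. norm (\<phi> i x)) \<le> (LINT x|lborel. indicator (A i) x)"
      by (rule integral_mono[OF integrable_norm[OF i] ind]) (use \<phi> that in auto)
    then show "(LINT x|lborel. norm (\<phi> i x)) \<le> measure lborel (A i)" using A[OF that] by simp
  qed
  have g_meas: "(\<lambda>\<xi>. g \<xi> i) \<in> borel_measurable borel" if "i \<in> I" for i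
    using that unfolding g_def by measurable
  have term_eq: "g \<xi> i * cnj (g \<xi> j) * of_real (e \<xi>) = ft (\<phi> i) \<xi> * cnj (ft (\<phi> j) \<xi>) * w (t i - t j) \<xi>" for \<xi> i j
  proof -
    have "cis (t i * norm \<xi>) * cnj (cis (t j * norm \<xi>)) = cis ((t i - t j) * norm \<xi>)"
      by (simp add: cis_cnj cis_mult left_diff_distrib)
    then show ?thesis unfolding w_eq g_def by (simp add: mult_ac)
  qed
  have term_int: "integrable lborel (\<lambda>\<xi>. g \<xi> i * cnj (g \<xi> j) * of_real (e \<xi>))" if ij: "i \<in> I" "j \<in> I" for i j
  proof (rule Bochner_Integration.integrable_bound[OF integrable_mult_right[OF e_int, of "measure lborel (A i) * measure lborel (A j)"]])
    show "(\<lambda>\<xi>. g \<xi> i * cnj (g \<xi> j) * of_real (e \<xi>)) \<in> borel_measurable lborel"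
      using g_meas[OF ij(1)] g_meas[OF ij(2)] by measurable
    show "AE \<xi> in lborel. norm (g \<xi> i * cnj (g \<xi> j) * of_real (e \<xi>)) \<le> norm (measure lborel (A i) * measure lborel (A j) * e \<xi>)"
      using e0 order_trans[OF norm_ft_le \<phi>_m[OF ij(1)]] order_trans[OF norm_ft_le \<phi>_m[OF ij(2)]]
      by (auto simp: g_def norm_mult less_imp_le intro!: mult_mono)
  qed
  define N where "N \<xi> = (\<Sum>i\<in>I. \<Sum>j\<in>I. if \<bar>l i - l j\<bar> < int L then g \<xi> i * cnj (g \<xi> j) else 0)" for \<xi>
  define F where "F \<xi> = (\<Sum>i\<in>I. \<Sum>j\<in>I. if \<bar>l i - l j\<bar> < int L then 0 else g \<xi> i * cnj (g \<xi> j))" for \<xi>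
  have NF: "complex_of_real ((norm (\<Sum>i\<in>I. g \<xi> i))\<^sup>2) = N \<xi> + F \<xi>" for \<xi>
  proof -
    have "complex_of_real ((norm (\<Sum>i\<in>I. g \<xi> i))\<^sup>2) = (\<Sum>i\<in>I. g \<xi> i) * cnj (\<Sum>i\<in>I. g \<xi> i)"
      by (rule complex_norm_square)
    also have "\<dots> = (\<Sum>i\<in>I. \<Sum>j\<in>I. g \<xi> i * cnj (g \<xi> j))" by (simp add: sum_product)
    also have "\<dots> = N \<xi> + F \<xi>"
      unfolding N_def F_def sum.distrib[symmetric] by (intro sum.cong refl) simp
    finally show ?thesis .
  qed
  have Ne: "N \<xi> * of_real (e \<xi>) = (\<Sum>i\<in>I. \<Sum>j\<in>I. if \<bar>l i - l j\<bar> < int L then g \<xi> i * cnj (g \<xi> j) * of_real (e \<xi>) else 0)" for \<xi>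
    unfolding N_def sum_distrib_right by (intro sum.cong refl) simp
  have Fe: "F \<xi> * of_real (e \<xi>) = (\<Sum>i\<in>I. \<Sum>j\<in>I. if \<bar>l i - l j\<bar> < int L then 0 else g \<xi> i * cnj (g \<xi> j) * of_real (e \<xi>))" for \<xi>
    unfolding F_def sum_distrib_right by (intro sum.cong refl) simp
  have if_int: "integrable lborel (\<lambda>\<xi>. if P then f \<xi> else 0)" "integrable lborel (\<lambda>\<xi>. if P then 0 else f \<xi>)"
    if "integrable lborel f" for P and f :: "'a \<Rightarrow> complex" using that by (cases P; simp)+
  have N_int: "integrable lborel (\<lambda>\<xi>. N \<xi> * of_real (e \<xi>))"
    unfolding Ne by (intro Bochner_Integration.integrable_sum if_int term_int)
  have F_int: "integrable lborel (\<lambda>\<xi>. F \<xi> * of_real (e \<xi>))"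
    unfolding Fe by (intro Bochner_Integration.integrable_sum if_int term_int)
  have F_le: "norm (LINT \<xi>|lborel. F \<xi> * of_real (e \<xi>)) \<le> Kb * M\<^sup>2"
  proof -
    have far: "norm (LINT \<xi>|lborel. g \<xi> i * cnj (g \<xi> j) * of_real (e \<xi>)) \<le> Kb * (measure lborel (A i) * measure lborel (A j))"
      if ij: "i \<in> I" "j \<in> I" and sep: "\<not> \<bar>l i - l j\<bar> < int L" for i j
    proof -
      \<comment> \<open>Indices at least L apart mean times at least (L - 1) \<rho> apart, the loss
        coming from the floors. This exceeds L \<rho> / 2 once L > 8; for smaller L the damping 4
        \<rho> itself supplies the bound.\<close>
      have "\<rho> * T \<le> max (4 * \<rho>) \<bar>t i - t j\<bar>"
      proof (cases "T \<le> 4")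
        case False
        then have L8: "real L > 8" "T = real L / 2" by (auto simp: T_def max_def split: if_splits)
        have "\<bar>real_of_int (l i) - real_of_int (l j)\<bar> \<ge> real L" using sep by linarith
        moreover have "\<bar>t i / \<rho> - t j / \<rho>\<bar> \<ge> \<bar>real_of_int (l i) - real_of_int (l j)\<bar> - 1"
          unfolding l_def by linarith
        ultimately have "T \<le> \<bar>t i / \<rho> - t j / \<rho>\<bar>" using L8 by linarith
        also have "\<dots> = \<bar>t i - t j\<bar> / \<rho>" using \<rho> by (simp add: abs_divide flip: diff_divide_distrib)
        finally show ?thesis using \<rho> by (simp add: field_simps)
      next
        case True
        then have "\<rho> * T \<le> \<rho> * 4" using \<rho> by (intro mult_left_mono) auto
        then show ?thesis by simp
      qed
      then have K: "norm (ft (w (t i - t j)) x) \<le> Kb" for x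
        unfolding w_def Kb_def using T \<rho> by (intro wave_kernel_bound) auto
      have "norm (LINT \<xi>|lborel. g \<xi> i * cnj (g \<xi> j) * of_real (e \<xi>)) \<le> Kb * (LINT x|lborel. norm (\<phi> i x)) * (LINT x|lborel. norm (\<phi> j x))"
        unfolding term_eq by (intro ft_bilinear_bound \<phi>_int ij w_int K)
      also have "\<dots> \<le> Kb * (measure lborel (A i) * measure lborel (A j))"
        unfolding mult.assoc using ij by (intro mult_left_mono mult_mono \<phi>_m Kb0) auto
      finally show ?thesis .
    qed
    have "(LINT \<xi>|lborel. F \<xi> * of_real (e \<xi>)) = (\<Sum>i\<in>I. \<Sum>j\<in>I. (LINT \<xi>|lborel. (if \<bar>l i - l j\<bar> < int L then 0 else g \<xi> i * cnj (g \<xi> j) * of_real (e \<xi>))))"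
      unfolding Fe by (subst Bochner_Integration.integral_sum, intro Bochner_Integration.integrable_sum if_int term_int, assumption+)
         (intro sum.cong refl Bochner_Integration.integral_sum if_int term_int)
    also have "norm \<dots> \<le> (\<Sum>i\<in>I. \<Sum>j\<in>I. Kb * (measure lborel (A i) * measure lborel (A j)))"
    proof (intro sum_norm_le order_trans[OF norm_sum] sum_mono)
      fix i j assume ij: "i \<in> I" "j \<in> I"
      show "norm (LINT \<xi>|lborel. (if \<bar>l i - l j\<bar> < int L then 0 else g \<xi> i * cnj (g \<xi> j) * of_real (e \<xi>))) \<le> Kb * (measure lborel (A i) * measure lborel (A j))"
        using far[OF ij] Kb0 by (cases "\<bar>l i - l j\<bar> < int L") auto
    qed
    also have "\<dots> = Kb * M\<^sup>2"
      unfolding M_def power2_eq_square sum_product by (simp add: sum_distrib_left)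
    finally show ?thesis .
  qed
  define V where "V = l ` I"
  define Iv where "Iv v = {i \<in> I. l i = v}" for v
  have V: "finite V" using I by (simp add: V_def)
  have G_bound: "integrable lborel (\<lambda>\<xi>. (norm (\<Sum>i\<in>Iv v. g \<xi> i))\<^sup>2 * e \<xi>) \<and>
      (LINT \<xi>|lborel. (norm (\<Sum>i\<in>Iv v. g \<xi> i))\<^sup>2 * e \<xi>) \<le> 4 * (2 * pi) ^ DIM('a) * (\<Sum>i\<in>Iv v. measure lborel (A i))" for v
  proof -
    have Iv: "Iv v \<subseteq> I" by (auto simp: Iv_def)
    have [measurable]: "(\<lambda>\<xi>. \<Sum>i\<in>Iv v. g \<xi> i) \<in> borel_measurable borel"
      using Iv by (intro borel_measurable_sum g_meas) auto
    have le: "(\<integral>\<^sup>+\<xi>. ennreal ((norm (\<Sum>i\<in>Iv v. g \<xi> i))\<^sup>2 * e \<xi>) \<partial>lborel) \<le> ennreal (4 * (2 * pi) ^ DIM('a)) * (\<Sum>i\<in>Iv v. emeasure lborel (A i))"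
      unfolding g_def e_def
    proof (rule short_time_bound[where a="real_of_int v * \<rho>"])
      show "finite (Iv v)" using I Iv by (rule finite_subset[rotated])
      show "disjoint_family_on A (Iv v)" using disj Iv by (rule disjoint_family_on_mono[rotated])
      show "real_of_int v * \<rho> \<le> t i \<and> t i \<le> real_of_int v * \<rho> + \<rho>" if "i \<in> Iv v" for i
      proof -
        have "real_of_int v \<le> t i / \<rho>" "t i / \<rho> \<le> real_of_int v + 1"
          using that by (auto simp: Iv_def l_def)
        then show ?thesis using \<rho> by (simp add: field_simps)
      qed
    qed (use A \<phi> \<rho> Iv in auto)
    also have "(\<Sum>i\<in>Iv v. emeasure lborel (A i)) = ennreal (\<Sum>i\<in>Iv v. measure lborel (A i))"
    proof -
      have "(\<Sum>i\<in>Iv v. emeasure lborel (A i)) = (\<Sum>i\<in>Iv v. ennreal (measure lborel (A i)))"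
      proof (intro sum.cong refl emeasure_eq_ennreal_measure)
        show "emeasure lborel (A i) \<noteq> top" if "i \<in> Iv v" for i
          using A(2)[of i] that Iv by auto
      qed
      then show ?thesis by (simp only: sum_ennreal measure_nonneg)
    qed
    also have "ennreal (4 * (2 * pi) ^ DIM('a)) * ennreal (\<Sum>i\<in>Iv v. measure lborel (A i)) = ennreal (4 * (2 * pi) ^ DIM('a) * (\<Sum>i\<in>Iv v. measure lborel (A i)))"
      by (simp add: ennreal_mult sum_nonneg)
    finally have le: "(\<integral>\<^sup>+\<xi>. ennreal ((norm (\<Sum>i\<in>Iv v. g \<xi> i))\<^sup>2 * e \<xi>) \<partial>lborel) \<le> ennreal (4 * (2 * pi) ^ DIM('a) * (\<Sum>i\<in>Iv v. measure lborel (A i)))" .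
    have int: "integrable lborel (\<lambda>\<xi>. (norm (\<Sum>i\<in>Iv v. g \<xi> i))\<^sup>2 * e \<xi>)"
      using e0 le_less_trans[OF le ennreal_less_top] by (intro integrableI_bounded) (auto simp: abs_mult less_imp_le)
    moreover have "ennreal (LINT \<xi>|lborel. (norm (\<Sum>i\<in>Iv v. g \<xi> i))\<^sup>2 * e \<xi>) \<le> ennreal (4 * (2 * pi) ^ DIM('a) * (\<Sum>i\<in>Iv v. measure lborel (A i)))"
      using le nn_integral_eq_integral[OF int] e0 by (simp add: less_imp_le)
    then have "(LINT \<xi>|lborel. (norm (\<Sum>i\<in>Iv v. g \<xi> i))\<^sup>2 * e \<xi>) \<le> 4 * (2 * pi) ^ DIM('a) * (\<Sum>i\<in>Iv v. measure lborel (A i))"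
      by (subst (asm) ennreal_le_iff) (auto intro!: mult_nonneg_nonneg sum_nonneg)
    ultimately show ?thesis by blast
  qed
  have N_le: "norm (LINT \<xi>|lborel. N \<xi> * of_real (e \<xi>)) \<le> 2 * real L * (4 * (2 * pi) ^ DIM('a) * M)"
  proof -
    have "norm (LINT \<xi>|lborel. N \<xi> * of_real (e \<xi>)) \<le> (LINT \<xi>|lborel. norm (N \<xi> * of_real (e \<xi>)))"
      by (rule integral_norm_bound)
    also have "\<dots> \<le> (LINT \<xi>|lborel. 2 * real L * (\<Sum>v\<in>V. (norm (\<Sum>i\<in>Iv v. g \<xi> i))\<^sup>2 * e \<xi>))"
    proof (rule integral_mono[OF integrable_norm[OF N_int]])
      show "integrable lborel (\<lambda>\<xi>. 2 * real L * (\<Sum>v\<in>V. (norm (\<Sum>i\<in>Iv v. g \<xi> i))\<^sup>2 * e \<xi>))"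
        by (intro integrable_mult_right Bochner_Integration.integrable_sum conjunct1[OF G_bound])
      fix \<xi>
      have "norm (N \<xi>) \<le> 2 * real L * (\<Sum>v\<in>V. (norm (\<Sum>i\<in>Iv v. g \<xi> i))\<^sup>2)"
        unfolding N_def V_def Iv_def by (rule near_pairs_bound[OF I])
      then have "norm (N \<xi>) * e \<xi> \<le> 2 * real L * (\<Sum>v\<in>V. (norm (\<Sum>i\<in>Iv v. g \<xi> i))\<^sup>2) * e \<xi>"
        using e0[of \<xi>] by (intro mult_right_mono) auto
      then show "norm (N \<xi> * of_real (e \<xi>)) \<le> 2 * real L * (\<Sum>v\<in>V. (norm (\<Sum>i\<in>Iv v. g \<xi> i))\<^sup>2 * e \<xi>)"
        using e0[of \<xi>] by (simp add: norm_mult sum_distrib_right mult.assoc)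
    qed
    also have "\<dots> = 2 * real L * (\<Sum>v\<in>V. (LINT \<xi>|lborel. (norm (\<Sum>i\<in>Iv v. g \<xi> i))\<^sup>2 * e \<xi>))"
      using G_bound by (subst integral_mult_right_zero, subst Bochner_Integration.integral_sum) auto
    also have "\<dots> \<le> 2 * real L * (\<Sum>v\<in>V. 4 * (2 * pi) ^ DIM('a) * (\<Sum>i\<in>Iv v. measure lborel (A i)))"
      using G_bound by (intro mult_left_mono sum_mono) auto
    also have "(\<Sum>v\<in>V. 4 * (2 * pi) ^ DIM('a) * (\<Sum>i\<in>Iv v. measure lborel (A i))) = 4 * (2 * pi) ^ DIM('a) * M"
      using sum.group[OF I V, of l "\<lambda>i. measure lborel (A i)"]
      by (simp add: V_def Iv_def M_def flip: sum_distrib_left)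
    finally show ?thesis .
  qed
  have tot: "complex_of_real ((norm (\<Sum>i\<in>I. g \<xi> i))\<^sup>2 * e \<xi>) = N \<xi> * of_real (e \<xi>) + F \<xi> * of_real (e \<xi>)" for \<xi>
    unfolding of_real_mult NF by (simp add: distrib_right)
  have tot_int: "integrable lborel (\<lambda>\<xi>. (norm (\<Sum>i\<in>I. g \<xi> i))\<^sup>2 * e \<xi>)"
  proof -
    have "integrable lborel (\<lambda>\<xi>. complex_of_real ((norm (\<Sum>i\<in>I. g \<xi> i))\<^sup>2 * e \<xi>))"
      unfolding tot by (intro Bochner_Integration.integrable_add N_int F_int)
    then show ?thesis by (rule complex_of_real_integrable_eq[THEN iffD1])
  qed
  have "complex_of_real (LINT \<xi>|lborel. (norm (\<Sum>i\<in>I. g \<xi> i))\<^sup>2 * e \<xi>) = (LINT \<xi>|lborel. N \<xi> * of_real (e \<xi>)) + (LINT \<xi>|lborel. F \<xi> * of_real (e \<xi>))"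
    unfolding integral_complex_of_real[symmetric] tot by (rule Bochner_Integration.integral_add[OF N_int F_int])
  then have "norm (complex_of_real (LINT \<xi>|lborel. (norm (\<Sum>i\<in>I. g \<xi> i))\<^sup>2 * e \<xi>)) \<le> 2 * real L * (4 * (2 * pi) ^ DIM('a) * M) + Kb * M\<^sup>2"
    by (simp only:) (rule order_trans[OF norm_triangle_ineq add_mono[OF N_le F_le]])
  then have "(LINT \<xi>|lborel. (norm (\<Sum>i\<in>I. g \<xi> i))\<^sup>2 * e \<xi>) \<le> 2 * real L * (4 * (2 * pi) ^ DIM('a) * M) + Kb * M\<^sup>2"
    unfolding norm_of_real by linarith
  also have "\<dots> \<le> dual_const DIM('a) * M * X"
  proof -
    \<comment> \<open>M^2 / \<rho>^d equals M X^((d+1)/2), and T^(-(d-1)/2) takes away all but one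
      power of X.\<close>
    have "Kb * M\<^sup>2 \<le> poisson_const DIM('a) * 2 powr ((?d - 1) / 2) * M * X"
    proof (cases "M = 0")
      case False
      then have Mp: "M / \<rho> ^ DIM('a) > 0" using M0 \<rho> by simp
      then have Xp: "X > 0" using False \<rho> by (simp add: X_def)
      have MX: "M / \<rho> ^ DIM('a) = X powr ((?d + 1) / 2)"
      proof -
        have "2 / (?d + 1) * ((?d + 1) / 2) = 1" using d by simp
        then show ?thesis using Mp by (simp only: X_def powr_powr powr_one)
      qed
      have "T powr (- (?d - 1) / 2) \<le> (X / 2) powr (- (?d - 1) / 2)"
        using T Xp d by (intro powr_mono2') auto
      also have "\<dots> = X powr (- (?d - 1) / 2) * 2 powr ((?d - 1) / 2)"
        using Xp by (simp only: powr_divide minus_divide_left[symmetric] powr_minus_divide) simp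
      finally have Tle: "T powr (- (?d - 1) / 2) \<le> X powr (- (?d - 1) / 2) * 2 powr ((?d - 1) / 2)" .
      have "Kb * M\<^sup>2 = poisson_const DIM('a) * T powr (- (?d - 1) / 2) * X powr ((?d + 1) / 2) * M"
        unfolding MX[symmetric] Kb_def by (simp add: power2_eq_square)
      also have "\<dots> \<le> poisson_const DIM('a) * (X powr (- (?d - 1) / 2) * 2 powr ((?d - 1) / 2)) * X powr ((?d + 1) / 2) * M"
        by (intro mult_right_mono mult_left_mono Tle poisson_const_nonneg M0) auto
      also have "\<dots> = poisson_const DIM('a) * 2 powr ((?d - 1) / 2) * M * (X powr (- (?d - 1) / 2) * X powr ((?d + 1) / 2))"
        by (simp only: mult_ac)
      also have "X powr (- (?d - 1) / 2) * X powr ((?d + 1) / 2) = X powr 1"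
        unfolding powr_add[symmetric] by (rule arg_cong[where f="(powr) X"]) (simp add: field_simps)
      finally show ?thesis using Xp by simp
    qed simp
    moreover have "2 * real L * (4 * (2 * pi) ^ DIM('a) * M) \<le> 2 * (2 * X) * (4 * (2 * pi) ^ DIM('a) * M)"
      using L M0 by (intro mult_right_mono mult_left_mono) auto
    ultimately show ?thesis by (simp add: dual_const_def algebra_simps)
  qed
  finally have "ennreal (LINT \<xi>|lborel. (norm (\<Sum>i\<in>I. g \<xi> i))\<^sup>2 * e \<xi>) \<le> ennreal (dual_const DIM('a) * M * X)"
    by (rule ennreal_leI)
  then show ?thesis
    using nn_integral_eq_integral[OF tot_int] e0 by (simp add: g_def e_def X_def)
qed

section \<open>Level sets of the maximal function\<close>

lemma suminf_ennreal_geometric: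
  assumes "0 \<le> c" "0 \<le> r" "r < 1"
  shows "(\<Sum>k. ennreal (c * r ^ k)) = ennreal (c / (1 - r))"
proof (rule suminf_ennreal_eq)
  show "(\<lambda>k. c * r ^ k) sums (c / (1 - r))"
    using sums_mult[OF geometric_sums[of r], of c] assms by simp
qed (use assms in auto)

lemma ennreal_term_le_suminf: "f k \<le> (\<Sum>k. f k :: ennreal)"
  using sum_le_suminf[of f "{k}"] by auto

lemma dyadic_scale:
  assumes "x \<ge> (1::real)"
  obtains k :: nat where "2 ^ k \<le> x" "x < 2 ^ Suc k"
proof -
  define k where "k = nat \<lfloor>log 2 x\<rfloor>"
  have "0 \<le> log 2 x" using assms by simp
  then have "real k = of_int \<lfloor>log 2 x\<rfloor>" by (simp add: k_def)
  then have "real k \<le> log 2 x" "log 2 x < real (Suc k)" by linarith+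
  then have "2 powr real k \<le> x" "x < 2 powr real (Suc k)"
    using assms by (auto simp: le_log_iff log_less_iff)
  then show ?thesis using that by (simp add: powr_realpow del: of_nat_Suc)
qed

lemma ennreal_mult_collect:
  "0 \<le> a \<Longrightarrow> 0 \<le> b \<Longrightarrow> ennreal a * E * ennreal b = ennreal (a * b) * E"
  by (simp add: ennreal_mult mult.assoc mult.commute[of E])

text \<open>The sum of a geometric series of ratio 2^(\<tau>-d) over dyadic shells; 2^\<tau>
  accounts for taking the weight at half the outer radius.\<close>

definition ball_const :: "nat \<Rightarrow> real \<Rightarrow> real" where
  "ball_const d \<tau> = unit_ball_vol d * 2 powr \<tau> / (1 - 2 powr (\<tau> - d))"

lemma ball_const_pos: "\<tau> < real d \<Longrightarrow> ball_const d \<tau> > 0"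
  unfolding ball_const_def by (intro divide_pos_pos mult_pos_pos) (auto simp: powr_less_one)

lemma pred_ball [measurable]: "Measurable.pred borel (\<lambda>x::'a::euclidean_space. x \<in> ball c r)"
  unfolding pred_def by simp

text \<open>Each dyadic shell is enlarged to the ball of its outer radius, with the weight taken at
  the inner radius. The k-th term is then a multiple of (R / 2^k)^(d-\<tau>), summable because
  \<tau> < d.\<close>

lemma nn_integral_norm_powr_ball:
  fixes \<tau> R :: real
  assumes R: "R > 0" and \<tau>: "0 \<le> \<tau>" "\<tau> < real DIM('a::euclidean_space)"
  shows "(\<integral>\<^sup>+\<xi>. ennreal (norm \<xi> powr - \<tau>) * indicator (ball (0::'a) R) \<xi> \<partial>lborel) \<le> 
    ennreal (ball_const DIM('a) \<tau> * R powr (DIM('a) - \<tau>))"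
proof -
  let ?d = "DIM('a)"
  define b where "b k = R / 2 ^ k" for k :: nat
  have b: "b k > 0" for k using R by (simp add: b_def)
  define S where "S k = cball (0::'a) (b k)" for k
  have [measurable]: "S k \<in> sets borel" for k by (simp add: S_def)
  define f where "f k \<xi> = ennreal ((b k / 2) powr - \<tau>) * indicator (S k) \<xi>" for k \<xi>
  have [measurable]: "f k \<in> borel_measurable borel" for k unfolding f_def[abs_def] by measurable
  have "(\<integral>\<^sup>+\<xi>. ennreal (norm \<xi> powr - \<tau>) * indicator (ball (0::'a) R) \<xi> \<partial>lborel) \<le> (\<integral>\<^sup>+\<xi>. (\<Sum>k. f k \<xi>) \<partial>lborel)"
  proof (rule nn_integral_mono)
    fix \<xi> :: 'a
    show "ennreal (norm \<xi> powr - \<tau>) * indicator (ball (0::'a) R) \<xi> \<le> (\<Sum>k. f k \<xi>)"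
    proof (cases "\<xi> \<noteq> 0 \<and> norm \<xi> < R")
      case True
      then have "R / norm \<xi> \<ge> 1" by simp
      then obtain k where k: "2 ^ k \<le> R / norm \<xi>" "R / norm \<xi> < 2 ^ Suc k" by (rule dyadic_scale)
      then have "norm \<xi> \<le> b k" "b k / 2 \<le> norm \<xi>" using True by (auto simp: b_def field_simps)
      then have "norm \<xi> powr - \<tau> \<le> (b k / 2) powr - \<tau>"
        using \<tau> b[of k] by (intro powr_mono2') auto
      moreover have "\<xi> \<in> ball 0 R" "\<xi> \<in> S k" unfolding S_def using True \<open>norm \<xi> \<le> b k\<close> by auto
      ultimately have "ennreal (norm \<xi> powr - \<tau>) * indicator (ball (0::'a) R) \<xi> \<le> f k \<xi>"
        unfolding f_def by (simp only: indicator_simps mult_1_right) (rule ennreal_leI)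
      also have "\<dots> \<le> (\<Sum>k. f k \<xi>)" by (rule ennreal_term_le_suminf)
      finally show ?thesis .
    next
      case False
      then have "ennreal (norm \<xi> powr - \<tau>) * indicator (ball (0::'a) R) \<xi> = 0" by (auto simp: indicator_def)
      then show ?thesis by (simp only: zero_le)
    qed
  qed
  also have "\<dots> = (\<Sum>k. (\<integral>\<^sup>+\<xi>. f k \<xi> \<partial>lborel))"
    by (rule nn_integral_suminf) measurable
  also have "\<dots> = (\<Sum>k. ennreal (unit_ball_vol ?d * 2 powr \<tau> * R powr (?d - \<tau>) * (2 powr (\<tau> - ?d)) ^ k))"
  proof (intro arg_cong[where f=suminf] ext)
    fix k
    have "(\<integral>\<^sup>+\<xi>. f k \<xi> \<partial>lborel) = ennreal ((b k / 2) powr - \<tau>) * emeasure lborel (S k)"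
      unfolding f_def by (simp add: nn_integral_cmult)
    also have "\<dots> = ennreal ((b k / 2) powr - \<tau> * (unit_ball_vol ?d * b k ^ ?d))"
      using b[of k] by (simp add: S_def emeasure_cball ennreal_mult less_imp_le)
    also have "(b k / 2) powr - \<tau> * (unit_ball_vol ?d * b k ^ ?d) = unit_ball_vol ?d * 2 powr \<tau> * (b k powr - \<tau> * b k powr ?d)"
      using b[of k] by (simp add: powr_divide powr_minus_divide powr_realpow)
    also have "b k powr - \<tau> * b k powr ?d = b k powr (?d - \<tau>)" by (simp flip: powr_add)
    also have "\<dots> = R powr (?d - \<tau>) * (2 powr (\<tau> - ?d)) ^ k"
    proof -
      have "b k powr (?d - \<tau>) = R powr (?d - \<tau>) / (2 powr k) powr (?d - \<tau>)"
        using R by (simp add: b_def powr_divide powr_realpow)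
      also have "(2 powr k) powr (?d - \<tau>) = 1 / (2 powr (\<tau> - ?d)) powr k"
        by (simp add: powr_powr powr_minus_divide[symmetric] algebra_simps)
      finally show ?thesis by (simp add: powr_realpow)
    qed
    finally show "(\<integral>\<^sup>+\<xi>. f k \<xi> \<partial>lborel) = ennreal (unit_ball_vol ?d * 2 powr \<tau> * R powr (?d - \<tau>) * (2 powr (\<tau> - ?d)) ^ k)"
      by (simp add: mult.assoc)
  qed
  also have "\<dots> = ennreal (unit_ball_vol ?d * 2 powr \<tau> * R powr (?d - \<tau>) / (1 - 2 powr (\<tau> - ?d)))"
    using \<tau> by (intro suminf_ennreal_geometric) (auto simp: powr_less_one)
  also have "\<dots> = ennreal (ball_const ?d \<tau> * R powr (?d - \<tau>))"
    by (simp add: ball_const_def)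
  finally show ?thesis .
qed

text \<open>On the shell b <= |\<xi>| <= 2 b the damping exp(-4 |\<xi>| / b) is at least exp(-8);
  the denominator belongs to a geometric series over shells.\<close>

definition high_const :: "nat \<Rightarrow> real \<Rightarrow> real" where
  "high_const d \<tau> = exp 8 * dual_const d / (1 - 2 powr (2 * real d / (real d + 1) - \<tau>))"

lemma dual_const_pos: "dual_const d > 0"
  unfolding dual_const_def using poisson_const_nonneg[of d] by (intro add_pos_nonneg) auto

lemma high_const_pos: "\<tau> > 2 * real d / (real d + 1) \<Longrightarrow> high_const d \<tau> > 0"
  unfolding high_const_def using dual_const_pos[of d] by (intro divide_pos_pos mult_pos_pos) (auto simp: powr_less_one)

text \<open>On the shell where |\<xi>| is comparable to b, the damping with \<rho> = 1 / b can be
  inserted at bounded cost, and \<open>wave_dual_bound\<close> grows like b^(2d/(d+1)). The weight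
  b^(-\<tau>) outweighs this growth, so the shells beyond R sum to a multiple of the bound for the
  first one.\<close>

lemma wave_dual_bound_high:
  fixes A :: "'i \<Rightarrow> 'a::euclidean_space set" and \<phi> :: "'i \<Rightarrow> 'a \<Rightarrow> complex"
  assumes I: "finite I" and disj: "disjoint_family_on A I"
    and A: "\<And>i. i \<in> I \<Longrightarrow> A i \<in> sets borel" "\<And>i. i \<in> I \<Longrightarrow> emeasure lborel (A i) < \<infinity>"
    and \<phi>: "\<And>i. i \<in> I \<Longrightarrow> \<phi> i \<in> borel_measurable borel" "\<And>i x. i \<in> I \<Longrightarrow> norm (\<phi> i x) \<le> indicator (A i) x"
    and R: "R > 0" and \<tau>: "\<tau> > 2 * real DIM('a) / (real DIM('a) + 1)"
  defines "M \<equiv> \<Sum>i\<in>I. measure lborel (A i)"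
  shows "(\<integral>\<^sup>+\<xi>. ennreal ((norm (\<Sum>i\<in>I. cis (t i * norm \<xi>) * ft (\<phi> i) \<xi>))\<^sup>2 * norm \<xi> powr - \<tau>) * indicator (- ball 0 R) \<xi> \<partial>lborel)
    \<le> ennreal (high_const DIM('a) \<tau> * M powr (1 + 2 / (real DIM('a) + 1)) * R powr (2 * real DIM('a) / (real DIM('a) + 1) - \<tau>))"
proof -
  let ?d = "real DIM('a)"
  define \<eta> where "\<eta> = 2 * ?d / (?d + 1)"
  have \<tau>0: "\<tau> \<ge> 0" using \<tau> by (rule less_imp_le[OF le_less_trans[rotated]]) simp
  define b where "b k = R * 2 ^ k" for k :: nat
  have b: "b k > 0" for k using R by (simp add: b_def)
  define G where "G \<xi> = (norm (\<Sum>i\<in>I. cis (t i * norm \<xi>) * ft (\<phi> i) \<xi>))\<^sup>2" for \<xi>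
  have G0: "G \<xi> \<ge> 0" for \<xi> by (simp add: G_def)
  have [measurable]: "\<phi> i \<in> borel_measurable borel" if "i \<in> I" for i by (rule \<phi>(1)[OF that])
  have [measurable]: "G \<in> borel_measurable borel" unfolding G_def[abs_def] by measurable
  define c where "c k = exp 8 * b k powr - \<tau>" for k
  define f where "f k \<xi> = ennreal (c k) * ennreal (G \<xi> * exp (- (4 * (1 / b k)) * norm \<xi>))" for k \<xi>
  have [measurable]: "f k \<in> borel_measurable borel" for k unfolding f_def[abs_def] by measurable
  have M0: "M \<ge> 0" by (simp add: M_def sum_nonneg)
  have "(\<integral>\<^sup>+\<xi>. ennreal (G \<xi> * norm \<xi> powr - \<tau>) * indicator (- ball 0 R) \<xi> \<partial>lborel) \<le> (\<integral>\<^sup>+\<xi>. (\<Sum>k. f k \<xi>) \<partial>lborel)"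
  proof (rule nn_integral_mono)
    fix \<xi> :: 'a
    show "ennreal (G \<xi> * norm \<xi> powr - \<tau>) * indicator (- ball 0 R) \<xi> \<le> (\<Sum>k. f k \<xi>)"
    proof (cases "norm \<xi> \<ge> R")
      case True
      then have "norm \<xi> / R \<ge> 1" using R by simp
      then obtain k where "2 ^ k \<le> norm \<xi> / R" "norm \<xi> / R < 2 ^ Suc k" by (rule dyadic_scale)
      then have k: "b k \<le> norm \<xi>" "norm \<xi> \<le> 2 * b k" using R by (auto simp: b_def field_simps)
      have "norm \<xi> powr - \<tau> \<le> b k powr - \<tau> * 1"
        using k b[of k] \<tau>0 by (simp add: powr_mono2')
      also have "\<dots> \<le> b k powr - \<tau> * (exp 8 * exp (- (4 * (1 / b k)) * norm \<xi>))"
      proof (intro mult_left_mono)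
        have "0 \<le> 8 + (- (4 * (1 / b k)) * norm \<xi>)" using k b[of k] by (simp add: field_simps)
        then show "1 \<le> exp 8 * exp (- (4 * (1 / b k)) * norm \<xi>)" by (simp flip: exp_add)
      qed simp
      finally have "G \<xi> * norm \<xi> powr - \<tau> \<le> G \<xi> * (c k * exp (- (4 * (1 / b k)) * norm \<xi>))"
        by (intro mult_left_mono G0) (simp add: c_def mult_ac)
      then have "ennreal (G \<xi> * norm \<xi> powr - \<tau>) \<le> ennreal (c k * (G \<xi> * exp (- (4 * (1 / b k)) * norm \<xi>)))"
        unfolding mult.left_commute[of "c k"] by (rule ennreal_leI)
      moreover have "indicator (- ball 0 R) \<xi> = (1::ennreal)" using True by simp
      ultimately have "ennreal (G \<xi> * norm \<xi> powr - \<tau>) * indicator (- ball 0 R) \<xi> \<le> ennreal (c k * (G \<xi> * exp (- (4 * (1 / b k)) * norm \<xi>)))"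
        by (simp only: mult_1_right)
      also have "\<dots> = f k \<xi>" unfolding f_def by (rule ennreal_mult) (auto simp: c_def G0)
      also have "\<dots> \<le> (\<Sum>k. f k \<xi>)" by (rule ennreal_term_le_suminf)
      finally show ?thesis .
    next
      case False
      then have "ennreal (G \<xi> * norm \<xi> powr - \<tau>) * indicator (- ball 0 R) \<xi> = 0" by (auto simp: indicator_def)
      then show ?thesis by (simp only: zero_le)
    qed
  qed
  also have "\<dots> = (\<Sum>k. (\<integral>\<^sup>+\<xi>. f k \<xi> \<partial>lborel))"
    by (rule nn_integral_suminf) measurable
  also have "\<dots> \<le> (\<Sum>k. ennreal (exp 8 * dual_const DIM('a) * M powr (1 + 2 / (?d + 1)) * R powr (\<eta> - \<tau>) * (2 powr (\<eta> - \<tau>)) ^ k))"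
  proof (intro suminf_le summableI)
    fix k
    have "(\<integral>\<^sup>+\<xi>. f k \<xi> \<partial>lborel) = ennreal (c k) * (\<integral>\<^sup>+\<xi>. ennreal (G \<xi> * exp (- (4 * (1 / b k)) * norm \<xi>)) \<partial>lborel)"
      unfolding f_def by (subst nn_integral_cmult) auto
    also have "\<dots> \<le> ennreal (c k) * ennreal (dual_const DIM('a) * M * (M / (1 / b k) ^ DIM('a)) powr (2 / (?d + 1)))"
      unfolding G_def M_def by (intro mult_left_mono wave_dual_bound[OF I disj A \<phi>]) (use b in auto)
    also have "\<dots> = ennreal (c k * (dual_const DIM('a) * M * (M / (1 / b k) ^ DIM('a)) powr (2 / (?d + 1))))"
      by (rule ennreal_mult[symmetric]) (use M0 dual_const_pos[of "DIM('a)"] in \<open>auto simp: c_def\<close>)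
    also have "c k * (dual_const DIM('a) * M * (M / (1 / b k) ^ DIM('a)) powr (2 / (?d + 1))) =
       exp 8 * dual_const DIM('a) * M powr (1 + 2 / (?d + 1)) * R powr (\<eta> - \<tau>) * (2 powr (\<eta> - \<tau>)) ^ k"
    proof -
      have "M / (1 / b k) ^ DIM('a) = M * b k powr ?d" using b[of k] by (simp add: power_divide powr_realpow)
      then have 1: "(M / (1 / b k) ^ DIM('a)) powr (2 / (?d + 1)) = M powr (2 / (?d + 1)) * b k powr \<eta>"
        using M0 b[of k] by (simp add: powr_mult powr_powr \<eta>_def mult.commute)
      have 2: "b k powr - \<tau> * b k powr \<eta> = b k powr (\<eta> - \<tau>)" by (simp flip: powr_add)
      have "b k = R * 2 powr real k" by (simp add: b_def powr_realpow)
      then have 3: "b k powr (\<eta> - \<tau>) = R powr (\<eta> - \<tau>) * (2 powr (\<eta> - \<tau>)) ^ k"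
        using R by (simp add: powr_mult powr_powr mult.commute flip: powr_realpow)
      have 4: "M * M powr (2 / (?d + 1)) = M powr (1 + 2 / (?d + 1))" using M0 by (simp add: powr_add)
      have "c k * (dual_const DIM('a) * M * (M powr (2 / (?d + 1)) * b k powr \<eta>)) =
         exp 8 * dual_const DIM('a) * (M * M powr (2 / (?d + 1))) * (b k powr - \<tau> * b k powr \<eta>)"
        by (simp add: c_def)
      then show ?thesis unfolding 1 2 3 4 by simp
    qed
    finally show "(\<integral>\<^sup>+\<xi>. f k \<xi> \<partial>lborel) \<le> ennreal (exp 8 * dual_const DIM('a) * M powr (1 + 2 / (?d + 1)) * R powr (\<eta> - \<tau>) * (2 powr (\<eta> - \<tau>)) ^ k)" .
  qed
  also have "\<dots> = ennreal (exp 8 * dual_const DIM('a) * M powr (1 + 2 / (?d + 1)) * R powr (\<eta> - \<tau>) / (1 - 2 powr (\<eta> - \<tau>)))"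
    using \<tau> dual_const_pos[of "DIM('a)"] by (intro suminf_ennreal_geometric) (auto simp: powr_less_one \<eta>_def)
  also have "\<dots> = ennreal (high_const DIM('a) \<tau> * M powr (1 + 2 / (?d + 1)) * R powr (\<eta> - \<tau>))"
    by (simp add: high_const_def \<eta>_def)
  finally show ?thesis by (simp only: G_def \<eta>_def)
qed

text \<open>The power-like tails of the weight make the energies of neighbouring dyadic scales comparable, so
  that the levels in \<open>wave_levels\<close> below grow geometrically.\<close>

definition band :: "real \<Rightarrow> real \<Rightarrow> real \<Rightarrow> real" where
  "band \<epsilon> R r = min ((r / R) powr (2 * \<epsilon>)) ((r / R) powr (- 2 * \<epsilon>))"

definition band_energy :: "real \<Rightarrow> ('a::euclidean_space \<Rightarrow> complex) \<Rightarrow> real \<Rightarrow> ennreal" where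
  "band_energy \<epsilon> g R = (\<integral>\<^sup>+\<xi>. ennreal ((norm (g \<xi>))\<^sup>2 * band \<epsilon> R (norm \<xi>)) \<partial>lborel)"

lemma band_nonneg: "band \<epsilon> R r \<ge> 0" by (simp add: band_def)

lemma band_measurable [measurable]: "band \<epsilon> R \<in> borel_measurable borel"
  unfolding band_def by measurable

section \<open>Low and high frequencies measured by the band energy\<close>

lemma band_low:
  assumes "0 < r" "r \<le> R" "\<epsilon> \<ge> 0" shows "r powr (2 * \<epsilon>) = R powr (2 * \<epsilon>) * band \<epsilon> R r"
proof -
  have "(r / R) powr (2 * \<epsilon>) \<le> (r / R) powr (- 2 * \<epsilon>)"
    using assms by (intro powr_mono') auto
  then show ?thesis using assms by (simp add: band_def powr_divide)
qed

lemma band_high: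
  assumes "0 < R" "R \<le> r" "\<epsilon> \<ge> 0" shows "r powr (- 2 * \<epsilon>) = R powr (- 2 * \<epsilon>) * band \<epsilon> R r"
proof -
  have "(r / R) powr (- 2 * \<epsilon>) \<le> (r / R) powr (2 * \<epsilon>)"
    using assms by (intro powr_mono) auto
  then show ?thesis using assms by (simp add: band_def powr_divide min_def)
qed

text \<open>Cauchy-Schwarz after writing |\<xi>|^(-s) as |\<xi>|^\<epsilon> |\<xi>|^(-s-\<epsilon>).
  Below R the first factor is what the band energy measures, and the second is square integrable
  near 0 because 2 s + 2 \<epsilon> < d.\<close>

lemma low_frequency_bound:
  fixes s \<epsilon> R :: real and h g :: "'a::euclidean_space \<Rightarrow> complex"
  assumes [measurable]: "h \<in> borel_measurable borel" "g \<in> borel_measurable borel"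
    and hg: "\<And>\<xi>. \<xi> \<noteq> 0 \<Longrightarrow> norm (h \<xi>) = norm \<xi> powr - s * norm (g \<xi>)"
    and R: "R > 0" and \<epsilon>: "0 \<le> \<epsilon>" "0 \<le> s" "2 * s + 2 * \<epsilon> < real DIM('a)"
  shows "(\<integral>\<^sup>+\<xi>. ennreal (norm (h \<xi>)) * indicator (ball 0 R) \<xi> \<partial>lborel)\<^sup>2 \<le> 
    ennreal (ball_const DIM('a) (2 * s + 2 * \<epsilon>) * R powr (DIM('a) - 2 * s)) * band_energy \<epsilon> g R"
proof -
  let ?\<tau> = "2 * s + 2 * \<epsilon>"
  have "(\<integral>\<^sup>+\<xi>. ennreal (norm (h \<xi>)) * indicator (ball 0 R) \<xi> \<partial>lborel) =
     (\<integral>\<^sup>+\<xi>. (ennreal (norm (g \<xi>) * norm \<xi> powr \<epsilon>) * indicator (ball 0 R) \<xi>) * (ennreal (norm \<xi> powr - (s + \<epsilon>)) * indicator (ball 0 R) \<xi>) \<partial>lborel)"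
  proof (rule nn_integral_cong_AE, rule AE_mp[OF AE_lborel_singleton[of "0::'a"]], rule AE_I2, rule impI)
    \<comment> \<open>The relation between \<open>h\<close> and \<open>g\<close> is given off the
      origin only, hence the passage through almost everywhere equality.\<close>
    fix \<xi> :: 'a assume "\<xi> \<noteq> 0"
    then have "norm (h \<xi>) = (norm (g \<xi>) * norm \<xi> powr \<epsilon>) * norm \<xi> powr - (s + \<epsilon>)"
      by (simp add: hg mult.assoc flip: powr_add)
    then have "ennreal (norm (h \<xi>)) = ennreal (norm (g \<xi>) * norm \<xi> powr \<epsilon>) * ennreal (norm \<xi> powr - (s + \<epsilon>))"
      by (simp add: ennreal_mult)
    then show "ennreal (norm (h \<xi>)) * indicator (ball 0 R) \<xi> = (ennreal (norm (g \<xi>) * norm \<xi> powr \<epsilon>) * indicator (ball 0 R) \<xi>) * (ennreal (norm \<xi> powr - (s + \<epsilon>)) * indicator (ball 0 R) \<xi>)"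
      by (simp split: split_indicator)
  qed
  also have "\<dots>\<^sup>2 \<le> (\<integral>\<^sup>+\<xi>. (ennreal (norm (g \<xi>) * norm \<xi> powr \<epsilon>) * indicator (ball 0 R) \<xi>)\<^sup>2 \<partial>lborel) * (\<integral>\<^sup>+\<xi>. (ennreal (norm \<xi> powr - (s + \<epsilon>)) * indicator (ball (0::'a) R) \<xi>)\<^sup>2 \<partial>lborel)"
    by (rule Cauchy_Schwarz_nn_integral) measurable
  also have "\<dots> \<le> (ennreal (R powr (2 * \<epsilon>)) * band_energy \<epsilon> g R) * ennreal (ball_const DIM('a) ?\<tau> * R powr (DIM('a) - ?\<tau>))"
  proof (rule mult_mono)
    have "(\<integral>\<^sup>+\<xi>. (ennreal (norm (g \<xi>) * norm \<xi> powr \<epsilon>) * indicator (ball 0 R) \<xi>)\<^sup>2 \<partial>lborel) \<le> 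
      (\<integral>\<^sup>+\<xi>. ennreal (R powr (2 * \<epsilon>)) * ennreal ((norm (g \<xi>))\<^sup>2 * band \<epsilon> R (norm \<xi>)) \<partial>lborel)"
    proof (rule nn_integral_mono)
      fix \<xi> :: 'a
      show "(ennreal (norm (g \<xi>) * norm \<xi> powr \<epsilon>) * indicator (ball 0 R) \<xi>)\<^sup>2 \<le> ennreal (R powr (2 * \<epsilon>)) * ennreal ((norm (g \<xi>))\<^sup>2 * band \<epsilon> R (norm \<xi>))"
      proof (cases "\<xi> \<noteq> 0 \<and> norm \<xi> < R")
        case True
        have "(norm (g \<xi>) * norm \<xi> powr \<epsilon>)\<^sup>2 = (norm (g \<xi>))\<^sup>2 * norm \<xi> powr (2 * \<epsilon>)"
          using True by (simp add: power_mult_distrib powr_power mult.commute)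
        also have "\<dots> = R powr (2 * \<epsilon>) * ((norm (g \<xi>))\<^sup>2 * band \<epsilon> R (norm \<xi>))"
          using True \<epsilon> by (subst band_low[of _ R]) auto
        finally show ?thesis using True band_nonneg[of \<epsilon> R "norm \<xi>"]
          by (simp add: ennreal_power flip: ennreal_mult)
      qed (auto split: split_indicator)
    qed
    then show "(\<integral>\<^sup>+\<xi>. (ennreal (norm (g \<xi>) * norm \<xi> powr \<epsilon>) * indicator (ball 0 R) \<xi>)\<^sup>2 \<partial>lborel) \<le> ennreal (R powr (2 * \<epsilon>)) * band_energy \<epsilon> g R"
      by (simp add: band_energy_def nn_integral_cmult)
    have "(\<integral>\<^sup>+\<xi>. (ennreal (norm \<xi> powr - (s + \<epsilon>)) * indicator (ball (0::'a) R) \<xi>)\<^sup>2 \<partial>lborel) =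
       (\<integral>\<^sup>+\<xi>. ennreal (norm \<xi> powr - ?\<tau>) * indicator (ball (0::'a) R) \<xi> \<partial>lborel)"
    proof (rule nn_integral_cong)
      fix \<xi> :: 'a
      have "(norm \<xi> powr - (s + \<epsilon>))\<^sup>2 = norm \<xi> powr - ?\<tau>"
        by (cases "\<xi> = 0") (simp_all add: powr_power algebra_simps)
      then show "(ennreal (norm \<xi> powr - (s + \<epsilon>)) * indicator (ball (0::'a) R) \<xi>)\<^sup>2 = ennreal (norm \<xi> powr - ?\<tau>) * indicator (ball (0::'a) R) \<xi>"
        by (simp add: ennreal_power split: split_indicator)
    qed
    also have "\<dots> \<le> ennreal (ball_const DIM('a) ?\<tau> * R powr (DIM('a) - ?\<tau>))"
      by (intro nn_integral_norm_powr_ball R) (use \<epsilon> in auto)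
    finally show "(\<integral>\<^sup>+\<xi>. (ennreal (norm \<xi> powr - (s + \<epsilon>)) * indicator (ball (0::'a) R) \<xi>)\<^sup>2 \<partial>lborel) \<le> ennreal (ball_const DIM('a) ?\<tau> * R powr (DIM('a) - ?\<tau>))" .
  qed auto
  also have "\<dots> = ennreal (ball_const DIM('a) ?\<tau> * R powr (DIM('a) - 2 * s)) * band_energy \<epsilon> g R"
  proof -
    have "R powr (2 * \<epsilon>) * R powr (DIM('a) - ?\<tau>) = R powr (DIM('a) - 2 * s)" by (simp flip: powr_add)
    then have eq: "R powr (2 * \<epsilon>) * (ball_const DIM('a) ?\<tau> * R powr (DIM('a) - ?\<tau>)) = ball_const DIM('a) ?\<tau> * R powr (DIM('a) - 2 * s)"
      by (simp add: mult.left_commute)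
    have pos: "ball_const DIM('a) ?\<tau> \<ge> 0" using ball_const_pos[of ?\<tau>] \<epsilon> by (simp add: less_imp_le)
    show ?thesis unfolding eq[symmetric] by (rule ennreal_mult_collect) (use pos in auto)
  qed
  finally show ?thesis .
qed


text \<open>The amplitude is prescribed on the frequency side, so that a sharp frequency cutoff is
  multiplication of \<open>h\<close> by an indicator.\<close>

definition wave_int :: "('a::euclidean_space \<Rightarrow> complex) \<Rightarrow> real \<Rightarrow> 'a \<Rightarrow> complex" where
  "wave_int h t x = (LINT \<xi>|lborel. cis (x \<bullet> \<xi> + t * norm \<xi>) * h \<xi>)"

lemma wave_int_measurable [measurable]:
  assumes [measurable]: "h \<in> borel_measurable borel"
  shows "wave_int h t \<in> borel_measurable borel"
  unfolding wave_int_def[abs_def] by measurable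

lemma integrable_wave:
  fixes h :: "'a::euclidean_space \<Rightarrow> complex"
  assumes h: "integrable lborel h"
  shows "integrable lborel (\<lambda>\<xi>. cis (x \<bullet> \<xi> + t * norm \<xi>) * h \<xi>)"
proof (rule Bochner_Integration.integrable_bound[OF h])
  have [measurable]: "h \<in> borel_measurable borel" using h by (auto dest: borel_measurable_integrable)
  show "(\<lambda>\<xi>. cis (x \<bullet> \<xi> + t * norm \<xi>) * h \<xi>) \<in> borel_measurable lborel" by measurable
qed (simp add: norm_mult)

lemma integrable_indicator_mult:
  fixes h :: "'a::euclidean_space \<Rightarrow> complex"
  assumes h: "integrable lborel h" and [measurable]: "S \<in> sets borel"
  shows "integrable lborel (\<lambda>\<xi>. indicator S \<xi> * h \<xi>)"
proof (rule Bochner_Integration.integrable_bound[OF h])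
  have [measurable]: "h \<in> borel_measurable borel" using h by (auto dest: borel_measurable_integrable)
  show "(\<lambda>\<xi>. indicator S \<xi> * h \<xi>) \<in> borel_measurable lborel" by measurable
qed (simp add: norm_mult split: split_indicator)

lemma norm_wave_int_le: "ennreal (norm (wave_int h t x)) \<le> (\<integral>\<^sup>+\<xi>. ennreal (norm (h \<xi>)) \<partial>lborel)"
  unfolding wave_int_def by (rule order_trans[OF norm_integral_le_nn_integral]) (simp add: norm_mult)

text \<open>Duality: testing the high part against its conjugate phase on each \<open>A i\<close>
  gives at least a M, and moving the evolution to the other side leaves the pairing of
  \<open>H\<close> with the dual function \<open>G\<close>. Cauchy-Schwarz then separates the band
  energy of the data from the bound of \<open>wave_dual_bound_high\<close> with \<tau> = 2 s - 2
  \<epsilon>.\<close>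

lemma high_frequency_bound:
  fixes A :: "'i \<Rightarrow> 'a::euclidean_space set" and h g :: "'a \<Rightarrow> complex" and s \<epsilon> R :: real
  assumes I: "finite I" and disj: "disjoint_family_on A I"
    and A: "\<And>i. i \<in> I \<Longrightarrow> A i \<in> sets borel" "\<And>i. i \<in> I \<Longrightarrow> emeasure lborel (A i) < \<infinity>"
    and h: "integrable lborel h" and g[measurable]: "g \<in> borel_measurable borel"
    and hg: "\<And>\<xi>. \<xi> \<noteq> 0 \<Longrightarrow> norm (h \<xi>) = norm \<xi> powr - s * norm (g \<xi>)"
    and R: "R > 0" and \<epsilon>: "0 \<le> \<epsilon>" "2 * s - 2 * \<epsilon> > 2 * real DIM('a) / (real DIM('a) + 1)"
    and a: "a \<ge> 0" "\<And>i x. i \<in> I \<Longrightarrow> x \<in> A i \<Longrightarrow> a \<le> norm (wave_int (\<lambda>\<xi>. indicator (- ball 0 R) \<xi> * h \<xi>) (t i) x)"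
  defines "M \<equiv> \<Sum>i\<in>I. measure lborel (A i)"
  shows "ennreal ((a * M)\<^sup>2) \<le> ennreal (high_const DIM('a) (2 * s - 2 * \<epsilon>) * M powr (1 + 2 / (real DIM('a) + 1)) *
      R powr (2 * real DIM('a) / (real DIM('a) + 1) - 2 * s)) * band_energy \<epsilon> g R"
proof -
  let ?\<tau> = "2 * s - 2 * \<epsilon>" and ?\<eta> = "2 * real DIM('a) / (real DIM('a) + 1)"
  define S where "S = - ball (0::'a) R"
  have S[measurable]: "S \<in> sets borel" unfolding S_def by simp
  define H where "H \<xi> = indicator S \<xi> * h \<xi>" for \<xi>
  have H_int: "integrable lborel H" unfolding H_def[abs_def] by (rule integrable_indicator_mult[OF h S])
  have [measurable]: "h \<in> borel_measurable borel" "H \<in> borel_measurable borel"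
    using h H_int by (auto dest: borel_measurable_integrable)
  have [measurable]: "A i \<in> sets borel" if "i \<in> I" for i by (rule A(1)[OF that])
  \<comment> \<open>The conjugate phase makes the product with the wave equal to its modulus on
    \<open>A i\<close>, while staying below the indicator in absolute value.\<close>
  define \<phi> where "\<phi> i x = indicator (A i) x * cnj (sgn (wave_int H (t i) x))" for i x
  have \<phi>_meas[measurable]: "\<phi> i \<in> borel_measurable borel" if "i \<in> I" for i
    unfolding \<phi>_def[abs_def] sgn_div_norm using that by measurable
  have \<phi>_le: "norm (\<phi> i x) \<le> indicator (A i) x" for i x
    by (simp add: \<phi>_def norm_mult norm_sgn split: split_indicator)
  have \<phi>_int: "integrable lborel (\<phi> i)" if "i \<in> I" for i
  proof (rule Bochner_Integration.integrable_bound[of _ "indicator (A i) :: 'a \<Rightarrow> real"])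
    show "integrable lborel (indicator (A i) :: 'a \<Rightarrow> real)"
      using A[OF that] by (intro integrable_real_indicator) auto
  qed (use \<phi>_le \<phi>_meas[OF that] in auto)
  define G where "G \<xi> = (\<Sum>i\<in>I. cis (t i * norm \<xi>) * ft (\<phi> i) \<xi>)" for \<xi>
  have [measurable]: "G \<in> borel_measurable borel" unfolding G_def[abs_def] by measurable
  have M0: "M \<ge> 0" by (simp add: M_def sum_nonneg)
  have pair: "(LINT x|lborel. \<phi> i x * wave_int H (t i) x) = (LINT \<xi>|lborel. H \<xi> * (cis (t i * norm \<xi>) * ft (\<phi> i) \<xi>))" if "i \<in> I" for i
  proof -
    have "(LINT x|lborel. \<phi> i x * wave_int H (t i) x) = (LINT \<xi>|lborel. H \<xi> * (LINT x|lborel. cis (x \<bullet> \<xi> + t i * norm \<xi>) * \<phi> i x))"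
      unfolding wave_int_def by (rule bounded_kernel_Fubini[symmetric, OF \<phi>_int[OF that] H_int]) auto
    also have "(\<lambda>\<xi>. LINT x|lborel. cis (x \<bullet> \<xi> + t i * norm \<xi>) * \<phi> i x) = (\<lambda>\<xi>. cis (t i * norm \<xi>) * ft (\<phi> i) \<xi>)"
      unfolding ft_def integral_mult_right_zero[symmetric] by (simp add: cis_mult mult.assoc[symmetric] add.commute)
    finally show ?thesis .
  qed
  have term_int: "integrable lborel (\<lambda>\<xi>. H \<xi> * (cis (t i * norm \<xi>) * ft (\<phi> i) \<xi>))" if "i \<in> I" for i
  proof (rule Bochner_Integration.integrable_bound[OF integrable_mult_right[OF H_int, of "of_real (LINT x|lborel. norm (\<phi> i x))"]])
    show "(\<lambda>\<xi>. H \<xi> * (cis (t i * norm \<xi>) * ft (\<phi> i) \<xi>)) \<in> borel_measurable lborel"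
      using \<phi>_meas[OF that] by measurable
    show "AE \<xi> in lborel. norm (H \<xi> * (cis (t i * norm \<xi>) * ft (\<phi> i) \<xi>)) \<le> norm (complex_of_real (LINT x|lborel. norm (\<phi> i x)) * H \<xi>)"
      using norm_ft_le[of "\<phi> i"] by (auto simp: norm_mult mult.commute intro!: mult_left_mono order_trans[OF norm_ft_le])
  qed
  have lower: "a * measure lborel (A i) \<le> Re (LINT x|lborel. \<phi> i x * wave_int H (t i) x)" if i: "i \<in> I" for i
  proof -
    have eq: "\<phi> i x * wave_int H (t i) x = of_real (indicator (A i) x * norm (wave_int H (t i) x))" for x
    proof -
      have "cnj (sgn z) * z = of_real (norm z)" for z :: complex
      proof -
        have "cnj z * z = of_real (norm z) * of_real (norm z)"
          using complex_norm_square[of z] by (simp add: mult.commute power2_eq_square)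
        then show ?thesis by (cases "z = 0") (simp_all add: sgn_eq)
      qed
      then show ?thesis by (simp add: \<phi>_def mult.assoc indicator_def)
    qed
    have fin: "integrable lborel (indicator (A i) :: 'a \<Rightarrow> real)"
      using A[OF i] by (intro integrable_real_indicator) auto
    obtain B where B: "\<And>x. norm (wave_int H (t i) x) \<le> B"
    proof
      show "norm (wave_int H (t i) x) \<le> (LINT \<xi>|lborel. norm (H \<xi>))" for x
        unfolding wave_int_def by (rule order_trans[OF integral_norm_bound]) (simp add: norm_mult)
    qed
    have int: "integrable lborel (\<lambda>x. indicator (A i) x * norm (wave_int H (t i) x))"
    proof (rule Bochner_Integration.integrable_bound[OF integrable_mult_right[OF fin, of B]])
      show "(\<lambda>x. indicator (A i) x * norm (wave_int H (t i) x)) \<in> borel_measurable lborel" using i by measurable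
    qed (use B in \<open>auto split: split_indicator intro: order_trans[OF _ abs_ge_self]\<close>)
    have "a * measure lborel (A i) = (LINT x|lborel. a * indicator (A i) x)" using A[OF i] by simp
    also have "\<dots> \<le> (LINT x|lborel. indicator (A i) x * norm (wave_int H (t i) x))"
      by (rule integral_mono[OF integrable_mult_right[OF fin] int])
         (use a(2)[OF i] in \<open>auto simp: H_def[abs_def] S_def split: split_indicator\<close>)
    also have "\<dots> = Re (LINT x|lborel. \<phi> i x * wave_int H (t i) x)"
      unfolding eq integral_complex_of_real by simp
    finally show ?thesis .
  qed
  have "a * M = (\<Sum>i\<in>I. a * measure lborel (A i))" by (simp add: M_def sum_distrib_left)
  also have "\<dots> \<le> (\<Sum>i\<in>I. Re (LINT x|lborel. \<phi> i x * wave_int H (t i) x))" by (intro sum_mono lower)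
  also have "\<dots> = Re (\<Sum>i\<in>I. (LINT \<xi>|lborel. H \<xi> * (cis (t i * norm \<xi>) * ft (\<phi> i) \<xi>)))" by (simp add: pair)
  also have "(\<Sum>i\<in>I. (LINT \<xi>|lborel. H \<xi> * (cis (t i * norm \<xi>) * ft (\<phi> i) \<xi>))) = (LINT \<xi>|lborel. H \<xi> * G \<xi>)"
    unfolding G_def sum_distrib_left by (rule Bochner_Integration.integral_sum[symmetric, OF term_int])
  also have "Re (LINT \<xi>|lborel. H \<xi> * G \<xi>) \<le> norm (LINT \<xi>|lborel. H \<xi> * G \<xi>)" by (rule complex_Re_le_cmod)
  finally have "ennreal (a * M) \<le> ennreal (norm (LINT \<xi>|lborel. H \<xi> * G \<xi>))" by (rule ennreal_leI)
  also have "\<dots> \<le> (\<integral>\<^sup>+\<xi>. ennreal (norm (H \<xi> * G \<xi>)) \<partial>lborel)" by (rule norm_integral_le_nn_integral)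
  \<comment> \<open>The exponent s is split as \<epsilon> + (s - \<epsilon>): above R the factor
    |\<xi>|^(-\<epsilon>), once squared, belongs to the band energy; the remainder is the weight of
    the dual estimate.\<close>
  also have "\<dots> = (\<integral>\<^sup>+\<xi>. (ennreal (norm (g \<xi>) * norm \<xi> powr - \<epsilon>) * indicator S \<xi>) * (ennreal (norm (G \<xi>) * norm \<xi> powr (\<epsilon> - s)) * indicator S \<xi>) \<partial>lborel)"
  proof (rule nn_integral_cong)
    fix \<xi> :: 'a
    show "ennreal (norm (H \<xi> * G \<xi>)) = (ennreal (norm (g \<xi>) * norm \<xi> powr - \<epsilon>) * indicator S \<xi>) * (ennreal (norm (G \<xi>) * norm \<xi> powr (\<epsilon> - s)) * indicator S \<xi>)"
    proof (cases "\<xi> \<in> S")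
      case True
      then have "\<xi> \<noteq> 0" using R by (auto simp: S_def)
      then have "norm (h \<xi>) = norm (g \<xi>) * norm \<xi> powr - \<epsilon> * norm \<xi> powr (\<epsilon> - s)"
        by (simp add: hg mult.assoc flip: powr_add)
      then have "norm (H \<xi> * G \<xi>) = (norm (g \<xi>) * norm \<xi> powr - \<epsilon>) * (norm (G \<xi>) * norm \<xi> powr (\<epsilon> - s))"
        using True by (simp add: H_def norm_mult)
      then show ?thesis using True by (simp add: ennreal_mult)
    qed (simp add: H_def)
  qed
  finally have "(ennreal (a * M))\<^sup>2 \<le> (\<integral>\<^sup>+\<xi>. (ennreal (norm (g \<xi>) * norm \<xi> powr - \<epsilon>) * indicator S \<xi>) * (ennreal (norm (G \<xi>) * norm \<xi> powr (\<epsilon> - s)) * indicator S \<xi>) \<partial>lborel)\<^sup>2"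
    by (intro power_mono) auto
  also have "\<dots> \<le> (\<integral>\<^sup>+\<xi>. (ennreal (norm (g \<xi>) * norm \<xi> powr - \<epsilon>) * indicator S \<xi>)\<^sup>2 \<partial>lborel) * (\<integral>\<^sup>+\<xi>. (ennreal (norm (G \<xi>) * norm \<xi> powr (\<epsilon> - s)) * indicator S \<xi>)\<^sup>2 \<partial>lborel)"
    by (rule Cauchy_Schwarz_nn_integral) measurable
  also have "\<dots> \<le> (ennreal (R powr (- 2 * \<epsilon>)) * band_energy \<epsilon> g R) *
      ennreal (high_const DIM('a) ?\<tau> * M powr (1 + 2 / (real DIM('a) + 1)) * R powr (?\<eta> - ?\<tau>))"
  proof (rule mult_mono)
    have "(\<integral>\<^sup>+\<xi>. (ennreal (norm (g \<xi>) * norm \<xi> powr - \<epsilon>) * indicator S \<xi>)\<^sup>2 \<partial>lborel) \<le>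
      (\<integral>\<^sup>+\<xi>. ennreal (R powr (- 2 * \<epsilon>)) * ennreal ((norm (g \<xi>))\<^sup>2 * band \<epsilon> R (norm \<xi>)) \<partial>lborel)"
    proof (rule nn_integral_mono)
      fix \<xi> :: 'a
      show "(ennreal (norm (g \<xi>) * norm \<xi> powr - \<epsilon>) * indicator S \<xi>)\<^sup>2 \<le> ennreal (R powr (- 2 * \<epsilon>)) * ennreal ((norm (g \<xi>))\<^sup>2 * band \<epsilon> R (norm \<xi>))"
      proof (cases "\<xi> \<in> S")
        case True
        then have n: "norm \<xi> \<ge> R" "norm \<xi> > 0" using R by (auto simp: S_def)
        have "(norm (g \<xi>) * norm \<xi> powr - \<epsilon>)\<^sup>2 = (norm (g \<xi>))\<^sup>2 * norm \<xi> powr (- 2 * \<epsilon>)"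
          using n by (simp add: power_mult_distrib powr_power mult.commute)
        also have "\<dots> = R powr (- 2 * \<epsilon>) * ((norm (g \<xi>))\<^sup>2 * band \<epsilon> R (norm \<xi>))"
          using n \<epsilon> R by (subst band_high[of R]) auto
        finally show ?thesis using True band_nonneg[of \<epsilon> R "norm \<xi>"]
          by (simp add: ennreal_power flip: ennreal_mult)
      qed simp
    qed
    then show "(\<integral>\<^sup>+\<xi>. (ennreal (norm (g \<xi>) * norm \<xi> powr - \<epsilon>) * indicator S \<xi>)\<^sup>2 \<partial>lborel) \<le> ennreal (R powr (- 2 * \<epsilon>)) * band_energy \<epsilon> g R"
      by (simp add: band_energy_def nn_integral_cmult)
    have "(\<integral>\<^sup>+\<xi>. (ennreal (norm (G \<xi>) * norm \<xi> powr (\<epsilon> - s)) * indicator S \<xi>)\<^sup>2 \<partial>lborel) =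
      (\<integral>\<^sup>+\<xi>. ennreal ((norm (\<Sum>i\<in>I. cis (t i * norm \<xi>) * ft (\<phi> i) \<xi>))\<^sup>2 * norm \<xi> powr - ?\<tau>) * indicator (- ball 0 R) \<xi> \<partial>lborel)"
    proof (rule nn_integral_cong)
      fix \<xi> :: 'a
      have "(norm \<xi> powr (\<epsilon> - s))\<^sup>2 = norm \<xi> powr - ?\<tau>"
        by (cases "\<xi> = 0") (simp_all add: powr_power algebra_simps)
      then have "(norm (G \<xi>) * norm \<xi> powr (\<epsilon> - s))\<^sup>2 = (norm (G \<xi>))\<^sup>2 * norm \<xi> powr - ?\<tau>"
        by (simp only: power_mult_distrib)
      then show "(ennreal (norm (G \<xi>) * norm \<xi> powr (\<epsilon> - s)) * indicator S \<xi>)\<^sup>2 = ennreal ((norm (\<Sum>i\<in>I. cis (t i * norm \<xi>) * ft (\<phi> i) \<xi>))\<^sup>2 * norm \<xi> powr - ?\<tau>) * indicator (- ball 0 R) \<xi>"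
        by (cases "\<xi> \<in> S") (simp_all add: ennreal_power G_def[symmetric] S_def[symmetric])
    qed
    also have "\<dots> \<le> ennreal (high_const DIM('a) ?\<tau> * M powr (1 + 2 / (real DIM('a) + 1)) * R powr (?\<eta> - ?\<tau>))"
      unfolding M_def by (rule wave_dual_bound_high[OF I disj A \<phi>_meas \<phi>_le R \<epsilon>(2)])
    finally show "(\<integral>\<^sup>+\<xi>. (ennreal (norm (G \<xi>) * norm \<xi> powr (\<epsilon> - s)) * indicator S \<xi>)\<^sup>2 \<partial>lborel) \<le> ennreal (high_const DIM('a) ?\<tau> * M powr (1 + 2 / (real DIM('a) + 1)) * R powr (?\<eta> - ?\<tau>))" .
  qed auto
  also have "\<dots> = ennreal (high_const DIM('a) ?\<tau> * M powr (1 + 2 / (real DIM('a) + 1)) * R powr (?\<eta> - 2 * s)) * band_energy \<epsilon> g R"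
  proof -
    have "R powr (- 2 * \<epsilon>) * R powr (?\<eta> - ?\<tau>) = R powr (?\<eta> - 2 * s)" by (simp flip: powr_add)
    then have eq: "R powr (- 2 * \<epsilon>) * (high_const DIM('a) ?\<tau> * M powr (1 + 2 / (real DIM('a) + 1)) * R powr (?\<eta> - ?\<tau>)) =
        high_const DIM('a) ?\<tau> * M powr (1 + 2 / (real DIM('a) + 1)) * R powr (?\<eta> - 2 * s)"
      by (simp only: mult.left_commute[of "R powr (- 2 * \<epsilon>)"])
    have pos: "high_const DIM('a) ?\<tau> * M powr (1 + 2 / (real DIM('a) + 1)) * R powr (?\<eta> - ?\<tau>) \<ge> 0"
      using high_const_pos[OF \<epsilon>(2)] by simp
    show ?thesis unfolding eq[symmetric] by (rule ennreal_mult_collect) (use pos in auto)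
  qed
  finally show ?thesis using a(1) M0 by (simp add: ennreal_power)
qed


lemma continuous_wave_int:
  fixes h :: "'a::euclidean_space \<Rightarrow> complex"
  assumes h: "integrable lborel h"
  shows "continuous_on UNIV (\<lambda>t. wave_int h t x)"
proof (rule continuous_on_sequentiallyI)
  fix u :: "nat \<Rightarrow> real" and a assume u: "u \<longlonglongrightarrow> a"
  have [measurable]: "h \<in> borel_measurable borel" using h by (auto dest: borel_measurable_integrable)
  show "(\<lambda>n. wave_int h (u n) x) \<longlonglongrightarrow> wave_int h a x"
    unfolding wave_int_def
  proof (rule integral_dominated_convergence[where w="\<lambda>\<xi>. norm (h \<xi>)"])
    show "AE \<xi> in lborel. (\<lambda>n. cis (x \<bullet> \<xi> + u n * norm \<xi>) * h \<xi>) \<longlonglongrightarrow> cis (x \<bullet> \<xi> + a * norm \<xi>) * h \<xi>"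
      unfolding cis_conv_exp by (intro AE_I2 tendsto_intros u)
  qed (use h in \<open>auto simp: norm_mult\<close>)
qed

text \<open>The exponent is the inverse of 2 - (1 + 2 / (d + 1)), the power of \<open>M\<close> that
  is left after cancellation in \<open>level_set_finite\<close>.\<close>

definition level_const :: "nat \<Rightarrow> real \<Rightarrow> real \<Rightarrow> real" where
  "level_const d s \<epsilon> = (high_const d (2 * s - 2 * \<epsilon>) / ball_const d (2 * s + 2 * \<epsilon>)) powr ((real d + 1) / (real d - 1))"

text \<open>The level is twice the uniform bound of the low part, so the high part must reach half
  of it on every \<open>A i\<close>. The squared level and the dual estimate both contain c^2, which
  cancels: the measure bound depends on R but not on the size of the data.\<close>

lemma level_set_finite:
  fixes A :: "'i \<Rightarrow> 'a::euclidean_space set" and h g :: "'a \<Rightarrow> complex" and s \<epsilon> R c :: real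
  assumes d: "DIM('a) \<ge> 2" and I: "finite I" and disj: "disjoint_family_on A I"
    and A: "\<And>i. i \<in> I \<Longrightarrow> A i \<in> sets borel" "\<And>i. i \<in> I \<Longrightarrow> emeasure lborel (A i) < \<infinity>"
    and h: "integrable lborel h" and g[measurable]: "g \<in> borel_measurable borel"
    and hg: "\<And>\<xi>. \<xi> \<noteq> 0 \<Longrightarrow> norm (h \<xi>) = norm \<xi> powr - s * norm (g \<xi>)"
    and R: "R > 0" and \<epsilon>: "0 \<le> \<epsilon>" "0 \<le> s" "2 * s + 2 * \<epsilon> < real DIM('a)" "2 * s - 2 * \<epsilon> > 2 * real DIM('a) / (real DIM('a) + 1)"
    and c: "band_energy \<epsilon> g R = ennreal (c\<^sup>2)" "c > 0"
    and a: "a = 2 * (sqrt (ball_const DIM('a) (2 * s + 2 * \<epsilon>)) * R powr (DIM('a) / 2 - s) * c)"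
    and big: "\<And>i x. i \<in> I \<Longrightarrow> x \<in> A i \<Longrightarrow> a < norm (wave_int h (t i) x)"
  defines "M \<equiv> \<Sum>i\<in>I. measure lborel (A i)"
  shows "M \<le> level_const DIM('a) s \<epsilon> * R powr - real DIM('a)"
proof -
  let ?d = "real DIM('a)" and ?\<tau> = "2 * s + 2 * \<epsilon>" and ?\<eta> = "2 * real DIM('a) / (real DIM('a) + 1)"
  define b where "b = a / 2"
  define Bc where "Bc = ball_const DIM('a) ?\<tau>"
  define Hc where "Hc = high_const DIM('a) (2 * s - 2 * \<epsilon>)"
  have Bc: "Bc > 0" unfolding Bc_def by (rule ball_const_pos[OF \<epsilon>(3)])
  have Hc: "Hc > 0" unfolding Hc_def by (rule high_const_pos[OF \<epsilon>(4)])
  have M0: "M \<ge> 0" by (simp add: M_def sum_nonneg)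
  have b: "b > 0" "b\<^sup>2 = Bc * R powr (?d - 2 * s) * c\<^sup>2"
  proof -
    show "b > 0" using Bc R c by (simp add: b_def a Bc_def[symmetric])
    have "(R powr (?d / 2 - s))\<^sup>2 = R powr (?d - 2 * s)" using R by (simp add: powr_power algebra_simps)
    then show "b\<^sup>2 = Bc * R powr (?d - 2 * s) * c\<^sup>2"
      using Bc by (simp add: b_def a Bc_def[symmetric] power_mult_distrib)
  qed
  have [measurable]: "h \<in> borel_measurable borel" using h by (auto dest: borel_measurable_integrable)
  define L where "L = (\<lambda>\<xi>. indicator (ball 0 R) \<xi> * h \<xi>)"
  define H where "H = (\<lambda>\<xi>. indicator (- ball 0 R) \<xi> * h \<xi>)"
  have L_int: "integrable lborel L" and H_int: "integrable lborel H"
    unfolding L_def H_def by (intro integrable_indicator_mult h; simp)+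
  have split: "wave_int h \<theta> x = wave_int L \<theta> x + wave_int H \<theta> x" for \<theta> x
  proof -
    have "wave_int L \<theta> x + wave_int H \<theta> x = (LINT \<xi>|lborel. cis (x \<bullet> \<xi> + \<theta> * norm \<xi>) * L \<xi> + cis (x \<bullet> \<xi> + \<theta> * norm \<xi>) * H \<xi>)"
      unfolding wave_int_def by (rule Bochner_Integration.integral_add[symmetric]) (rule integrable_wave L_int H_int)+
    also have "\<dots> = wave_int h \<theta> x"
      unfolding wave_int_def by (intro Bochner_Integration.integral_cong refl) (simp add: L_def H_def split: split_indicator)
    finally show ?thesis by simp
  qed
  have low: "norm (wave_int L \<theta> x) \<le> b" for \<theta> x
  proof -
    have "ennreal ((norm (wave_int L \<theta> x))\<^sup>2) = (ennreal (norm (wave_int L \<theta> x)))\<^sup>2" by (simp add: ennreal_power)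
    also have "\<dots> \<le> (\<integral>\<^sup>+\<xi>. ennreal (norm (L \<xi>)) \<partial>lborel)\<^sup>2" by (intro power_mono norm_wave_int_le) auto
    also have "(\<integral>\<^sup>+\<xi>. ennreal (norm (L \<xi>)) \<partial>lborel) = (\<integral>\<^sup>+\<xi>. ennreal (norm (h \<xi>)) * indicator (ball 0 R) \<xi> \<partial>lborel)"
      by (intro nn_integral_cong) (simp add: L_def norm_mult split: split_indicator)
    also have "\<dots>\<^sup>2 \<le> ennreal (Bc * R powr (?d - 2 * s)) * band_energy \<epsilon> g R"
      unfolding Bc_def by (rule low_frequency_bound) (use hg R \<epsilon> in auto)
    also have "\<dots> = ennreal (b\<^sup>2)" unfolding c(1) b(2) using Bc by (intro ennreal_mult[symmetric]) auto
    finally have "(norm (wave_int L \<theta> x))\<^sup>2 \<le> b\<^sup>2" by (subst (asm) ennreal_le_iff) auto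
    then show ?thesis by (rule power2_le_imp_le) (use b(1) in auto)
  qed
  have high: "b \<le> norm (wave_int H (t i) x)" if "i \<in> I" "x \<in> A i" for i x
  proof -
    have "2 * b < norm (wave_int L (t i) x + wave_int H (t i) x)"
      using big[OF that] by (simp add: b_def split[symmetric])
    also have "\<dots> \<le> b + norm (wave_int H (t i) x)"
      by (rule order_trans[OF norm_triangle_ineq]) (simp add: low)
    finally show ?thesis by simp
  qed
  show ?thesis
  proof (cases "M = 0")
    case False
    then have M: "M > 0" using M0 by simp
    have "ennreal ((b * M)\<^sup>2) \<le> ennreal (Hc * M powr (1 + 2 / (?d + 1)) * R powr (?\<eta> - 2 * s)) * band_energy \<epsilon> g R"
      unfolding Hc_def M_def
      by (rule high_frequency_bound[OF I disj A h g hg R \<epsilon>(1,4)]) (use b high in \<open>auto simp: H_def\<close>)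
    also have "\<dots> = ennreal (Hc * M powr (1 + 2 / (?d + 1)) * R powr (?\<eta> - 2 * s) * c\<^sup>2)"
      unfolding c(1) using Hc by (intro ennreal_mult[symmetric]) auto
    finally have "(b * M)\<^sup>2 \<le> Hc * M powr (1 + 2 / (?d + 1)) * R powr (?\<eta> - 2 * s) * c\<^sup>2"
      using Hc by (subst (asm) ennreal_le_iff) auto
    then have "(Bc * R powr (?d - 2 * s) * M\<^sup>2) * c\<^sup>2 \<le> (Hc * M powr (1 + 2 / (?d + 1)) * R powr (?\<eta> - 2 * s)) * c\<^sup>2"
      unfolding power_mult_distrib b(2) by (simp only: mult_ac)
    then have 1: "Bc * R powr (?d - 2 * s) * M\<^sup>2 \<le> Hc * M powr (1 + 2 / (?d + 1)) * R powr (?\<eta> - 2 * s)"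
      using c(2) by (subst (asm) mult_le_cancel_right) auto
    \<comment> \<open>The surplus power of \<open>M\<close> after division; the surplus power of
      \<open>R\<close> is then -d u, so that taking the root gives exactly R^(-d).\<close>
    define u where "u = (?d - 1) / (?d + 1)"
    have u: "u > 0" "1 / u = (?d + 1) / (?d - 1)" using d by (auto simp: u_def)
    have u1: "u = 1 - 2 / (?d + 1)"
    proof -
      have "u + 2 / (?d + 1) = (?d + 1) / (?d + 1)"
        unfolding u_def by (simp only: add_divide_distrib[symmetric]) simp
      also have "\<dots> = 1" by (rule divide_self) linarith
      finally show ?thesis by simp
    qed
    have e1: "M\<^sup>2 = M powr u * M powr (1 + 2 / (?d + 1))"
    proof -
      have "u + (1 + 2 / (?d + 1)) = 2" by (simp add: u1)
      then have "M powr 2 = M powr u * M powr (1 + 2 / (?d + 1))" by (metis powr_add)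
      then show ?thesis using M by simp
    qed
    have e2: "R powr (?\<eta> - 2 * s) = R powr (- ?d * u) * R powr (?d - 2 * s)"
    proof -
      have "- ?d * u + (?d - 2 * s) = ?\<eta> - 2 * s" by (simp add: u1 algebra_simps)
      then show ?thesis by (metis powr_add)
    qed
    have "(Bc * M powr u) * (R powr (?d - 2 * s) * M powr (1 + 2 / (?d + 1))) \<le> (Hc * R powr (- ?d * u)) * (R powr (?d - 2 * s) * M powr (1 + 2 / (?d + 1)))"
      using 1 unfolding e1 e2 by (simp only: mult_ac)
    then have "Bc * M powr u \<le> Hc * R powr (- ?d * u)"
      using M R by (subst (asm) mult_le_cancel_right) auto
    then have "M powr u \<le> (Hc / Bc) * R powr (- ?d * u)" using Bc by (simp add: field_simps)
    then have "(M powr u) powr (1 / u) \<le> ((Hc / Bc) * R powr (- ?d * u)) powr (1 / u)"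
      using u by (intro powr_mono2) auto
    also have "(M powr u) powr (1 / u) = M" using M u(1) by (simp add: powr_powr)
    also have "((Hc / Bc) * R powr (- ?d * u)) powr (1 / u) = (Hc / Bc) powr (1 / u) * R powr - ?d"
      using u(1) Bc Hc by (subst powr_mult) (auto simp: powr_powr)
    finally show ?thesis by (simp add: level_const_def Hc_def Bc_def u(2))
  qed (use R in \<open>simp add: level_const_def\<close>)
qed

text \<open>By continuity in time, a level exceeded at some time is exceeded at a rational one.
  Assigning each point to the first such rational in an enumeration gives disjoint sets and serves
  as the measurable choice of times. Finitely many rationals and a ball give the families of
  \<open>level_set_finite\<close>, whose bound survives the increasing limit.\<close>

lemma level_set:
  fixes h g :: "'a::euclidean_space \<Rightarrow> complex" and s \<epsilon> R c :: real
  assumes d: "DIM('a) \<ge> 2" and h: "integrable lborel h" and g[measurable]: "g \<in> borel_measurable borel"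
    and hg: "\<And>\<xi>. \<xi> \<noteq> 0 \<Longrightarrow> norm (h \<xi>) = norm \<xi> powr - s * norm (g \<xi>)"
    and R: "R > 0" and \<epsilon>: "0 \<le> \<epsilon>" "0 \<le> s" "2 * s + 2 * \<epsilon> < real DIM('a)" "2 * s - 2 * \<epsilon> > 2 * real DIM('a) / (real DIM('a) + 1)"
    and c: "band_energy \<epsilon> g R = ennreal (c\<^sup>2)" "c > 0"
    and a: "a = 2 * (sqrt (ball_const DIM('a) (2 * s + 2 * \<epsilon>)) * R powr (DIM('a) / 2 - s) * c)"
  shows "emeasure lborel {x. \<exists>t. a < norm (wave_int h t x)} \<le> ennreal (level_const DIM('a) s \<epsilon> * R powr - real DIM('a))"
    (is "_ \<le> ?K")
proof -
  have [measurable]: "h \<in> borel_measurable borel" using h by (auto dest: borel_measurable_integrable)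
  define r where "r = from_nat_into (\<rat> :: real set)"
  have r: "range r = \<rat>"
    unfolding r_def by (rule range_from_nat_into) (auto simp: countable_rat)
  define U where "U k = {x. a < norm (wave_int h (r k) x)}" for k
  have U_sets: "U k \<in> sets borel" for k unfolding U_def by measurable
  define A where "A n k = disjointed U k \<inter> ball 0 (real n)" for n k
  have A_sets[measurable]: "A n k \<in> sets borel" for n k
  proof -
    have "range (disjointed U) \<subseteq> sets borel"
      by (rule sets.range_disjointed_sets) (use U_sets in auto)
    then have "disjointed U k \<in> sets borel" by (simp add: image_subset_iff)
    then show ?thesis unfolding A_def by (intro sets.Int) auto
  qed
  define B where "B n = (\<Union>k\<in>{0..<n}. A n k)" for n
  have B_eq: "B n = (\<Union>k\<in>{0..<n}. U k) \<inter> ball 0 (real n)" for n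
    unfolding B_def A_def using finite_UN_disjointed_eq[of U n] by blast
  have A_fin: "emeasure lborel (A n k) < \<infinity>" for n k
    by (rule emeasure_bounded_finite) (auto simp: A_def)
  have le: "emeasure lborel (B n) \<le> ?K" for n
  proof -
    have "emeasure lborel (B n) \<le> (\<Sum>k\<in>{0..<n}. emeasure lborel (A n k))"
      unfolding B_def by (rule emeasure_subadditive_finite) auto
    also have "\<dots> = (\<Sum>k\<in>{0..<n}. ennreal (measure lborel (A n k)))"
      using A_fin by (intro sum.cong refl emeasure_eq_ennreal_measure) (auto simp: less_top)
    also have "\<dots> = ennreal (\<Sum>k\<in>{0..<n}. measure lborel (A n k))" by (simp only: sum_ennreal measure_nonneg)
    also have "\<dots> \<le> ?K"
    proof (rule ennreal_leI, rule level_set_finite[OF d _ _ _ _ h g hg R \<epsilon> c a])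
      show "disjoint_family_on (A n) {0..<n}"
        using disjoint_family_disjointed[of U] by (auto simp: disjoint_family_on_def A_def)
      show "a < norm (wave_int h (r k) x)" if "x \<in> A n k" for k x
        using that disjointed_subset[of U k] by (auto simp: A_def U_def)
    qed (use A_fin in auto)
    finally show ?thesis .
  qed
  have eq: "{x. \<exists>t. a < norm (wave_int h t x)} = (\<Union>n. B n)"
  proof (intro equalityI subsetI)
    fix x assume "x \<in> {x. \<exists>t. a < norm (wave_int h t x)}"
    then obtain t where t: "a < norm (wave_int h t x)" by blast
    define V where "V = {t. a < norm (wave_int h t x)}"
    have "open V" unfolding V_def
      using continuous_on_norm[OF continuous_wave_int[OF h, of x]] by (intro open_Collect_less) auto
    moreover have "t \<in> V" using t by (simp add: V_def)
    ultimately have "V \<inter> closure \<rat> \<noteq> {}" by (auto simp: Rats_closure_real)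
    then have "V \<inter> \<rat> \<noteq> {}" using \<open>open V\<close> open_Int_closure_eq_empty by blast
    then obtain y where "y \<in> V" "y \<in> \<rat>" by blast
    then obtain k where k: "r k \<in> V" using r by (metis rangeE)
    obtain m where m: "norm x < real m" using reals_Archimedean2 by blast
    have "x \<in> B (max (Suc k) m)" using k m by (auto simp: B_eq U_def V_def)
    then show "x \<in> (\<Union>n. B n)" by blast
  qed (auto simp: B_eq U_def)
  have SUP: "(SUP n. emeasure lborel (B n)) = emeasure lborel (\<Union>n. B n)"
  proof (rule SUP_emeasure_incseq)
    show "range B \<subseteq> sets lborel" unfolding B_def by auto
    show "incseq B"
      unfolding incseq_def B_eq by (intro allI impI Int_mono UN_mono subset_ball) auto
  qed
  show ?thesis unfolding eq SUP[symmetric] by (rule SUP_least) (rule le)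
qed

section \<open>Summation over dyadic frequencies\<close>

text \<open>Growth by at least a fixed factor makes the values tend to 0 at minus infinity and to
  infinity at plus infinity, so the half-open intervals between consecutive values cover the
  positive reals.\<close>

lemma geometric_bracket:
  fixes a :: "int \<Rightarrow> real"
  assumes lam: "\<mu> > 1" and pos: "\<And>N. a N > 0" and step: "\<And>N. \<mu> * a N \<le> a (N + 1)" and y: "y > 0"
  obtains N where "a N \<le> y" "y < a (N + 1)"
proof -
  have up: "\<mu> ^ n * a N \<le> a (N + int n)" for n N
  proof (induction n)
    case (Suc n)
    have "\<mu> ^ Suc n * a N = \<mu> * (\<mu> ^ n * a N)" by simp
    also have "\<dots> \<le> \<mu> * a (N + int n)" using lam by (intro mult_left_mono Suc.IH) auto
    also have "\<dots> \<le> a (N + int n + 1)" by (rule step)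
    finally show ?case by (simp add: algebra_simps)
  qed simp
  obtain n0 where n0: "a 0 / y < \<mu> ^ n0" using real_arch_pow[OF lam] by blast
  have "\<mu> ^ n0 * a (- int n0) \<le> a 0" using up[of n0 "- int n0"] by simp
  also have "\<dots> < \<mu> ^ n0 * y" using n0 y by (simp add: field_simps)
  finally have N0: "a (- int n0) < y" using lam by (simp add: mult_less_cancel_left_pos)
  obtain n1 where n1: "y / a (- int n0) < \<mu> ^ n1" using real_arch_pow[OF lam] by blast
  then have "y < \<mu> ^ n1 * a (- int n0)" using pos[of "- int n0"] by (simp add: field_simps)
  then have ex: "y < a (- int n0 + int n1)" using up[of n1 "- int n0"] by linarith
  \<comment> \<open>The least such index is not 0, because \<open>a (- int n0) < y\<close>; its
    predecessor is the required one.\<close>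
  define n where "n = (LEAST n. y < a (- int n0 + int n))"
  have n: "y < a (- int n0 + int n)" unfolding n_def by (rule LeastI[of "\<lambda>n. y < a (- int n0 + int n)", OF ex])
  then obtain m where m: "n = Suc m" using N0 by (cases n) auto
  have "\<not> y < a (- int n0 + int m)" by (rule not_less_Least) (use m n_def in simp)
  then show ?thesis using that[of "- int n0 + int m"] n m by (simp add: algebra_simps)
qed

text \<open>The integers are covered by two half-lines that share K. Counting K twice is harmless in
  an upper bound and makes each half an ordinary series.\<close>

lemma nn_integral_int_le:
  "(\<integral>\<^sup>+M. f M \<partial>count_space UNIV) \<le> (\<Sum>n. f (K + int n)) + (\<Sum>n. f (K - int n))"
proof -
  let ?A = "range (\<lambda>n. K + int n)" and ?B = "range (\<lambda>n. K - int n)"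
  have "M \<in> ?A \<or> M \<in> ?B" for M
  proof (cases "M \<ge> K")
    case True
    then have "M = K + int (nat (M - K))" by simp
    then show ?thesis by blast
  next
    case False
    then have "M = K - int (nat (K - M))" by simp
    then show ?thesis by blast
  qed
  then have "(\<integral>\<^sup>+M. f M \<partial>count_space UNIV) \<le> (\<integral>\<^sup>+M. f M * indicator ?A M + f M * indicator ?B M \<partial>count_space UNIV)"
    by (intro nn_integral_mono) (auto split: split_indicator)
  also have "\<dots> = (\<integral>\<^sup>+M. f M \<partial>count_space ?A) + (\<integral>\<^sup>+M. f M \<partial>count_space ?B)"
    by (subst nn_integral_add) (auto simp: nn_integral_count_space_indicator)
  also have "(\<integral>\<^sup>+M. f M \<partial>count_space ?A) = (\<Sum>n. f (K + int n))"
    by (subst nn_integral_bij_count_space[symmetric, of "\<lambda>n. K + int n" UNIV])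
       (auto simp: bij_betw_def inj_on_def nn_integral_count_space_nat)
  also have "(\<integral>\<^sup>+M. f M \<partial>count_space ?B) = (\<Sum>n. f (K - int n))"
    by (subst nn_integral_bij_count_space[symmetric, of "\<lambda>n. K - int n" UNIV])
       (auto simp: bij_betw_def inj_on_def nn_integral_count_space_nat)
  finally show ?thesis .
qed

text \<open>Two geometric tails of ratio 2^(-2 \<epsilon>), one on each side of the given frequency;
  2^(2 \<epsilon>) is the loss from rounding its logarithm.\<close>

definition overlap_const :: "real \<Rightarrow> real" where
  "overlap_const \<epsilon> = 2 * (2 powr (2 * \<epsilon>) / (1 - 2 powr (- 2 * \<epsilon>)))"

lemma overlap_const_nonneg: "\<epsilon> > 0 \<Longrightarrow> overlap_const \<epsilon> \<ge> 0"
  using powr_less_one[of 2 "- 2 * \<epsilon>"] unfolding overlap_const_def by (intro mult_nonneg_nonneg divide_nonneg_nonneg) auto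

text \<open>Relative to the dyadic index \<open>K\<close> of r the band weight decays geometrically
  on both sides. The free shift k serves the later sums, in which a level set is paired with the
  energy one or two steps further up.\<close>

lemma sum_band_le:
  assumes \<epsilon>: "\<epsilon> > 0" and r0: "r \<ge> 0"
  shows "(\<integral>\<^sup>+N. ennreal (band \<epsilon> (2 powr real_of_int (N + k)) r) \<partial>count_space UNIV) \<le> ennreal (overlap_const \<epsilon>)"
proof (cases "r > 0")
  case True
  define K where "K = \<lfloor>log 2 r\<rfloor> - k"
  define \<theta> where "\<theta> = log 2 r - real_of_int \<lfloor>log 2 r\<rfloor>"
  have \<theta>: "0 \<le> \<theta>" "\<theta> \<le> 1" unfolding \<theta>_def by linarith+
  have r: "r = 2 powr (log 2 r)" using True by simp
  have quot: "r / 2 powr real_of_int (K + m + k) = 2 powr (\<theta> - real_of_int m)" for m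
    by (subst r) (simp add: K_def \<theta>_def algebra_simps flip: powr_diff)
  have pw: "(2 powr (- 2 * \<epsilon>)) ^ n = 2 powr (- 2 * \<epsilon> * real n)" for n
    by (simp add: powr_powr flip: powr_realpow)
  have 1: "band \<epsilon> (2 powr real_of_int (K + int n + k)) r \<le> 2 powr (2 * \<epsilon>) * (2 powr (- 2 * \<epsilon>)) ^ n" for n
  proof -
    have "band \<epsilon> (2 powr real_of_int (K + int n + k)) r \<le> (2 powr (\<theta> - real n)) powr (2 * \<epsilon>)"
      unfolding band_def quot by simp
    also have "\<dots> \<le> 2 powr (2 * \<epsilon> + - 2 * \<epsilon> * real n)"
      unfolding powr_powr using \<theta> \<epsilon> by (intro powr_mono) (auto simp: algebra_simps)
    finally show ?thesis by (simp only: pw powr_add)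
  qed
  have 2: "band \<epsilon> (2 powr real_of_int (K - int n + k)) r \<le> 2 powr (2 * \<epsilon>) * (2 powr (- 2 * \<epsilon>)) ^ n" for n
  proof -
    have q: "r / 2 powr real_of_int (K - int n + k) = 2 powr (\<theta> + real n)" using quot[of "- int n"] by simp
    have "band \<epsilon> (2 powr real_of_int (K - int n + k)) r \<le> (2 powr (\<theta> + real n)) powr (- 2 * \<epsilon>)"
      unfolding band_def q by simp
    also have "\<dots> \<le> 2 powr (2 * \<epsilon> + - 2 * \<epsilon> * real n)"
    proof -
      have "0 \<le> \<epsilon> * \<theta>" using \<theta> \<epsilon> by simp
      then have "- (\<epsilon> * \<theta>) \<le> \<epsilon>" using \<epsilon> by linarith
      then show ?thesis unfolding powr_powr by (intro powr_mono) (auto simp: algebra_simps)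
    qed
    finally show ?thesis by (simp only: pw powr_add)
  qed
  have "(\<integral>\<^sup>+N. ennreal (band \<epsilon> (2 powr real_of_int (N + k)) r) \<partial>count_space UNIV) \<le>
    (\<Sum>n. ennreal (band \<epsilon> (2 powr real_of_int (K + int n + k)) r)) + (\<Sum>n. ennreal (band \<epsilon> (2 powr real_of_int (K - int n + k)) r))"
    by (rule nn_integral_int_le)
  also have "\<dots> \<le> (\<Sum>n. ennreal (2 powr (2 * \<epsilon>) * (2 powr (- 2 * \<epsilon>)) ^ n)) + (\<Sum>n. ennreal (2 powr (2 * \<epsilon>) * (2 powr (- 2 * \<epsilon>)) ^ n))"
    by (intro add_mono suminf_le summableI ennreal_leI 1 2)
  also have "(\<Sum>n. ennreal (2 powr (2 * \<epsilon>) * (2 powr (- 2 * \<epsilon>)) ^ n)) = ennreal (2 powr (2 * \<epsilon>) / (1 - 2 powr (- 2 * \<epsilon>)))"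
    using \<epsilon> by (intro suminf_ennreal_geometric) (auto simp: powr_less_one)
  also have "ennreal (2 powr (2 * \<epsilon>) / (1 - 2 powr (- 2 * \<epsilon>))) + ennreal (2 powr (2 * \<epsilon>) / (1 - 2 powr (- 2 * \<epsilon>))) = ennreal (overlap_const \<epsilon>)"
    using \<epsilon> powr_less_one[of 2 "- 2 * \<epsilon>"] unfolding overlap_const_def mult_2 by (intro ennreal_plus[symmetric] divide_nonneg_nonneg) auto
  finally show ?thesis .
next
  case False
  \<comment> \<open>At r = 0 the weight is 0, since \<open>0 powr x = 0\<close> for both
    exponents.\<close>
  then have "r = 0" using r0 by simp
  then show ?thesis by (simp add: band_def)
qed

lemma sum_band_energy_le:
  fixes g :: "'a::euclidean_space \<Rightarrow> complex"
  assumes \<epsilon>: "\<epsilon> > 0" and [measurable]: "g \<in> borel_measurable borel"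
  shows "(\<integral>\<^sup>+N. band_energy \<epsilon> g (2 powr real_of_int (N + k)) \<partial>count_space UNIV) \<le> 
    ennreal (overlap_const \<epsilon>) * (\<integral>\<^sup>+\<xi>. ennreal ((norm (g \<xi>))\<^sup>2) \<partial>lborel)"
proof -
  have "(\<integral>\<^sup>+N. band_energy \<epsilon> g (2 powr real_of_int (N + k)) \<partial>count_space UNIV) = 
     (\<integral>\<^sup>+\<xi>. (\<integral>\<^sup>+N. ennreal ((norm (g \<xi>))\<^sup>2 * band \<epsilon> (2 powr real_of_int (N + k)) (norm \<xi>)) \<partial>count_space UNIV) \<partial>lborel)"
    unfolding band_energy_def by (rule nn_integral_count_space_nn_integral[symmetric]) auto
  also have "\<dots> = (\<integral>\<^sup>+\<xi>. ennreal ((norm (g \<xi>))\<^sup>2) * (\<integral>\<^sup>+N. ennreal (band \<epsilon> (2 powr real_of_int (N + k)) (norm \<xi>)) \<partial>count_space UNIV) \<partial>lborel)"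
    by (simp add: ennreal_mult band_nonneg nn_integral_cmult)
  also have "\<dots> \<le> (\<integral>\<^sup>+\<xi>. ennreal ((norm (g \<xi>))\<^sup>2) * ennreal (overlap_const \<epsilon>) \<partial>lborel)"
    by (intro nn_integral_mono mult_left_mono sum_band_le \<epsilon> norm_ge_zero) simp
  also have "\<dots> = ennreal (overlap_const \<epsilon>) * (\<integral>\<^sup>+\<xi>. ennreal ((norm (g \<xi>))\<^sup>2) \<partial>lborel)"
    by (simp add: nn_integral_cmult mult.commute)
  finally show ?thesis .
qed

definition max_wave :: "('a::euclidean_space \<Rightarrow> complex) \<Rightarrow> 'a \<Rightarrow> ennreal" where
  "max_wave h x = (SUP t. ennreal (norm (wave_int h t x)))"

lemma max_wave_level: "a \<ge> 0 \<Longrightarrow> {x. ennreal a < max_wave h x} = {x. \<exists>t. a < norm (wave_int h t x)}"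
  by (auto simp: max_wave_def less_SUP_iff ennreal_less_iff)

lemma band_pos: "r > 0 \<Longrightarrow> R > 0 \<Longrightarrow> band \<epsilon> R r > 0"
  by (simp add: band_def)

lemma band_le_1: "r \<ge> 0 \<Longrightarrow> R > 0 \<Longrightarrow> \<epsilon> \<ge> 0 \<Longrightarrow> band \<epsilon> R r \<le> 1"
proof (cases "r \<le> R")
  case True
  moreover assume "r \<ge> 0" "R > 0" "\<epsilon> \<ge> 0"
  ultimately have "(r / R) powr (2 * \<epsilon>) \<le> 1" by (intro powr_le1) auto
  then show ?thesis by (simp add: band_def)
next
  case False
  moreover assume "r \<ge> 0" "R > 0" "\<epsilon> \<ge> 0"
  ultimately have "(r / R) powr (- 2 * \<epsilon>) \<le> (r / R) powr 0" by (intro powr_mono) auto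
  then show ?thesis using False \<open>R > 0\<close> by (simp add: band_def)
qed

text \<open>Under doubling of R one of the two powers loses the factor 2^(-2 \<epsilon>) and the
  other gains, so their minimum loses no more than that.\<close>

lemma band_double:
  assumes "\<epsilon> \<ge> 0" "R > 0" "r \<ge> 0" shows "2 powr (- 2 * \<epsilon>) * band \<epsilon> R r \<le> band \<epsilon> (2 * R) r"
proof -
  have half: "r / (2 * R) = (r / R) * (1 / 2)" by simp
  have 1: "(r / (2 * R)) powr (2 * \<epsilon>) = 2 powr (- 2 * \<epsilon>) * (r / R) powr (2 * \<epsilon>)"
    unfolding half using assms by (subst powr_mult) (auto simp: powr_divide powr_minus_divide)
  have 2: "(r / (2 * R)) powr (- 2 * \<epsilon>) = 2 powr (2 * \<epsilon>) * (r / R) powr (- 2 * \<epsilon>)"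
    unfolding half using assms by (subst powr_mult) (auto simp: powr_divide powr_minus_divide)
  have "2 powr (- 2 * \<epsilon>) \<le> 2 powr (2 * \<epsilon>)" using assms by (intro powr_mono) auto
  then have 3: "2 powr (- 2 * \<epsilon>) * (r / R) powr (- 2 * \<epsilon>) \<le> (r / (2 * R)) powr (- 2 * \<epsilon>)"
    unfolding 2 by (intro mult_right_mono) auto
  have 4: "2 powr (- 2 * \<epsilon>) * band \<epsilon> R r \<le> 2 powr (- 2 * \<epsilon>) * (r / R) powr (- 2 * \<epsilon>)"
    "2 powr (- 2 * \<epsilon>) * band \<epsilon> R r \<le> 2 powr (- 2 * \<epsilon>) * (r / R) powr (2 * \<epsilon>)"
    by (intro mult_left_mono; simp add: band_def)+
  show ?thesis unfolding band_def[of _ "2 * R"] 1 by (intro min.boundedI 4(2) order_trans[OF 4(1) 3])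
qed

text \<open>The levels are 2 sqrt(B) 2^(N (d/2 - s)) sqrt(e N) with B the ball constant. A doubling
  of the frequency costs the energy at most 2^(-2 \<epsilon>), so the levels grow at least by the
  factor 2^(d/2 - s - \<epsilon>), which exceeds 1 by the condition 2 s + 2 \<epsilon> < d.\<close>

lemma wave_levels:
  fixes h g :: "'a::euclidean_space \<Rightarrow> complex" and s \<epsilon> :: real
  assumes d: "DIM('a) \<ge> 2" and h: "integrable lborel h" and g[measurable]: "g \<in> borel_measurable borel"
    and hg: "\<And>\<xi>. \<xi> \<noteq> 0 \<Longrightarrow> norm (h \<xi>) = norm \<xi> powr - s * norm (g \<xi>)"
    and \<epsilon>: "0 < \<epsilon>" "0 \<le> s" "2 * s + 2 * \<epsilon> < real DIM('a)" "2 * s - 2 * \<epsilon> > 2 * real DIM('a) / (real DIM('a) + 1)"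
    and g2: "(\<integral>\<^sup>+\<xi>. ennreal ((norm (g \<xi>))\<^sup>2) \<partial>lborel) = ennreal n2" "n2 > 0"
  obtains a e :: "int \<Rightarrow> real" and \<mu> :: real where "\<mu> > 1" "\<And>N. a N > 0" "\<And>N. \<mu> * a N \<le> a (N + 1)"
    "\<And>N. emeasure lborel {x. ennreal (a N) < max_wave h x} \<le> ennreal (level_const DIM('a) s \<epsilon> * 2 powr (- (real DIM('a) * real_of_int N)))"
    "\<And>N. band_energy \<epsilon> g (2 powr real_of_int N) = ennreal (e N)" "\<And>N. 0 \<le> e N" "\<And>N. e N \<le> n2"
    "\<And>N. (a N)\<^sup>2 = 4 * ball_const DIM('a) (2 * s + 2 * \<epsilon>) * 2 powr (real_of_int N * (real DIM('a) - 2 * s)) * e N"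
proof -
  let ?d = "real DIM('a)"
  define E where "E R = band_energy \<epsilon> g R" for R
  define Bc where "Bc = ball_const DIM('a) (2 * s + 2 * \<epsilon>)"
  have Bc: "Bc > 0" unfolding Bc_def by (rule ball_const_pos[OF \<epsilon>(3)])
  have E_le: "E R \<le> ennreal n2" if "R > 0" for R
    unfolding E_def band_energy_def g2(1)[symmetric]
    using that \<epsilon> by (intro nn_integral_mono ennreal_leI mult_right_le_one_le band_le_1 band_nonneg) auto
  \<comment> \<open>The band weight vanishes only at the origin, so a band without energy would
    force \<open>g\<close> to vanish almost everywhere.\<close>
  have E_pos: "E R > 0" if R: "R > 0" for R
  proof (rule ccontr)
    assume "\<not> E R > 0"
    then have "(\<integral>\<^sup>+\<xi>. ennreal ((norm (g \<xi>))\<^sup>2 * band \<epsilon> R (norm \<xi>)) \<partial>lborel) = 0" by (simp add: E_def band_energy_def)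
    then have "AE \<xi> in lborel. ennreal ((norm (g \<xi>))\<^sup>2 * band \<epsilon> R (norm \<xi>)) = 0"
      by (subst (asm) nn_integral_0_iff_AE) auto
    then have "AE \<xi> in lborel. ennreal ((norm (g \<xi>))\<^sup>2) = 0"
      using AE_lborel_singleton[of "0::'a"]
    proof eventually_elim
      case (elim \<xi>)
      then have "(norm (g \<xi>))\<^sup>2 * band \<epsilon> R (norm \<xi>) \<le> 0" by (simp add: ennreal_eq_0_iff)
      moreover have "band \<epsilon> R (norm \<xi>) > 0" using elim R by (intro band_pos) auto
      ultimately show ?case by (simp add: mult_le_0_iff)
    qed
    then have "(\<integral>\<^sup>+\<xi>. ennreal ((norm (g \<xi>))\<^sup>2) \<partial>lborel) = 0" by (subst nn_integral_0_iff_AE) auto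
    then show False using g2 by simp
  qed
  define f where "f R = enn2real (E R)" for R
  have Ef: "E R = ennreal (f R)" if "R > 0" for R
    using le_less_trans[OF E_le[OF that] ennreal_less_top] by (simp add: f_def)
  have f_pos: "f R > 0" if "R > 0" for R using E_pos[OF that] unfolding Ef[OF that] by simp
  have f_le: "f R \<le> n2" if "R > 0" for R using E_le[OF that] g2(2) unfolding Ef[OF that] by (simp add: ennreal_le_iff)
  have f_double: "2 powr (- 2 * \<epsilon>) * f R \<le> f (2 * R)" if R: "R > 0" for R
  proof -
    have "ennreal (2 powr (- 2 * \<epsilon>) * f R) = ennreal (2 powr (- 2 * \<epsilon>)) * E R"
      unfolding Ef[OF R] using f_pos[OF R] by (simp add: ennreal_mult)
    also have "\<dots> = (\<integral>\<^sup>+\<xi>. ennreal (2 powr (- 2 * \<epsilon>)) * ennreal ((norm (g \<xi>))\<^sup>2 * band \<epsilon> R (norm \<xi>)) \<partial>lborel)"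
      unfolding E_def band_energy_def by (rule nn_integral_cmult[symmetric]) measurable
    also have "\<dots> \<le> E (2 * R)"
      unfolding E_def band_energy_def
    proof (rule nn_integral_mono)
      fix \<xi> :: 'a
      have "(norm (g \<xi>))\<^sup>2 * (2 powr (- 2 * \<epsilon>) * band \<epsilon> R (norm \<xi>)) \<le> (norm (g \<xi>))\<^sup>2 * band \<epsilon> (2 * R) (norm \<xi>)"
        using \<epsilon> R by (intro mult_left_mono band_double) auto
      then show "ennreal (2 powr (- 2 * \<epsilon>)) * ennreal ((norm (g \<xi>))\<^sup>2 * band \<epsilon> R (norm \<xi>)) \<le> ennreal ((norm (g \<xi>))\<^sup>2 * band \<epsilon> (2 * R) (norm \<xi>))"
        by (simp add: band_nonneg mult.left_commute ennreal_leI flip: ennreal_mult)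
    qed
    also have "\<dots> = ennreal (f (2 * R))" using R by (intro Ef) simp
    finally show ?thesis using f_pos[of "2 * R"] R by (simp add: ennreal_le_iff)
  qed
  define b where "b R = 2 * (sqrt Bc * R powr (?d / 2 - s) * sqrt (f R))" for R
  define \<mu> where "\<mu> = 2 powr (?d / 2 - s - \<epsilon>)"
  show ?thesis
  proof (rule that[of \<mu> "\<lambda>N. b (2 powr real_of_int N)" "\<lambda>N. f (2 powr real_of_int N)"])
    show "\<mu> > 1" unfolding \<mu>_def using \<epsilon> by (intro gr_one_powr) (auto simp: field_simps)
    show "b (2 powr real_of_int N) > 0" for N using Bc f_pos by (simp add: b_def)
    show "\<mu> * b (2 powr real_of_int N) \<le> b (2 powr real_of_int (N + 1))" for N
    proof -
      define R where "R = 2 powr real_of_int N"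
      have R: "R > 0" "2 powr real_of_int (N + 1) = 2 * R" by (auto simp: R_def powr_add)
      have "2 powr - \<epsilon> * sqrt (f R) = sqrt (2 powr (- 2 * \<epsilon>) * f R)"
      proof -
        have "(2 powr - \<epsilon>)\<^sup>2 = 2 powr (- 2 * \<epsilon>)" by (simp add: powr_power)
        then have "sqrt (2 powr (- 2 * \<epsilon>)) = 2 powr - \<epsilon>" by (metis powr_ge_zero real_sqrt_unique)
        then show ?thesis by (simp add: real_sqrt_mult)
      qed
      also have "\<dots> \<le> sqrt (f (2 * R))" using f_double[OF R(1)] by simp
      finally have 1: "2 powr - \<epsilon> * sqrt (f R) \<le> sqrt (f (2 * R))" .
      have "\<mu> = 2 powr (?d / 2 - s) * 2 powr - \<epsilon>" by (simp add: \<mu>_def flip: powr_add)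
      then have "\<mu> * b R = 2 * (sqrt Bc * (2 powr (?d / 2 - s) * R powr (?d / 2 - s)) * (2 powr - \<epsilon> * sqrt (f R)))"
        by (simp add: b_def)
      also have "\<dots> \<le> 2 * (sqrt Bc * (2 powr (?d / 2 - s) * R powr (?d / 2 - s)) * sqrt (f (2 * R)))"
        using 1 Bc by (intro mult_left_mono) auto
      also have "\<dots> = b (2 * R)" using R by (simp add: b_def powr_mult)
      finally show ?thesis unfolding R(2) R_def .
    qed
    show "emeasure lborel {x. ennreal (b (2 powr real_of_int N)) < max_wave h x} \<le> ennreal (level_const DIM('a) s \<epsilon> * 2 powr (- (?d * real_of_int N)))" for N
    proof -
      define R where "R = 2 powr real_of_int N"
      have R: "R > 0" by (simp add: R_def)
      have b0: "b R \<ge> 0" using Bc f_pos[OF R] by (simp add: b_def)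
      have "emeasure lborel {x. \<exists>t. b R < norm (wave_int h t x)} \<le> ennreal (level_const DIM('a) s \<epsilon> * R powr - ?d)"
      proof (rule level_set[OF d h g hg R _ \<epsilon>(2-4)])
        show "band_energy \<epsilon> g R = ennreal ((sqrt (f R))\<^sup>2)" using Ef[OF R] f_pos[OF R] by (simp add: E_def)
        show "b R = 2 * (sqrt (ball_const DIM('a) (2 * s + 2 * \<epsilon>)) * R powr (DIM('a) / 2 - s) * sqrt (f R))"
          by (simp add: b_def Bc_def)
      qed (use f_pos[OF R] \<epsilon> in auto)
      also have "R powr - ?d = 2 powr (- (?d * real_of_int N))" by (simp add: R_def powr_powr mult.commute)
      finally show ?thesis unfolding R_def[symmetric] max_wave_level[OF b0] .
    qed
    show "band_energy \<epsilon> g (2 powr real_of_int N) = ennreal (f (2 powr real_of_int N))" for N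
      using Ef[of "2 powr real_of_int N"] by (simp add: E_def)
    show "0 \<le> f (2 powr real_of_int N)" "f (2 powr real_of_int N) \<le> n2" for N
      using f_pos[of "2 powr real_of_int N"] f_le[of "2 powr real_of_int N"] by auto
    show "(b (2 powr real_of_int N))\<^sup>2 = 4 * ball_const DIM('a) (2 * s + 2 * \<epsilon>) * 2 powr (real_of_int N * (?d - 2 * s)) * f (2 powr real_of_int N)" for N
    proof -
      define R where "R = 2 powr real_of_int N"
      have R: "R > 0" by (simp add: R_def)
      have "(R powr (?d / 2 - s))\<^sup>2 = R powr (?d - 2 * s)" using R by (simp add: powr_power algebra_simps)
      also have "\<dots> = 2 powr (real_of_int N * (?d - 2 * s))" by (simp add: R_def powr_powr)
      finally have 1: "(R powr (?d / 2 - s))\<^sup>2 = 2 powr (real_of_int N * (?d - 2 * s))" .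
      have "(b R)\<^sup>2 = 4 * Bc * (R powr (?d / 2 - s))\<^sup>2 * f R"
        using Bc f_pos[OF R] by (simp add: b_def power_mult_distrib)
      then show ?thesis unfolding 1 by (simp add: R_def Bc_def)
    qed
  qed
qed

section \<open>Lorentz and Lebesgue norms of the maximal function\<close>

lemma ennreal_powr_ennreal [simp]: "x \<ge> 0 \<Longrightarrow> ennreal_powr (ennreal x) p = ennreal (x powr p)"
  by (simp add: ennreal_powr_def)

lemma ennreal_powr_0 [simp]: "ennreal_powr 0 p = 0"
  by (simp add: ennreal_powr_def)

lemma ennreal_powr_top [simp]: "ennreal_powr top p = top"
  by (simp add: ennreal_powr_def)

lemma ennreal_powr_mono:
  assumes "a \<le> b" "p \<ge> 0" shows "ennreal_powr a p \<le> ennreal_powr b p"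
proof (cases b)
  case (real y)
  then obtain x where "a = ennreal x" "x \<ge> 0" using assms(1) by (cases a) (auto simp: top_unique)
  then show ?thesis using real assms by (auto simp: ennreal_le_iff intro!: ennreal_leI powr_mono2)
qed simp

lemma ennreal_powr_measurable [measurable (raw)]:
  assumes [measurable]: "f \<in> borel_measurable M"
  shows "(\<lambda>x. ennreal_powr (f x) p) \<in> borel_measurable M"
  unfolding ennreal_powr_def by measurable

lemma ennreal_powr_inverse:
  assumes "p > 0" shows "ennreal_powr (ennreal_powr a p) (1 / p) = a"
  using assms by (cases a) (auto simp: powr_powr)

lemma SUP_rationals:
  fixes f :: "real \<Rightarrow> complex"
  assumes cont: "continuous_on UNIV f"
  shows "(SUP t. ennreal (norm (f t))) = (SUP t\<in>\<rat>. ennreal (norm (f t)))"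
proof (rule antisym)
  show "(SUP t. ennreal (norm (f t))) \<le> (SUP t\<in>\<rat>. ennreal (norm (f t)))"
  proof (rule SUP_least)
    fix t :: real
    have "t \<in> closure \<rat>" by (simp add: Rats_closure_real)
    then obtain r where r: "\<And>n. r n \<in> \<rat>" "r \<longlonglongrightarrow> t" unfolding closure_sequential by blast
    have "(\<lambda>n. ennreal (norm (f (r n)))) \<longlonglongrightarrow> ennreal (norm (f t))"
      by (intro tendsto_ennrealI tendsto_norm continuous_on_tendsto_compose[OF cont r(2)]) auto
    then show "ennreal (norm (f t)) \<le> (SUP t\<in>\<rat>. ennreal (norm (f t)))"
      by (rule LIMSEQ_le_const2) (use r(1) in \<open>auto intro!: exI[of _ 0] SUP_upper\<close>)
  qed
qed (rule SUP_subset_mono, auto)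

lemma borel_measurable_SUP_time:
  fixes u :: "real \<Rightarrow> 'a \<Rightarrow> complex"
  assumes "\<And>t. u t \<in> borel_measurable M" "\<And>x. continuous_on UNIV (\<lambda>t. u t x)"
  shows "(\<lambda>x. SUP t. ennreal (norm (u t x))) \<in> borel_measurable M"
proof -
  have [measurable]: "u t \<in> borel_measurable M" for t by (rule assms(1))
  show ?thesis
    unfolding SUP_rationals[OF assms(2)] by (rule borel_measurable_SUP) (auto simp: countable_rat)
qed

lemma max_wave_measurable:
  assumes "integrable lborel h" shows "max_wave h \<in> borel_measurable borel"
proof -
  have [measurable]: "h \<in> borel_measurable borel" using assms by (auto dest: borel_measurable_integrable)
  show ?thesis unfolding max_wave_def[abs_def]
    by (rule borel_measurable_SUP_time) (auto intro: continuous_wave_int assms)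
qed

lemma max_wave_finite:
  assumes "integrable lborel h" shows "max_wave h x < \<infinity>"
proof -
  have "max_wave h x \<le> (\<integral>\<^sup>+\<xi>. ennreal (norm (h \<xi>)) \<partial>lborel)"
    unfolding max_wave_def by (rule SUP_least) (rule norm_wave_int_le)
  also have "\<dots> < \<infinity>" using assms by (simp add: integrable_iff_bounded)
  finally show ?thesis .
qed

lemma max_wave_eq_0:
  assumes [measurable]: "h \<in> borel_measurable borel" "g \<in> borel_measurable borel"
    and hg: "\<And>\<xi>. \<xi> \<noteq> 0 \<Longrightarrow> norm (h \<xi>) = norm \<xi> powr - s * norm (g \<xi>)"
    and g2: "(\<integral>\<^sup>+\<xi>. ennreal ((norm (g \<xi>))\<^sup>2) \<partial>lborel) = 0"
  shows "max_wave h = (\<lambda>x. 0)"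
proof
  fix x
  have "AE \<xi> in lborel. ennreal ((norm (g \<xi>))\<^sup>2) = 0" using g2 by (subst (asm) nn_integral_0_iff_AE) auto
  then have "AE \<xi> in lborel. ennreal (norm (h \<xi>)) = 0"
    using AE_lborel_singleton[of 0]
  proof eventually_elim
    case (elim \<xi>) then show ?case by (simp add: hg ennreal_eq_0_iff)
  qed
  then have "(\<integral>\<^sup>+\<xi>. ennreal (norm (h \<xi>)) \<partial>lborel) = 0" by (subst nn_integral_0_iff_AE) auto
  then have "ennreal (norm (wave_int h t x)) = 0" for t using norm_wave_int_le[of h t x] by simp
  then show "max_wave h x = 0" unfolding max_wave_def by simp
qed

text \<open>The factor 2^(2d/q) comes from pairing the level \<open>a (N + 1)\<close> with the
  measure bound at index \<open>N\<close>.\<close>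

definition lorentz_const :: "nat \<Rightarrow> real \<Rightarrow> real \<Rightarrow> real \<Rightarrow> real" where
  "lorentz_const d q s \<epsilon> = (4 * ball_const d (2 * s + 2 * \<epsilon>) * 2 powr (2 * d / q) * level_const d s \<epsilon> powr (2 / q)) * overlap_const \<epsilon>"

lemmas wave_levels_cart = wave_levels[where 'a="real^'d", unfolded DIM_cart DIM_real mult_1_right]

text \<open>For heights between \<open>a N\<close> and \<open>a (N + 1)\<close> the distribution
  function is at most K 2^(-d N), so their contribution is at most the square of
  \<open>a (N + 1)\<close> times (K 2^(-d N))^(2/q). Because d - 2 s = 2d/q the powers of 2 cancel
  and a multiple of the band energy at N + 1 is left, whose sum is controlled by the total
  energy.\<close>

lemma Lorentz_max_wave_le:
  fixes h g :: "real^'d::finite \<Rightarrow> complex" and s \<epsilon> q n2 :: real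
  assumes d: "CARD('d) \<ge> 2" and h: "integrable lborel h" and g[measurable]: "g \<in> borel_measurable borel"
    and hg: "\<And>\<xi>. \<xi> \<noteq> 0 \<Longrightarrow> norm (h \<xi>) = norm \<xi> powr - s * norm (g \<xi>)"
    and \<epsilon>: "0 < \<epsilon>" "0 \<le> s" "2 * s + 2 * \<epsilon> < real CARD('d)" "2 * s - 2 * \<epsilon> > 2 * real CARD('d) / (real CARD('d) + 1)"
    and q: "q > 0" "real CARD('d) - 2 * s = 2 * real CARD('d) / q"
    and g2: "(\<integral>\<^sup>+\<xi>. ennreal ((norm (g \<xi>))\<^sup>2) \<partial>lborel) = ennreal n2" "n2 \<ge> 0"
  shows "Lorentz_norm q 2 (max_wave h) \<le> ennreal (sqrt (q * lorentz_const CARD('d) q s \<epsilon>) * sqrt n2)"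
proof (cases "n2 = 0")
  \<comment> \<open>Without energy there are no positive levels, so this case is separated; the wave
    itself vanishes.\<close>
  case True
  have [measurable]: "h \<in> borel_measurable borel" using h by (auto dest: borel_measurable_integrable)
  have "max_wave h = (\<lambda>x. 0)" using g2 True by (intro max_wave_eq_0[OF _ g hg]) auto
  then show ?thesis by (simp add: Lorentz_norm_def)
next
  case False
  let ?d = "real CARD('d)" and ?F = "max_wave h"
  define K where "K = level_const CARD('d) s \<epsilon>"
  define \<kappa> where "\<kappa> = 4 * ball_const CARD('d) (2 * s + 2 * \<epsilon>)"
  have n2: "n2 > 0" using False g2(2) by simp
  have K0: "K \<ge> 0" by (simp add: K_def level_const_def)
  have \<kappa>0: "\<kappa> \<ge> 0" using ball_const_pos[OF \<epsilon>(3)] by (simp add: \<kappa>_def)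
  obtain a e :: "int \<Rightarrow> real" and \<mu> :: real where a: "\<mu> > 1" "\<And>N. a N > 0" "\<And>N. \<mu> * a N \<le> a (N + 1)"
    and lev: "\<And>N. emeasure lborel {x. ennreal (a N) < ?F x} \<le> ennreal (level_const CARD('d) s \<epsilon> * 2 powr (- (?d * real_of_int N)))"
    and e: "\<And>N. band_energy \<epsilon> g (2 powr real_of_int N) = ennreal (e N)" "\<And>N. 0 \<le> e N" "\<And>N. e N \<le> n2"
    and a2: "\<And>N. (a N)\<^sup>2 = 4 * ball_const CARD('d) (2 * s + 2 * \<epsilon>) * 2 powr (real_of_int N * (?d - 2 * s)) * e N"
    by (rule wave_levels_cart[OF d h g hg \<epsilon> g2(1) n2]) (simp, rule that, assumption+)
  note lev = lev[folded K_def] and a2 = a2[folded \<kappa>_def]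
  define P where "P N = (K * 2 powr (- (?d * real_of_int N))) powr (2 / q)" for N
  have Pn: "P N \<ge> 0" for N by (simp add: P_def)
  have [measurable]: "?F \<in> borel_measurable borel" by (rule max_wave_measurable[OF h])
  define C0 where "C0 = \<kappa> * 2 powr (2 * ?d / q) * K powr (2 / q)"
  have C0: "C0 \<ge> 0" using \<kappa>0 by (simp add: C0_def)
  have ov: "overlap_const \<epsilon> \<ge> 0" by (rule overlap_const_nonneg[OF \<epsilon>(1)])
  have "(\<integral>\<^sup>+y. ennreal (y powr (2 - 1)) * ennreal_powr (emeasure lborel {x. ennreal y < ?F x}) (2 / q) * indicator {0<..} y \<partial>lborel)
     \<le> (\<integral>\<^sup>+y. (\<integral>\<^sup>+N. ennreal (a (N + 1) * P N) * indicator {a N..<a (N + 1)} y \<partial>count_space UNIV) \<partial>lborel)"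
  proof (rule nn_integral_mono)
    fix y :: real
    show "ennreal (y powr (2 - 1)) * ennreal_powr (emeasure lborel {x. ennreal y < ?F x}) (2 / q) * indicator {0<..} y \<le>
      (\<integral>\<^sup>+N. ennreal (a (N + 1) * P N) * indicator {a N..<a (N + 1)} y \<partial>count_space UNIV)"
    proof (cases "y > 0")
      case True
      obtain N where N: "a N \<le> y" "y < a (N + 1)" by (rule geometric_bracket[of \<mu> a y, OF a True])
      have "emeasure lborel {x. ennreal y < ?F x} \<le> emeasure lborel {x. ennreal (a N) < ?F x}"
        using N by (intro emeasure_mono) (auto intro: le_less_trans[OF ennreal_leI])
      also have "\<dots> \<le> ennreal (K * 2 powr (- (?d * real_of_int N)))" by (rule lev)
      finally have "ennreal_powr (emeasure lborel {x. ennreal y < ?F x}) (2 / q) \<le> ennreal_powr (ennreal (K * 2 powr (- (?d * real_of_int N)))) (2 / q)"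
        using q by (intro ennreal_powr_mono) auto
      also have "\<dots> = ennreal (P N)" using K0 by (simp add: P_def)
      finally have "ennreal (y powr (2 - 1)) * ennreal_powr (emeasure lborel {x. ennreal y < ?F x}) (2 / q) \<le> ennreal (a (N + 1)) * ennreal (P N)"
        using N True by (intro mult_mono ennreal_leI) auto
      also have "\<dots> = ennreal (a (N + 1) * P N)" using a(2)[of "N + 1"] by (simp add: ennreal_mult Pn less_imp_le)
      also have "\<dots> = ennreal (a (N + 1) * P N) * indicator {a N..<a (N + 1)} y" using N by simp
      also have "\<dots> \<le> (\<integral>\<^sup>+N. ennreal (a (N + 1) * P N) * indicator {a N..<a (N + 1)} y \<partial>count_space UNIV)"
        by (rule nn_integral_ge_point) simp
      finally show ?thesis using True by simp
    qed simp
  qed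
  also have "\<dots> = (\<integral>\<^sup>+N. (\<integral>\<^sup>+y. ennreal (a (N + 1) * P N) * indicator {a N..<a (N + 1)} y \<partial>lborel) \<partial>count_space UNIV)"
    by (rule nn_integral_count_space_nn_integral) auto
  also have "\<dots> \<le> (\<integral>\<^sup>+N. ennreal C0 * band_energy \<epsilon> g (2 powr real_of_int (N + 1)) \<partial>count_space UNIV)"
  proof (rule nn_integral_mono)
    fix N :: int
    have le: "a N \<le> a (N + 1)" 
    proof -
      have "1 * a N \<le> \<mu> * a N" using a(1) a(2)[of N] by (intro mult_right_mono) auto
      then show ?thesis using a(3)[of N] by linarith
    qed
    have "(\<integral>\<^sup>+y. ennreal (a (N + 1) * P N) * indicator {a N..<a (N + 1)} y \<partial>lborel) = ennreal (a (N + 1) * P N) * ennreal (a (N + 1) - a N)"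
      using le by (simp add: nn_integral_cmult)
    \<comment> \<open>The length of the interval is bounded by its right end, which produces the
      square of the level.\<close>
    also have "\<dots> \<le> ennreal (a (N + 1) * P N) * ennreal (a (N + 1))"
      using a(2)[of N] by (intro mult_left_mono ennreal_leI) auto
    also have "\<dots> = ennreal ((a (N + 1))\<^sup>2 * P N)"
      using a(2)[of "N + 1"] Pn[of N] by (simp add: power2_eq_square mult_ac less_imp_le flip: ennreal_mult)
    also have "(a (N + 1))\<^sup>2 * P N = C0 * e (N + 1)"
    proof -
      have "P N = K powr (2 / q) * 2 powr (- (2 * ?d / q * real_of_int N))"
        using K0 unfolding P_def by (subst powr_mult) (auto simp: powr_powr mult_ac)
      moreover have "2 powr (real_of_int (N + 1) * (?d - 2 * s)) * 2 powr (- (2 * ?d / q * real_of_int N)) = 2 powr (2 * ?d / q)"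
        unfolding q(2) powr_add[symmetric] by (rule arg_cong[where f="(powr) 2"]) (simp add: algebra_simps add_divide_distrib)
      ultimately show ?thesis unfolding a2 C0_def by (simp add: algebra_simps)
    qed
    also have "ennreal (C0 * e (N + 1)) = ennreal C0 * band_energy \<epsilon> g (2 powr real_of_int (N + 1))"
      unfolding e(1) using C0 e(2) by (simp add: ennreal_mult)
    finally show "(\<integral>\<^sup>+y. ennreal (a (N + 1) * P N) * indicator {a N..<a (N + 1)} y \<partial>lborel) \<le> ennreal C0 * band_energy \<epsilon> g (2 powr real_of_int (N + 1))" .
  qed
  also have "\<dots> = ennreal C0 * (\<integral>\<^sup>+N. band_energy \<epsilon> g (2 powr real_of_int (N + 1)) \<partial>count_space UNIV)"
    by (rule nn_integral_cmult) simp
  also have "\<dots> \<le> ennreal C0 * (ennreal (overlap_const \<epsilon>) * ennreal n2)"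
    unfolding g2(1)[symmetric] by (intro mult_left_mono sum_band_energy_le \<epsilon> g) simp
  also have "\<dots> = ennreal (C0 * overlap_const \<epsilon> * n2)" using C0 ov g2(2) by (simp add: ennreal_mult mult.assoc)
  finally have "ennreal q * (\<integral>\<^sup>+y. ennreal (y powr (2 - 1)) * ennreal_powr (emeasure lborel {x. ennreal y < ?F x}) (2 / q) * indicator {0<..} y \<partial>lborel) \<le> ennreal q * ennreal (C0 * overlap_const \<epsilon> * n2)"
    by (intro mult_left_mono) auto
  also have "\<dots> = ennreal (q * lorentz_const CARD('d) q s \<epsilon> * n2)"
    using q C0 ov g2(2) by (simp add: lorentz_const_def C0_def \<kappa>_def K_def mult.assoc flip: ennreal_mult)
  finally have "Lorentz_norm q 2 ?F \<le> ennreal_powr (ennreal (q * lorentz_const CARD('d) q s \<epsilon> * n2)) (1 / 2)"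
    unfolding Lorentz_norm_def by (intro ennreal_powr_mono) auto
  also have "\<dots> = ennreal (sqrt (q * lorentz_const CARD('d) q s \<epsilon>) * sqrt n2)"
  proof -
    have "q * lorentz_const CARD('d) q s \<epsilon> * n2 \<ge> 0"
      using q C0 ov g2(2) by (simp add: lorentz_const_def C0_def \<kappa>_def K_def)
    then show ?thesis by (simp add: powr_half_sqrt real_sqrt_mult)
  qed
  finally show ?thesis .
qed

text \<open>The factor 2^(2d) comes from the shift by two between the level that bounds the function
  and the level set on which it is used.\<close>

definition lebesgue_const :: "nat \<Rightarrow> real \<Rightarrow> real \<Rightarrow> real \<Rightarrow> real" where
  "lebesgue_const d q s \<epsilon> = ((4 * ball_const d (2 * s + 2 * \<epsilon>)) powr (q / 2) * 2 powr (2 * d) * level_const d s \<epsilon>) * overlap_const \<epsilon>"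

text \<open>A point is charged to the level set one step below its bracket, of measure at most K
  2^(-d N), with the value \<open>a (N + 2)\<close>. This leaves e^(q/2); since q >= 2 and e is at
  most the total energy, the sum over N is controlled by the sum of the energies themselves, as in
  the inclusion of l^2 in l^q.\<close>

lemma Lp_max_wave_le:
  fixes h g :: "real^'d::finite \<Rightarrow> complex" and s \<epsilon> q n2 :: real
  assumes d: "CARD('d) \<ge> 2" and h: "integrable lborel h" and g[measurable]: "g \<in> borel_measurable borel"
    and hg: "\<And>\<xi>. \<xi> \<noteq> 0 \<Longrightarrow> norm (h \<xi>) = norm \<xi> powr - s * norm (g \<xi>)"
    and \<epsilon>: "0 < \<epsilon>" "0 \<le> s" "2 * s + 2 * \<epsilon> < real CARD('d)" "2 * s - 2 * \<epsilon> > 2 * real CARD('d) / (real CARD('d) + 1)"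
    and q: "q \<ge> 2" "real CARD('d) - 2 * s = 2 * real CARD('d) / q"
    and g2: "(\<integral>\<^sup>+\<xi>. ennreal ((norm (g \<xi>))\<^sup>2) \<partial>lborel) = ennreal n2" "n2 \<ge> 0"
  shows "Lp_norm q (max_wave h) \<le> ennreal (lebesgue_const CARD('d) q s \<epsilon> powr (1 / q) * sqrt n2)"
proof (cases "n2 = 0")
  case True
  have [measurable]: "h \<in> borel_measurable borel" using h by (auto dest: borel_measurable_integrable)
  have "max_wave h = (\<lambda>x. 0)" using g2 True by (intro max_wave_eq_0[OF _ g hg]) auto
  then show ?thesis by (simp add: Lp_norm_def)
next
  case False
  let ?d = "real CARD('d)" and ?F = "max_wave h"
  define K where "K = level_const CARD('d) s \<epsilon>"
  define \<kappa> where "\<kappa> = 4 * ball_const CARD('d) (2 * s + 2 * \<epsilon>)"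
  have n2: "n2 > 0" using False g2(2) by simp
  have K0: "K \<ge> 0" by (simp add: K_def level_const_def)
  have \<kappa>0: "\<kappa> \<ge> 0" using ball_const_pos[OF \<epsilon>(3)] by (simp add: \<kappa>_def)
  obtain a e :: "int \<Rightarrow> real" and \<mu> :: real where a: "\<mu> > 1" "\<And>N. a N > 0" "\<And>N. \<mu> * a N \<le> a (N + 1)"
    and lev: "\<And>N. emeasure lborel {x. ennreal (a N) < ?F x} \<le> ennreal (level_const CARD('d) s \<epsilon> * 2 powr (- (?d * real_of_int N)))"
    and e: "\<And>N. band_energy \<epsilon> g (2 powr real_of_int N) = ennreal (e N)" "\<And>N. 0 \<le> e N" "\<And>N. e N \<le> n2"
    and a2: "\<And>N. (a N)\<^sup>2 = 4 * ball_const CARD('d) (2 * s + 2 * \<epsilon>) * 2 powr (real_of_int N * (?d - 2 * s)) * e N"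
    by (rule wave_levels_cart[OF d h g hg \<epsilon> g2(1) n2]) (simp, rule that, assumption+)
  note lev = lev[folded K_def] and a2 = a2[folded \<kappa>_def]
  have [measurable]: "?F \<in> borel_measurable borel" by (rule max_wave_measurable[OF h])
  define C0 where "C0 = \<kappa> powr (q / 2) * 2 powr (2 * ?d) * K"
  have C0: "C0 \<ge> 0" using K0 by (simp add: C0_def)
  have ov: "overlap_const \<epsilon> \<ge> 0" by (rule overlap_const_nonneg[OF \<epsilon>(1)])
  have inc: "a N < a (N + 1)" for N
  proof -
    have "1 * a N < \<mu> * a N" using a(1) a(2)[of N] by (intro mult_strict_right_mono)
    then show ?thesis using a(3)[of N] by linarith
  qed
  have "(\<integral>\<^sup>+x. ennreal_powr (?F x) q \<partial>lborel) \<le>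
    (\<integral>\<^sup>+x. (\<integral>\<^sup>+N. ennreal (a (N + 2) powr q) * indicator {x. ennreal (a N) < ?F x} x \<partial>count_space UNIV) \<partial>lborel)"
  proof (rule nn_integral_mono)
    fix x :: "real^'d"
    obtain y where y: "?F x = ennreal y" "y \<ge> 0" using max_wave_finite[OF h, of x] by (cases "?F x") auto
    show "ennreal_powr (?F x) q \<le> (\<integral>\<^sup>+N. ennreal (a (N + 2) powr q) * indicator {x. ennreal (a N) < ?F x} x \<partial>count_space UNIV)"
    proof (cases "y > 0")
      case True
      obtain M where M: "a M \<le> y" "y < a (M + 1)" by (rule geometric_bracket[of \<mu> a y, OF a True])
      \<comment> \<open>The bracket gives only \<open>a M \<le> y\<close>, whereas the level sets
        are strict; going down one index restores strictness and causes the shift by two.\<close>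
      define N where "N = M - 1"
      have N: "a N < y" "y < a (N + 2)" using M inc[of N] by (simp_all add: N_def algebra_simps)
      have "ennreal_powr (?F x) q \<le> ennreal (a (N + 2) powr q)"
        using y N q by (simp add: powr_mono2 ennreal_leI)
      also have "\<dots> = ennreal (a (N + 2) powr q) * indicator {x. ennreal (a N) < ?F x} x"
        using y N a(2)[of N] by (simp add: ennreal_less_iff less_imp_le)
      also have "\<dots> \<le> (\<integral>\<^sup>+N. ennreal (a (N + 2) powr q) * indicator {x. ennreal (a N) < ?F x} x \<partial>count_space UNIV)"
        by (rule nn_integral_ge_point) simp
      finally show ?thesis .
    qed (use y in simp)
  qed
  also have "\<dots> = (\<integral>\<^sup>+N. (\<integral>\<^sup>+x. ennreal (a (N + 2) powr q) * indicator {x. ennreal (a N) < ?F x} x \<partial>lborel) \<partial>count_space UNIV)"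
    by (rule nn_integral_count_space_nn_integral) auto
  also have "\<dots> \<le> (\<integral>\<^sup>+N. ennreal (C0 * n2 powr (q / 2 - 1)) * band_energy \<epsilon> g (2 powr real_of_int (N + 2)) \<partial>count_space UNIV)"
  proof (rule nn_integral_mono)
    fix N :: int
    have "(\<integral>\<^sup>+x. ennreal (a (N + 2) powr q) * indicator {x. ennreal (a N) < ?F x} x \<partial>lborel) = ennreal (a (N + 2) powr q) * emeasure lborel {x. ennreal (a N) < ?F x}"
      by (rule nn_integral_cmult_indicator) measurable
    also have "\<dots> \<le> ennreal (a (N + 2) powr q) * ennreal (K * 2 powr (- (?d * real_of_int N)))"
      by (intro mult_left_mono lev) simp
    also have "\<dots> = ennreal (a (N + 2) powr q * (K * 2 powr (- (?d * real_of_int N))))"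
      using K0 by (simp add: ennreal_mult)
    also have "\<dots> \<le> ennreal (C0 * n2 powr (q / 2 - 1) * e (N + 2))"
    proof (rule ennreal_leI)
      have "a (N + 2) powr q = ((a (N + 2)) powr 2) powr (q / 2)" by (simp only: powr_powr) simp
      also have "(a (N + 2)) powr 2 = (a (N + 2))\<^sup>2" using a(2)[of "N + 2"] by simp
      also have "((a (N + 2))\<^sup>2) powr (q / 2) = \<kappa> powr (q / 2) * 2 powr (real_of_int (N + 2) * (?d - 2 * s) * (q / 2)) * e (N + 2) powr (q / 2)"
        unfolding a2 using \<kappa>0 e(2) by (simp add: powr_mult powr_powr)
      also have "real_of_int (N + 2) * (?d - 2 * s) * (q / 2) = ?d * real_of_int (N + 2)"
        unfolding q(2) using q(1) by simp
      finally have 1: "a (N + 2) powr q = \<kappa> powr (q / 2) * 2 powr (?d * real_of_int (N + 2)) * e (N + 2) powr (q / 2)" .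
      have 2: "2 powr (?d * real_of_int (N + 2)) * 2 powr (- (?d * real_of_int N)) = 2 powr (2 * ?d)"
        unfolding powr_add[symmetric] by (rule arg_cong[where f="(powr) 2"]) (simp add: algebra_simps)
      have "a (N + 2) powr q * (K * 2 powr (- (?d * real_of_int N))) = \<kappa> powr (q / 2) * (2 powr (?d * real_of_int (N + 2)) * 2 powr (- (?d * real_of_int N))) * K * e (N + 2) powr (q / 2)"
        unfolding 1 by (simp only: mult_ac)
      also have "\<dots> = C0 * e (N + 2) powr (q / 2)" unfolding 2 C0_def ..
      \<comment> \<open>One power of e is kept for the summation, and the remaining power q/2 - 1 >=
        0 is bounded by that of the total energy.\<close>
      also have "e (N + 2) powr (q / 2) \<le> n2 powr (q / 2 - 1) * e (N + 2)"
      proof (cases "e (N + 2) = 0")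
        case False
        then have ep: "e (N + 2) > 0" using e(2)[of "N + 2"] by simp
        have "e (N + 2) powr (q / 2) = e (N + 2) powr (q / 2 - 1) * e (N + 2)" using ep by (simp add: powr_diff)
        also have "\<dots> \<le> n2 powr (q / 2 - 1) * e (N + 2)"
          using ep q e(3) by (intro mult_right_mono powr_mono2) auto
        finally show ?thesis .
      qed simp
      finally show "a (N + 2) powr q * (K * 2 powr (- (?d * real_of_int N))) \<le> C0 * n2 powr (q / 2 - 1) * e (N + 2)"
        using C0 by (simp add: mult.assoc mult_left_mono)
    qed
    also have "ennreal (C0 * n2 powr (q / 2 - 1) * e (N + 2)) = ennreal (C0 * n2 powr (q / 2 - 1)) * band_energy \<epsilon> g (2 powr real_of_int (N + 2))"
      unfolding e(1) using C0 e(2) by (intro ennreal_mult) auto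
    finally show "(\<integral>\<^sup>+x. ennreal (a (N + 2) powr q) * indicator {x. ennreal (a N) < ?F x} x \<partial>lborel) \<le> ennreal (C0 * n2 powr (q / 2 - 1)) * band_energy \<epsilon> g (2 powr real_of_int (N + 2))" .
  qed
  also have "\<dots> = ennreal (C0 * n2 powr (q / 2 - 1)) * (\<integral>\<^sup>+N. band_energy \<epsilon> g (2 powr real_of_int (N + 2)) \<partial>count_space UNIV)"
    by (rule nn_integral_cmult) simp
  also have "\<dots> \<le> ennreal (C0 * n2 powr (q / 2 - 1)) * (ennreal (overlap_const \<epsilon>) * ennreal n2)"
    unfolding g2(1)[symmetric] by (intro mult_left_mono sum_band_energy_le \<epsilon> g) simp
  also have "\<dots> = ennreal (C0 * n2 powr (q / 2 - 1) * (overlap_const \<epsilon> * n2))"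
    using C0 ov g2(2) by (simp add: ennreal_mult)
  also have "C0 * n2 powr (q / 2 - 1) * (overlap_const \<epsilon> * n2) = lebesgue_const CARD('d) q s \<epsilon> * n2 powr (q / 2)"
    using n2 by (simp add: lebesgue_const_def C0_def \<kappa>_def K_def powr_diff)
  finally have "Lp_norm q ?F \<le> ennreal_powr (ennreal (lebesgue_const CARD('d) q s \<epsilon> * n2 powr (q / 2))) (1 / q)"
    unfolding Lp_norm_def using q by (intro ennreal_powr_mono) auto
  also have "\<dots> = ennreal (lebesgue_const CARD('d) q s \<epsilon> powr (1 / q) * sqrt n2)"
  proof -
    have l0: "lebesgue_const CARD('d) q s \<epsilon> \<ge> 0" using C0 ov by (simp add: lebesgue_const_def C0_def \<kappa>_def K_def)
    have "(n2 powr (q / 2)) powr (1 / q) = sqrt n2" using q n2 by (simp add: powr_powr powr_half_sqrt)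
    then show ?thesis using l0 n2 by (simp add: powr_mult)
  qed
  finally show ?thesis .
qed

section \<open>Fourier transform of Schwartz functions\<close>

lemma power_one_plus_sq_le:
  fixes r :: real assumes "r \<ge> 0" shows "(1 + r\<^sup>2) ^ n \<le> 2 ^ n * (1 + r ^ (2 * n))"
proof (cases "r \<le> 1")
  case True
  then have "1 + r\<^sup>2 \<le> 2" using assms by (simp add: power_le_one)
  then have "(1 + r\<^sup>2) ^ n \<le> 2 ^ n" by (intro power_mono) auto
  also have "\<dots> \<le> 2 ^ n * (1 + r ^ (2 * n))" using assms by simp
  finally show ?thesis .
next
  case False
  then have "1 + r\<^sup>2 \<le> 2 * r\<^sup>2" by simp
  then have "(1 + r\<^sup>2) ^ n \<le> (2 * r\<^sup>2) ^ n" by (intro power_mono) auto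
  also have "\<dots> = 2 ^ n * r ^ (2 * n)" by (simp add: power_mult_distrib power_mult)
  also have "\<dots> \<le> 2 ^ n * (1 + r ^ (2 * n))" by simp
  finally show ?thesis .
qed

text \<open>The square of the usual Japanese bracket; its n-th power stands for growth of order 2
  n.\<close>

definition bracket :: "'a::euclidean_space \<Rightarrow> real" where
  "bracket x = 1 + (norm x)\<^sup>2"

lemma bracket_ge_1: "bracket x \<ge> 1" by (simp add: bracket_def)

lemma bracket_pos: "bracket x > 0" using bracket_ge_1[of x] by linarith

lemma bracket_measurable [measurable]: "bracket \<in> borel_measurable borel"
  unfolding bracket_def[abs_def] by measurable

text \<open>The power d of 1 + |x|^2 dominates the product of the coordinate factors 1 + (x
  \<bullet> b)^2, and the inverse of each of these is integrable on the line.\<close>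

lemma integrable_bracket: "integrable lborel (\<lambda>x::'a::euclidean_space. inverse (bracket x ^ DIM('a)))"
proof -
  have "integrable lborel (\<lambda>t::real. inverse (1 + t\<^sup>2))"
    using integrable_inverse_1_plus_square by (simp add: set_integrable_def einterval_def)
  then have "integrable lborel (\<lambda>x::'a. \<Prod>b\<in>Basis. inverse (1 + (x \<bullet> b)\<^sup>2))"
    by (intro integrable_lborel_prod)
  then show ?thesis
  proof (rule Bochner_Integration.integrable_bound)
    show "AE x::'a in lborel. norm (inverse (bracket x ^ DIM('a))) \<le> norm (\<Prod>b\<in>Basis. inverse (1 + (x \<bullet> b)\<^sup>2))"
    proof (rule AE_I2)
      fix x :: 'a
      have "(\<Prod>b\<in>Basis. 1 + (x \<bullet> b)\<^sup>2) \<le> (\<Prod>b\<in>(Basis::'a set). bracket x)"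
      proof (rule prod_mono)
        fix b :: 'a assume b: "b \<in> Basis"
        have "(x \<bullet> b)\<^sup>2 \<le> (norm x)\<^sup>2" using Basis_le_norm[OF b, of x] by (simp add: abs_le_square_iff[symmetric])
        then show "0 \<le> 1 + (x \<bullet> b)\<^sup>2 \<and> 1 + (x \<bullet> b)\<^sup>2 \<le> bracket x" by (simp add: bracket_def)
      qed
      moreover have "(\<Prod>b\<in>(Basis::'a set). 1 + (x \<bullet> b)\<^sup>2) > 0" by (intro prod_pos) (auto intro: add_pos_nonneg)
      ultimately have "inverse (bracket x ^ DIM('a)) \<le> inverse (\<Prod>b\<in>Basis. 1 + (x \<bullet> b)\<^sup>2)"
        by (intro le_imp_inverse_le) auto
      then show "norm (inverse (bracket x ^ DIM('a))) \<le> norm (\<Prod>b\<in>Basis. inverse (1 + (x \<bullet> b)\<^sup>2))"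
        using bracket_pos[of x] by (simp add: prod_inversef[symmetric] comp_def abs_prod prod_nonneg)
    qed
  qed measurable
qed

lemma integrable_by_bracket:
  fixes f :: "'a::euclidean_space \<Rightarrow> complex"
  assumes [measurable]: "f \<in> borel_measurable borel" and C: "\<And>x. norm (f x) * bracket x ^ DIM('a) \<le> C"
  shows "integrable lborel f"
proof (rule Bochner_Integration.integrable_bound[OF integrable_mult_right[OF integrable_bracket, of C]])
  show "AE x in lborel. norm (f x) \<le> norm (C * inverse (bracket x ^ DIM('a)))"
  proof (rule AE_I2)
    fix x :: 'a
    have "norm (f x) \<le> C * inverse (bracket x ^ DIM('a))" using C[of x] bracket_pos[of x] by (simp add: field_simps)
    then show "norm (f x) \<le> norm (C * inverse (bracket x ^ DIM('a)))" by simp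
  qed
qed simp

lemma schwartz_differentiable: "schwartz f \<Longrightarrow> f differentiable (at x)"
  unfolding schwartz_def by (metis partial_derivs.simps(1))

lemma schwartz_continuous: "schwartz f \<Longrightarrow> continuous_on UNIV f"
  by (meson schwartz_differentiable differentiable_imp_continuous_within continuous_at_imp_continuous_on)

lemma schwartz_measurable: "schwartz f \<Longrightarrow> f \<in> borel_measurable borel"
  by (intro borel_measurable_continuous_onI schwartz_continuous)

lemma partial_derivs_append: "partial_derivs js (partial_derivs ks f) = partial_derivs (js @ ks) f"
  by (induction js) auto

lemma schwartz_partial_derivs: "schwartz f \<Longrightarrow> schwartz (partial_derivs ks f)"
  unfolding schwartz_def partial_derivs_append by blast

lemma schwartz_partial_deriv: "schwartz f \<Longrightarrow> schwartz (partial_deriv j f)"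
  using schwartz_partial_derivs[of f "[j]"] by simp

lemma schwartz_decay:
  fixes f :: "real^'d::finite \<Rightarrow> complex"
  assumes "schwartz f" obtains C where "\<And>x. norm (f x) * bracket x ^ n \<le> C" "C \<ge> 0"
proof -
  have b: "bounded (range (\<lambda>x. norm x ^ k *\<^sub>R f x))" for k
    using assms unfolding schwartz_def by (metis partial_derivs.simps(1))
  obtain B0 where B0: "\<And>x. norm (norm x ^ 0 *\<^sub>R f x) \<le> B0" using b[of 0] unfolding bounded_iff by blast
  obtain B1 where B1: "\<And>x. norm (norm x ^ (2 * n) *\<^sub>R f x) \<le> B1" using b[of "2 * n"] unfolding bounded_iff by blast
  have *: "norm (f x) * bracket x ^ n \<le> 2 ^ n * (B0 + B1)" for x
  proof -
    have "norm (f x) * bracket x ^ n \<le> norm (f x) * (2 ^ n * (1 + norm x ^ (2 * n)))"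
      unfolding bracket_def by (intro mult_left_mono power_one_plus_sq_le) auto
    also have "\<dots> = 2 ^ n * (norm (norm x ^ 0 *\<^sub>R f x) + norm (norm x ^ (2 * n) *\<^sub>R f x))"
      by (simp add: algebra_simps)
    also have "\<dots> \<le> 2 ^ n * (B0 + B1)" by (intro mult_left_mono add_mono B0 B1) auto
    finally show ?thesis .
  qed
  show ?thesis
  proof (rule that[OF *])
    have "0 \<le> norm (f 0) * bracket (0::real^'d) ^ n" by (simp add: bracket_def)
    then show "0 \<le> 2 ^ n * (B0 + B1)" using *[of 0] by linarith
  qed
qed

lemma schwartz_integrable:
  fixes f :: "real^'d::finite \<Rightarrow> complex"
  assumes f: "schwartz f" shows "integrable lborel f"
proof -
  obtain C where "\<And>x. norm (f x) * bracket x ^ DIM(real^'d) \<le> C"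
    using schwartz_decay[OF f] by blast
  then show ?thesis by (rule integrable_by_bracket[OF schwartz_measurable[OF f]])
qed

lemma fourier_eq_ft: "fourier f \<xi> = ft f (- \<xi>)"
  by (simp add: fourier_def ft_def cis_conv_exp)

lemma has_vector_derivative_line:
  fixes f :: "real^'d::finite \<Rightarrow> complex"
  assumes "f differentiable (at (x + t *\<^sub>R axis j 1))"
  shows "((\<lambda>t. f (x + t *\<^sub>R axis j 1)) has_vector_derivative partial_deriv j f (x + t *\<^sub>R axis j 1)) (at t)"
proof -
  let ?y = "x + t *\<^sub>R axis j 1"
  have D: "(f has_derivative frechet_derivative f (at ?y)) (at ?y)"
    using assms frechet_derivative_works by blast
  have l: "((\<lambda>t. x + t *\<^sub>R axis j 1) has_derivative (\<lambda>s. s *\<^sub>R axis j (1::real))) (at t)"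
    by (auto intro!: derivative_eq_intros)
  have "((\<lambda>t. f (x + t *\<^sub>R axis j 1)) has_derivative (\<lambda>s. frechet_derivative f (at ?y) (s *\<^sub>R axis j 1))) (at t)"
    using has_derivative_compose[OF l D] .
  moreover have "frechet_derivative f (at ?y) (s *\<^sub>R axis j 1) = s *\<^sub>R partial_deriv j f ?y" for s
    using linear_scale[OF has_derivative_linear[OF D]] by (simp add: partial_deriv_def)
  ultimately show ?thesis by (simp add: has_vector_derivative_def)
qed

lemma has_vector_derivative_quotient:
  assumes "(F has_vector_derivative v) (at 0)"
  shows "((\<lambda>t. (F t - F 0) /\<^sub>R t) \<longlongrightarrow> v) (at 0)"
proof -
  have "((\<lambda>h. norm (F (0 + h) - F 0 - h *\<^sub>R v) / norm h) \<longlongrightarrow> 0) (at 0)"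
    using assms unfolding has_vector_derivative_def has_derivative_at by blast
  moreover have "\<forall>\<^sub>F h in at 0. norm (F (0 + h) - F 0 - h *\<^sub>R v) / norm h = norm ((F h - F 0) /\<^sub>R h - v)"
  proof (rule eventually_at_ball'[THEN eventually_mono, of 1])
    fix h :: real assume "h \<in> ball 0 1 \<and> h \<noteq> 0 \<and> h \<in> UNIV"
    then have h: "h \<noteq> 0" by simp
    then have "(F h - F 0) /\<^sub>R h - v = (F (0 + h) - F 0 - h *\<^sub>R v) /\<^sub>R h"
      by (simp add: scaleR_right_diff_distrib)
    then show "norm (F (0 + h) - F 0 - h *\<^sub>R v) / norm h = norm ((F h - F 0) /\<^sub>R h - v)"
      by (simp add: divide_inverse mult.commute)
  qed simp
  ultimately have "((\<lambda>h. norm ((F h - F 0) /\<^sub>R h - v)) \<longlongrightarrow> 0) (at 0)"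
    by (rule Lim_transform_eventually)
  then show ?thesis by (rule LIM_zero_cancel[OF tendsto_norm_zero_cancel])
qed

text \<open>Weights at points at distance at most 1 are comparable, so the decay of a derivative
  along a short segment can be stated at its starting point.\<close>

lemma bracket_shift:
  assumes "norm (y - x) \<le> 1" shows "bracket x \<le> 3 * bracket y"
proof -
  have "norm x \<le> norm y + 1" using norm_triangle_ineq4[of y "y - x"] assms by simp
  then have "(norm x)\<^sup>2 \<le> (norm y + 1)\<^sup>2" by (intro power_mono) auto
  also have "\<dots> \<le> 2 * (norm y)\<^sup>2 + 2" using sum_squares_bound[of "norm y" 1] by (simp add: power2_sum)
  also have "\<dots> \<le> 3 * (norm y)\<^sup>2 + 2" by simp
  finally show ?thesis by (simp add: bracket_def)
qed

text \<open>Mean value inequality along the segment, combined with the decay of the partial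
  derivative. The bound is uniform in h, so it dominates all difference quotients at once.\<close>

lemma difference_quotient_bound:
  fixes f :: "real^'d::finite \<Rightarrow> complex"
  assumes f: "schwartz f"
  obtains C where "\<And>x h. 0 < h \<Longrightarrow> h \<le> 1 \<Longrightarrow> norm ((f (x + h *\<^sub>R axis j 1) - f x) /\<^sub>R h) \<le> C * inverse (bracket x ^ CARD('d))"
proof -
  obtain B where B: "\<And>x. norm (partial_deriv j f x) * bracket x ^ CARD('d) \<le> B" "B \<ge> 0"
    using schwartz_decay[OF schwartz_partial_deriv[OF f, of j], of "CARD('d)"] by blast
  have "norm ((f (x + h *\<^sub>R axis j 1) - f x) /\<^sub>R h) \<le> (B * 3 ^ CARD('d)) * inverse (bracket x ^ CARD('d))"
    if h: "0 < h" "h \<le> 1" for x h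
  proof -
    define K where "K = (B * 3 ^ CARD('d)) * inverse (bracket x ^ CARD('d))"
    have le: "norm (partial_deriv j f (x + t *\<^sub>R axis j 1)) \<le> K" if t: "t \<in> {0..h}" for t
    proof -
      let ?y = "x + t *\<^sub>R axis j 1"
      have "bracket x \<le> 3 * bracket ?y" using t h by (intro bracket_shift) (simp add: norm_axis_1)
      then have "bracket x ^ CARD('d) \<le> (3 * bracket ?y) ^ CARD('d)" using bracket_pos[of x] by (intro power_mono) auto
      then have "norm (partial_deriv j f ?y) * bracket x ^ CARD('d) \<le> norm (partial_deriv j f ?y) * (3 * bracket ?y) ^ CARD('d)"
        by (intro mult_left_mono) auto
      also have "\<dots> = (norm (partial_deriv j f ?y) * bracket ?y ^ CARD('d)) * 3 ^ CARD('d)" by (simp add: power_mult_distrib)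
      also have "\<dots> \<le> B * 3 ^ CARD('d)" by (intro mult_right_mono B) auto
      finally show ?thesis using bracket_pos[of x] by (simp add: K_def field_simps)
    qed
    have K0: "K \<ge> 0" using B bracket_pos[of x] by (simp add: K_def less_imp_le)
    have "norm (f (x + h *\<^sub>R axis j 1) - f (x + 0 *\<^sub>R axis j 1)) \<le> K * norm (h - 0)"
    proof (rule differentiable_bound[of "{0..h}" "\<lambda>t. f (x + t *\<^sub>R axis j 1)" "\<lambda>t s. s *\<^sub>R partial_deriv j f (x + t *\<^sub>R axis j 1)"])
      show "((\<lambda>t. f (x + t *\<^sub>R axis j 1)) has_derivative (\<lambda>s. s *\<^sub>R partial_deriv j f (x + t *\<^sub>R axis j 1))) (at t within {0..h})" for t
        using has_vector_derivative_line[OF schwartz_differentiable[OF f]] has_vector_derivative_def has_derivative_at_withinI by blast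
      show "onorm (\<lambda>s. s *\<^sub>R partial_deriv j f (x + t *\<^sub>R axis j 1)) \<le> K" if "t \<in> {0..h}" for t
        by (rule onorm_bound[OF K0]) (use mult_left_mono[OF le[OF that] abs_ge_zero] in \<open>simp add: mult.commute[of K]\<close>)
    qed (use h in auto)
    then have "norm (f (x + h *\<^sub>R axis j 1) - f x) \<le> K * h" using h by simp
    then have "norm (f (x + h *\<^sub>R axis j 1) - f x) / h \<le> K" using h by (simp add: pos_divide_le_eq)
    moreover have "norm ((f (x + h *\<^sub>R axis j 1) - f x) /\<^sub>R h) = norm (f (x + h *\<^sub>R axis j 1) - f x) / h"
      using h by (simp only: norm_scaleR) (simp add: divide_inverse mult.commute)
    ultimately show ?thesis by (simp only: K_def)
  qed
  then show ?thesis using that by blast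
qed

text \<open>Translation by h multiplies the transform by a phase, so the difference quotient of
  \<open>f\<close> has transform (cis (h \<xi>_j) - 1) / h times that of \<open>f\<close>. Dominated
  convergence on one side and differentiation of the phase on the other give the formula along h = 1
  / (n + 1).\<close>

lemma fourier_partial_deriv:
  fixes f :: "real^'d::finite \<Rightarrow> complex"
  assumes f: "schwartz f"
  shows "fourier (partial_deriv j f) \<xi> = \<i> * of_real (\<xi> $ j) * fourier f \<xi>"
proof -
  have [measurable]: "f \<in> borel_measurable borel" "partial_deriv j f \<in> borel_measurable borel"
    by (intro schwartz_measurable f schwartz_partial_deriv)+
  define e where "e = (axis j 1 :: real^'d)"
  define \<eta> where "\<eta> n = 1 / real (Suc n)" for n
  have \<eta>: "0 < \<eta> n" "\<eta> n \<le> 1" for n by (auto simp: \<eta>_def)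
  have \<eta>0: "\<eta> \<longlonglongrightarrow> 0" unfolding \<eta>_def by (rule LIMSEQ_Suc[OF lim_1_over_n])
  define Q where "Q n x = (f (x + \<eta> n *\<^sub>R e) - f x) /\<^sub>R \<eta> n" for n x
  have [measurable]: "Q n \<in> borel_measurable borel" for n unfolding Q_def[abs_def] by measurable
  have int: "integrable lborel (\<lambda>x. cis (x \<bullet> - \<xi>) * \<phi> x)" if "integrable lborel \<phi>" for \<phi> :: "real^'d \<Rightarrow> complex"
    by (rule Bochner_Integration.integrable_bound[OF that])
       (use borel_measurable_integrable[OF that] in \<open>auto simp: norm_mult\<close>)
  have fi: "integrable lborel f" by (rule schwartz_integrable[OF f])
  have shift: "(LINT x|lborel. cis (x \<bullet> - \<xi>) * f (x + h *\<^sub>R e)) = cis (h * \<xi> $ j) * fourier f \<xi>"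
    and shift_int: "integrable lborel (\<lambda>x. cis (x \<bullet> - \<xi>) * f (x + h *\<^sub>R e))" for h
  proof -
    have eq: "cis (x \<bullet> - \<xi>) * f (x + h *\<^sub>R e) = cis (h * \<xi> $ j) * (cis ((h *\<^sub>R e + 1 *\<^sub>R x) \<bullet> - \<xi>) * f (h *\<^sub>R e + 1 *\<^sub>R x))" for x
    proof -
      have "cis (h * \<xi> $ j) * cis ((h *\<^sub>R e + 1 *\<^sub>R x) \<bullet> - \<xi>) = cis (x \<bullet> - \<xi>)"
        by (simp add: cis_mult inner_add_left e_def inner_axis')
      then show ?thesis by (simp add: mult.assoc[symmetric] add.commute)
    qed
    have m: "(\<lambda>x. cis (x \<bullet> - \<xi>) * f x) \<in> borel_measurable borel" by measurable
    show "(LINT x|lborel. cis (x \<bullet> - \<xi>) * f (x + h *\<^sub>R e)) = cis (h * \<xi> $ j) * fourier f \<xi>"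
      unfolding eq integral_mult_right_zero fourier_eq_ft ft_def
      using integral_lborel_affine[of 1 "\<lambda>x. cis (x \<bullet> - \<xi>) * f x" "h *\<^sub>R e"] m by simp
    have "integrable lborel (\<lambda>x. f (x + h *\<^sub>R e))"
    proof -
      have "(\<integral>\<^sup>+x. ennreal (norm (f x)) \<partial>lborel) = (\<integral>\<^sup>+x. ennreal (norm (f (h *\<^sub>R e + 1 *\<^sub>R x))) \<partial>lborel)"
        by (subst nn_integral_lborel_affine[of 1 _ "h *\<^sub>R e"]) auto
      then show ?thesis using fi by (simp add: integrable_iff_bounded add.commute)
    qed
    then show "integrable lborel (\<lambda>x. cis (x \<bullet> - \<xi>) * f (x + h *\<^sub>R e))" by (rule int)
  qed
  have I: "(LINT x|lborel. cis (x \<bullet> - \<xi>) * Q n x) = ((cis (\<eta> n * \<xi> $ j) - 1) /\<^sub>R \<eta> n) * fourier f \<xi>" for n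
  proof -
    have "(LINT x|lborel. cis (x \<bullet> - \<xi>) * Q n x) = (LINT x|lborel. (cis (x \<bullet> - \<xi>) * f (x + \<eta> n *\<^sub>R e) - cis (x \<bullet> - \<xi>) * f x) /\<^sub>R \<eta> n)"
      by (simp add: Q_def right_diff_distrib)
    also have "\<dots> = ((LINT x|lborel. cis (x \<bullet> - \<xi>) * f (x + \<eta> n *\<^sub>R e)) - (LINT x|lborel. cis (x \<bullet> - \<xi>) * f x)) /\<^sub>R \<eta> n"
      by (simp only: integral_scaleR_right Bochner_Integration.integral_diff[OF shift_int int[OF fi]])
    also have "\<dots> = ((cis (\<eta> n * \<xi> $ j) - 1) /\<^sub>R \<eta> n) * fourier f \<xi>"
      unfolding shift by (simp add: fourier_eq_ft ft_def left_diff_distrib)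
    finally show ?thesis .
  qed
  have "(\<lambda>n. (LINT x|lborel. cis (x \<bullet> - \<xi>) * Q n x)) \<longlonglongrightarrow> (LINT x|lborel. cis (x \<bullet> - \<xi>) * partial_deriv j f x)"
  proof -
    obtain C where C: "\<And>x h. 0 < h \<Longrightarrow> h \<le> 1 \<Longrightarrow> norm ((f (x + h *\<^sub>R axis j 1) - f x) /\<^sub>R h) \<le> C * inverse (bracket x ^ CARD('d))"
      using difference_quotient_bound[OF f] by blast
    show ?thesis
    proof (rule integral_dominated_convergence[where w="\<lambda>x. C * inverse (bracket x ^ CARD('d))"])
      show "integrable lborel (\<lambda>x::real^'d. C * inverse (bracket x ^ CARD('d)))"
        using integrable_bracket[where 'a="real^'d"] by (intro integrable_mult_right) simp
      show "AE x in lborel. (\<lambda>n. cis (x \<bullet> - \<xi>) * Q n x) \<longlonglongrightarrow> cis (x \<bullet> - \<xi>) * partial_deriv j f x"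
      proof (intro AE_I2 tendsto_mult tendsto_const)
        fix x
        have "((\<lambda>t. f (x + t *\<^sub>R e)) has_vector_derivative partial_deriv j f x) (at 0)"
          using has_vector_derivative_line[of f x 0 j] schwartz_differentiable[OF f] by (simp add: e_def)
        from has_vector_derivative_quotient[OF this]
        have "((\<lambda>t. (f (x + t *\<^sub>R e) - f x) /\<^sub>R t) \<longlongrightarrow> partial_deriv j f x) (at 0)" by simp
        then have "\<forall>X. (\<forall>i. X i \<in> UNIV - {0}) \<longrightarrow> X \<longlonglongrightarrow> 0 \<longrightarrow> (\<lambda>n. (f (x + X n *\<^sub>R e) - f x) /\<^sub>R X n) \<longlonglongrightarrow> partial_deriv j f x"
          unfolding tendsto_at_iff_sequentially comp_def .
        moreover have "\<forall>i. \<eta> i \<in> UNIV - {0}" using \<eta>(1) by (simp add: less_imp_neq[symmetric] order_less_imp_not_eq2)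
        ultimately show "(\<lambda>n. Q n x) \<longlonglongrightarrow> partial_deriv j f x"
          unfolding Q_def using \<eta>0 by blast
      qed
      show "AE x in lborel. norm (cis (x \<bullet> - \<xi>) * Q n x) \<le> C * inverse (bracket x ^ CARD('d))" for n
        using C[OF \<eta>[of n]] by (simp add: norm_mult Q_def e_def)
    qed measurable
  qed
  then have "(\<lambda>n. ((cis (\<eta> n * \<xi> $ j) - 1) /\<^sub>R \<eta> n) * fourier f \<xi>) \<longlonglongrightarrow> fourier (partial_deriv j f) \<xi>"
    unfolding I by (simp add: fourier_eq_ft ft_def)
  moreover have "(\<lambda>n. ((cis (\<eta> n * \<xi> $ j) - 1) /\<^sub>R \<eta> n) * fourier f \<xi>) \<longlonglongrightarrow> (\<i> * of_real (\<xi> $ j)) * fourier f \<xi>"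
  proof (intro tendsto_mult tendsto_const)
    have "((\<lambda>t. exp (t * (\<i> * of_real (\<xi> $ j)))) has_field_derivative (\<i> * of_real (\<xi> $ j))) (at 0)"
      by (auto intro!: derivative_eq_intros)
    then have "((\<lambda>t. (exp (t * (\<i> * of_real (\<xi> $ j))) - 1) / t) \<longlongrightarrow> \<i> * of_real (\<xi> $ j)) (at 0)"
      by (simp add: has_field_derivative_iff)
    moreover have "(\<lambda>n. complex_of_real (\<eta> n)) \<longlonglongrightarrow> 0" using tendsto_of_real[OF \<eta>0] by simp
    moreover have "complex_of_real (\<eta> n) \<noteq> 0" for n using \<eta>(1)[of n] by simp
    ultimately have "(\<lambda>n. (exp (complex_of_real (\<eta> n) * (\<i> * of_real (\<xi> $ j))) - 1) / complex_of_real (\<eta> n)) \<longlonglongrightarrow> \<i> * of_real (\<xi> $ j)"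
      unfolding tendsto_at_iff_sequentially comp_def by auto
    then show "(\<lambda>n. (cis (\<eta> n * \<xi> $ j) - 1) /\<^sub>R \<eta> n) \<longlonglongrightarrow> \<i> * of_real (\<xi> $ j)"
      by (simp add: cis_conv_exp scaleR_conv_of_real divide_inverse mult_ac)
  qed
  ultimately show ?thesis by (rule LIMSEQ_unique)
qed

text \<open>Reduces a power of the norm to pure coordinate powers, so that decay of a transform
  follows from iterated derivatives in one direction at a time.\<close>

lemma norm_le_max_component:
  fixes \<xi> :: "real^'d::finite"
  shows "norm \<xi> ^ k \<le> real CARD('d) ^ k * (\<Sum>j\<in>UNIV. \<bar>\<xi> $ j\<bar> ^ k)"
proof -
  obtain m where m: "\<And>j. \<bar>\<xi> $ j\<bar> \<le> \<bar>\<xi> $ m\<bar>"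
  proof -
    have "Max (range (\<lambda>j. \<bar>\<xi> $ j\<bar>)) \<in> range (\<lambda>j. \<bar>\<xi> $ j\<bar>)" by (intro Max_in) auto
    then obtain m where "Max (range (\<lambda>j. \<bar>\<xi> $ j\<bar>)) = \<bar>\<xi> $ m\<bar>" by blast
    then show ?thesis using that by (metis Max_ge finite finite_imageI rangeI)
  qed
  have "norm \<xi> \<le> (\<Sum>j\<in>UNIV. \<bar>\<xi> $ j\<bar>)" by (rule norm_le_l1_cart)
  also have "\<dots> \<le> (\<Sum>j\<in>(UNIV::'d set). \<bar>\<xi> $ m\<bar>)" by (intro sum_mono m)
  finally have "norm \<xi> \<le> real CARD('d) * \<bar>\<xi> $ m\<bar>" by simp
  then have "norm \<xi> ^ k \<le> (real CARD('d) * \<bar>\<xi> $ m\<bar>) ^ k" by (intro power_mono) auto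
  also have "\<dots> = real CARD('d) ^ k * \<bar>\<xi> $ m\<bar> ^ k" by (simp add: power_mult_distrib)
  also have "\<dots> \<le> real CARD('d) ^ k * (\<Sum>j\<in>UNIV. \<bar>\<xi> $ j\<bar> ^ k)"
    by (intro mult_left_mono member_le_sum) auto
  finally show ?thesis .
qed

text \<open>Up to a unimodular factor, a coordinate power times the transform is the transform of an
  iterated derivative, hence bounded by the L^1 norm of that derivative.\<close>

lemma fourier_decay:
  fixes f :: "real^'d::finite \<Rightarrow> complex"
  assumes f: "schwartz f"
  obtains C where "\<And>\<xi>. norm (fourier f \<xi>) * bracket \<xi> ^ m \<le> C" "C \<ge> 0"
proof -
  define B where "B j k = (LINT x|lborel. norm (partial_derivs (replicate k j) f x))" for j k
  have rep: "fourier (partial_derivs (replicate k j) f) \<xi> = (\<i> * of_real (\<xi> $ j)) ^ k * fourier f \<xi>" for j k \<xi>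
    by (induction k) (simp_all add: fourier_partial_deriv[OF schwartz_partial_derivs[OF f]])
  have B: "\<bar>\<xi> $ j\<bar> ^ k * norm (fourier f \<xi>) \<le> B j k" for j k \<xi>
  proof -
    have "\<bar>\<xi> $ j\<bar> ^ k * norm (fourier f \<xi>) = norm (fourier (partial_derivs (replicate k j) f) \<xi>)"
      unfolding rep by (simp add: norm_mult norm_power)
    also have "\<dots> \<le> B j k" unfolding fourier_eq_ft B_def by (rule norm_ft_le)
    finally show ?thesis .
  qed
  define C where "C = 2 ^ m * ((LINT x|lborel. norm (f x)) + real CARD('d) ^ (2 * m) * (\<Sum>j\<in>UNIV. B j (2 * m)))"
  have *: "norm (fourier f \<xi>) * bracket \<xi> ^ m \<le> C" for \<xi>
  proof -
    have "norm (fourier f \<xi>) * bracket \<xi> ^ m \<le> norm (fourier f \<xi>) * (2 ^ m * (1 + norm \<xi> ^ (2 * m)))"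
      unfolding bracket_def by (intro mult_left_mono power_one_plus_sq_le) auto
    also have "\<dots> \<le> norm (fourier f \<xi>) * (2 ^ m * (1 + real CARD('d) ^ (2 * m) * (\<Sum>j\<in>UNIV. \<bar>\<xi> $ j\<bar> ^ (2 * m))))"
      by (intro mult_left_mono add_left_mono norm_le_max_component) auto
    also have "\<dots> = 2 ^ m * (norm (fourier f \<xi>) + real CARD('d) ^ (2 * m) * (\<Sum>j\<in>UNIV. \<bar>\<xi> $ j\<bar> ^ (2 * m) * norm (fourier f \<xi>)))"
      by (simp add: algebra_simps sum_distrib_left)
    also have "\<dots> \<le> C"
      unfolding C_def by (intro mult_left_mono add_mono sum_mono B) (auto simp: fourier_eq_ft norm_ft_le)
    finally show ?thesis .
  qed
  show ?thesis
  proof (rule that[OF *])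
    have "0 \<le> norm (fourier f 0) * bracket (0::real^'d) ^ m" by (simp add: bracket_def)
    then show "C \<ge> 0" using *[of 0] by linarith
  qed
qed

section \<open>From Schwartz data to amplitudes in frequency\<close>

lemma continuous_ft:
  fixes \<phi> :: "'a::euclidean_space \<Rightarrow> complex"
  assumes \<phi>: "integrable lborel \<phi>"
  shows "continuous_on UNIV (ft \<phi>)"
proof (rule continuous_on_sequentiallyI)
  fix u :: "nat \<Rightarrow> 'a" and a assume u: "u \<longlonglongrightarrow> a"
  have [measurable]: "\<phi> \<in> borel_measurable borel" using \<phi> by (auto dest: borel_measurable_integrable)
  show "(\<lambda>n. ft \<phi> (u n)) \<longlonglongrightarrow> ft \<phi> a"
    unfolding ft_def
  proof (rule integral_dominated_convergence[where w="\<lambda>\<xi>. norm (\<phi> \<xi>)"])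
    show "AE x in lborel. (\<lambda>n. cis (x \<bullet> u n) * \<phi> x) \<longlonglongrightarrow> cis (x \<bullet> a) * \<phi> x"
      unfolding cis_conv_exp by (intro AE_I2 tendsto_intros u)
  qed (use \<phi> in \<open>auto simp: norm_mult\<close>)
qed

text \<open>Carries the factor (2 pi)^(-d), so that the wave operator and the multiplier both become
  plain integrals against it.\<close>

definition spectrum :: "(real^'d::finite \<Rightarrow> complex) \<Rightarrow> real^'d \<Rightarrow> complex" where
  "spectrum f \<xi> = complex_of_real (1 / (2 * pi) ^ CARD('d)) * fourier f \<xi>"

lemma wave_op_eq_wave_int: "wave_op t f x = wave_int (spectrum f) t x"
  unfolding wave_op_def wave_int_def spectrum_def
  by (simp add: cis_conv_exp mult.left_commute flip: integral_mult_right_zero)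

lemma laplacian_eq_ft: "laplacian_half_power s f x = ft (\<lambda>\<xi>. complex_of_real (norm \<xi> powr s) * spectrum f \<xi>) x"
  unfolding laplacian_half_power_def ft_def spectrum_def
  by (simp add: cis_conv_exp inner_commute mult.left_commute mult.assoc flip: integral_mult_right_zero)

lemma continuous_spectrum:
  assumes "schwartz f" shows "continuous_on UNIV (spectrum f)"
proof -
  have "continuous_on UNIV (\<lambda>\<xi>. ft f (- \<xi>))"
    by (rule continuous_on_compose2[OF continuous_ft[OF schwartz_integrable[OF assms]]]) (auto intro: continuous_intros)
  then show ?thesis unfolding spectrum_def fourier_eq_ft by (intro continuous_intros)
qed

text \<open>Supplies the hypotheses of \<open>Plancherel_ge\<close> for the weighted spectrum and
  integrability of the plain one for the wave integral. Positivity of s makes |\<xi>|^s continuous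
  at the origin, and rapid decay of the transform absorbs its growth.\<close>

lemma weighted_spectrum:
  fixes f :: "real^'d::finite \<Rightarrow> complex"
  assumes f: "schwartz f" and s: "s > 0"
  defines "g \<equiv> \<lambda>\<xi>. complex_of_real (norm \<xi> powr s) * spectrum f \<xi>"
  shows "continuous_on UNIV g" "integrable lborel g" "\<exists>B. \<forall>\<xi>. norm (g \<xi>) \<le> B" "integrable lborel (spectrum f)"
proof -
  show cont: "continuous_on UNIV g"
    unfolding g_def using s by (intro continuous_intros continuous_on_powr' continuous_spectrum f) auto
  have [measurable]: "g \<in> borel_measurable borel" "spectrum f \<in> borel_measurable borel"
    by (intro borel_measurable_continuous_onI cont continuous_spectrum f)+
  \<comment> \<open>Rounding s up bounds the real power by an integer power of the bracket.\<close>
  define n where "n = nat \<lceil>s\<rceil>"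
  obtain C where C: "\<And>\<xi>. norm (fourier f \<xi>) * bracket \<xi> ^ (n + CARD('d)) \<le> C" "C \<ge> 0"
    using fourier_decay[OF f, of "n + CARD('d)"] by blast
  define c where "c = 1 / (2 * pi) ^ CARD('d)"
  have c: "c \<ge> 0" by (simp add: c_def)
  have w: "norm \<xi> powr s \<le> bracket \<xi> ^ n" for \<xi> :: "real^'d"
  proof -
    have "norm \<xi> \<le> bracket \<xi>"
    proof -
      have "2 * norm \<xi> \<le> (norm \<xi>)\<^sup>2 + 1" using sum_squares_bound[of "norm \<xi>" 1] by simp
      then show ?thesis unfolding bracket_def using norm_ge_zero[of \<xi>] by linarith
    qed
    then have "norm \<xi> powr s \<le> bracket \<xi> powr s" using s by (intro powr_mono2) auto
    also have "\<dots> \<le> bracket \<xi> powr real n" using bracket_ge_1[of \<xi>] by (intro powr_mono) (auto simp: n_def real_nat_ceiling_ge)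
    also have "\<dots> = bracket \<xi> ^ n" using bracket_pos[of \<xi>] by (simp add: powr_realpow)
    finally show ?thesis .
  qed
  have ns: "norm (spectrum f \<xi>) = c * norm (fourier f \<xi>)" for \<xi>
    by (simp only: spectrum_def norm_mult norm_of_real c_def[symmetric] abs_of_nonneg[OF c])
  have ng: "norm (g \<xi>) = norm \<xi> powr s * (c * norm (fourier f \<xi>))" for \<xi>
    by (simp only: g_def norm_mult ns norm_of_real abs_of_nonneg powr_ge_zero)
  have main: "norm (g \<xi>) * bracket \<xi> ^ CARD('d) \<le> c * C" for \<xi>
  proof -
    have "norm (g \<xi>) * bracket \<xi> ^ CARD('d) \<le> bracket \<xi> ^ n * (c * norm (fourier f \<xi>)) * bracket \<xi> ^ CARD('d)"
      unfolding ng using c w bracket_pos[of \<xi>] by (intro mult_right_mono) auto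
    also have "\<dots> = c * (norm (fourier f \<xi>) * bracket \<xi> ^ (n + CARD('d)))" by (simp add: power_add)
    also have "\<dots> \<le> c * C" by (intro mult_left_mono C c)
    finally show ?thesis .
  qed
  show "integrable lborel g" by (rule integrable_by_bracket) (use main in auto)
  have "norm (g \<xi>) \<le> c * C" for \<xi>
  proof -
    have "norm (g \<xi>) * 1 \<le> norm (g \<xi>) * bracket \<xi> ^ CARD('d)"
      using bracket_ge_1[of \<xi>] by (intro mult_left_mono one_le_power) auto
    then show ?thesis using main[of \<xi>] by simp
  qed
  then show "\<exists>B. \<forall>\<xi>. norm (g \<xi>) \<le> B" by blast
  have "norm (spectrum f \<xi>) * bracket \<xi> ^ CARD('d) \<le> c * C" for \<xi>
  proof -
    have "norm (spectrum f \<xi>) * bracket \<xi> ^ CARD('d) \<le> c * (norm (fourier f \<xi>) * bracket \<xi> ^ (n + CARD('d)))"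
      unfolding ns mult.assoc using c bracket_ge_1[of \<xi>] by (intro mult_left_mono power_increasing) auto
    also have "\<dots> \<le> c * C" by (intro mult_left_mono C c)
    finally show ?thesis .
  qed
  then show "integrable lborel (spectrum f)" by (intro integrable_by_bracket) auto
qed

lemma partial_derivs_diff:
  assumes "schwartz f" "schwartz g"
  shows "partial_derivs js (\<lambda>x. f x - g x) = (\<lambda>x. partial_derivs js f x - partial_derivs js g x)"
proof (induction js)
  case (Cons j js)
  have "frechet_derivative (\<lambda>x. partial_derivs js f x - partial_derivs js g x) (at x) =
      (\<lambda>v. frechet_derivative (partial_derivs js f) (at x) v - frechet_derivative (partial_derivs js g) (at x) v)" for x
  proof (rule frechet_derivative_at[symmetric], rule has_derivative_diff)
    show "(partial_derivs js f has_derivative frechet_derivative (partial_derivs js f) (at x)) (at x)"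
      "(partial_derivs js g has_derivative frechet_derivative (partial_derivs js g) (at x)) (at x)"
      using assms unfolding schwartz_def frechet_derivative_works by blast+
  qed
  then show ?case by (simp add: Cons.IH partial_deriv_def fun_eq_iff)
qed simp

lemma schwartz_diff:
  assumes f: "schwartz f" and g: "schwartz g" shows "schwartz (\<lambda>x. f x - g x)"
  unfolding schwartz_def partial_derivs_diff[OF f g]
proof (intro allI conjI)
  fix js x k
  show "(\<lambda>x. partial_derivs js f x - partial_derivs js g x) differentiable at x"
    using f g unfolding schwartz_def by (intro differentiable_diff) auto
  have "bounded (range (\<lambda>x. norm x ^ k *\<^sub>R partial_derivs js f x))" "bounded (range (\<lambda>x. norm x ^ k *\<^sub>R partial_derivs js g x))"
    using f g unfolding schwartz_def by blast+
  from bounded_minus_comp[OF this]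
  show "bounded (range (\<lambda>x. norm x ^ k *\<^sub>R (partial_derivs js f x - partial_derivs js g x)))"
    by (simp add: scaleR_right_diff_distrib)
qed

lemma spectrum_diff:
  assumes f: "schwartz f" and g: "schwartz g"
  shows "spectrum (\<lambda>x. f x - g x) \<xi> = spectrum f \<xi> - spectrum g \<xi>"
proof -
  have int: "integrable lborel (\<lambda>x. cis (x \<bullet> - \<xi>) * \<phi> x)" if "schwartz \<phi>" for \<phi>
    by (rule Bochner_Integration.integrable_bound[OF schwartz_integrable[OF that]])
       (use schwartz_measurable[OF that] in \<open>auto simp: norm_mult\<close>)
  have "fourier (\<lambda>x. f x - g x) \<xi> = fourier f \<xi> - fourier g \<xi>"
    unfolding fourier_eq_ft ft_def right_diff_distrib
    by (rule Bochner_Integration.integral_diff[OF int[OF f] int[OF g]])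
  then show ?thesis by (simp add: spectrum_def right_diff_distrib)
qed

section \<open>A priori estimates and extension by density\<close>

lemma ennreal_powr_less_iff:
  assumes p: "p > 0"
  shows "a < ennreal_powr b p \<longleftrightarrow> ennreal_powr a (1 / p) < b" "ennreal_powr b p < a \<longleftrightarrow> b < ennreal_powr a (1 / p)"
proof -
  have inv: "ennreal_powr (ennreal_powr a (1 / p)) p = a"
    using ennreal_powr_inverse[of "1 / p" a] p by simp
  show "a < ennreal_powr b p \<longleftrightarrow> ennreal_powr a (1 / p) < b"
    using ennreal_powr_mono[of b "ennreal_powr a (1 / p)" p] ennreal_powr_mono[of "ennreal_powr b p" a "1 / p"] p
    by (auto simp: inv ennreal_powr_inverse not_le[symmetric])
  show "ennreal_powr b p < a \<longleftrightarrow> b < ennreal_powr a (1 / p)"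
    using ennreal_powr_mono[of "ennreal_powr a (1 / p)" b p] ennreal_powr_mono[of a "ennreal_powr b p" "1 / p"] p
    by (auto simp: inv ennreal_powr_inverse not_le[symmetric])
qed

text \<open>The power is an order isomorphism of [0,\<infinity>], so order neighbourhoods pull back
  under it; this covers the point \<infinity> as well.\<close>

lemma continuous_ennreal_powr:
  assumes p: "p > 0" shows "continuous_on A (\<lambda>a. ennreal_powr a p)"
  unfolding continuous_on_def
proof (intro ballI order_tendstoI)
  fix x a
  show "\<forall>\<^sub>F y in at x within A. a < ennreal_powr y p" if "a < ennreal_powr x p"
    using that unfolding ennreal_powr_less_iff(1)[OF p] by (rule order_tendstoD(1)[OF tendsto_ident_at])
  show "\<forall>\<^sub>F y in at x within A. ennreal_powr y p < a" if "ennreal_powr x p < a"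
    using that unfolding ennreal_powr_less_iff(2)[OF p] by (rule order_tendstoD(2)[OF tendsto_ident_at])
qed

lemma ennreal_powr_2: "ennreal_powr a 2 = a\<^sup>2"
  by (cases a) (auto simp: ennreal_power)

lemma ennreal_powr_sq_half: "ennreal_powr (a\<^sup>2) (1 / 2) = a"
  using ennreal_powr_inverse[of 2 a] by (simp add: ennreal_powr_2)

lemma ennreal_powr_half_sq: "(ennreal_powr a (1 / 2))\<^sup>2 = a"
  using ennreal_powr_inverse[of "1 / 2" a] by (simp add: ennreal_powr_2)

text \<open>Minkowski's inequality by expanding the square and Cauchy-Schwarz; carried out in
  [0,\<infinity>], it includes infinite norms.\<close>

lemma Lp_norm_2_triangle:
  fixes f g h :: "real^'d::finite \<Rightarrow> ennreal"
  assumes [measurable]: "g \<in> borel_measurable borel" "h \<in> borel_measurable borel"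
    and le: "\<And>x. f x \<le> g x + h x"
  shows "Lp_norm 2 f \<le> Lp_norm 2 g + Lp_norm 2 h"
proof -
  define A where "A = Lp_norm 2 g"
  define B where "B = Lp_norm 2 h"
  have A: "(\<integral>\<^sup>+x. (g x)\<^sup>2 \<partial>lborel) = A\<^sup>2" and B: "(\<integral>\<^sup>+x. (h x)\<^sup>2 \<partial>lborel) = B\<^sup>2"
    by (simp_all add: A_def B_def Lp_norm_def ennreal_powr_2 ennreal_powr_half_sq)
  have "(\<integral>\<^sup>+x. g x * h x \<partial>lborel)\<^sup>2 \<le> (A * B)\<^sup>2"
    using Cauchy_Schwarz_nn_integral[of g lborel h] by (simp add: A B power_mult_distrib)
  from ennreal_powr_mono[OF this, of "1 / 2"]
  have I: "(\<integral>\<^sup>+x. g x * h x \<partial>lborel) \<le> A * B" by (simp add: ennreal_powr_sq_half)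
  have "(\<integral>\<^sup>+x. (f x)\<^sup>2 \<partial>lborel) \<le> (\<integral>\<^sup>+x. (g x)\<^sup>2 + (2 * (g x * h x) + (h x)\<^sup>2) \<partial>lborel)"
  proof (rule nn_integral_mono)
    fix x
    have "(f x)\<^sup>2 \<le> (g x + h x)\<^sup>2" by (intro power_mono le) simp
    then show "(f x)\<^sup>2 \<le> (g x)\<^sup>2 + (2 * (g x * h x) + (h x)\<^sup>2)"
      by (simp add: power2_sum add_ac mult_ac)
  qed
  also have "\<dots> = A\<^sup>2 + (2 * (\<integral>\<^sup>+x. g x * h x \<partial>lborel) + B\<^sup>2)"
    by (simp add: nn_integral_add nn_integral_cmult A B)
  also have "\<dots> \<le> A\<^sup>2 + (2 * (A * B) + B\<^sup>2)" by (intro add_mono mult_left_mono I) auto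
  also have "\<dots> = (A + B)\<^sup>2" by (simp add: power2_sum add_ac mult_ac)
  finally have "ennreal_powr (\<integral>\<^sup>+x. (f x)\<^sup>2 \<partial>lborel) (1 / 2) \<le> ennreal_powr ((A + B)\<^sup>2) (1 / 2)"
    by (intro ennreal_powr_mono) auto
  then show ?thesis by (simp add: A_def B_def Lp_norm_def[of 2 f] ennreal_powr_2 ennreal_powr_sq_half)
qed

text \<open>Powers commute with the lower limit because they are continuous and increasing, so
  Fatou's lemma passes to norms. Inequalities almost everywhere and bounds that hold eventually are
  the form in which the extension by density provides its data.\<close>

lemma Lp_norm_fatou:
  fixes G :: "nat \<Rightarrow> real^'d::finite \<Rightarrow> ennreal"
  assumes q: "q > 0" and [measurable]: "\<And>k. G k \<in> borel_measurable borel"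
    and le: "AE x in lborel. f x \<le> liminf (\<lambda>k. G k x)" and b: "\<forall>\<^sub>F k in sequentially. Lp_norm q (G k) \<le> b"
  shows "Lp_norm q f \<le> b"
proof -
  have cm: "liminf (\<lambda>k. ennreal_powr (G k x) q) = ennreal_powr (liminf (\<lambda>k. G k x)) q" for x
    using q by (intro Liminf_compose_continuous_mono continuous_ennreal_powr monoI ennreal_powr_mono) auto
  have "(\<integral>\<^sup>+x. ennreal_powr (f x) q \<partial>lborel) \<le> (\<integral>\<^sup>+x. liminf (\<lambda>k. ennreal_powr (G k x) q) \<partial>lborel)"
    unfolding cm
  proof (rule nn_integral_mono_AE)
    show "AE x in lborel. ennreal_powr (f x) q \<le> ennreal_powr (liminf (\<lambda>k. G k x)) q"
      using le by eventually_elim (use q in \<open>auto intro!: ennreal_powr_mono\<close>)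
  qed
  also have "\<dots> \<le> liminf (\<lambda>k. \<integral>\<^sup>+x. ennreal_powr (G k x) q \<partial>lborel)"
    by (rule nn_integral_liminf) measurable
  also have "\<dots> \<le> ennreal_powr b q"
  proof -
    have "\<forall>\<^sub>F k in sequentially. (\<integral>\<^sup>+x. ennreal_powr (G k x) q \<partial>lborel) \<le> ennreal_powr b q"
      using b
    proof eventually_elim
      case (elim k)
      from ennreal_powr_mono[OF this, of q] show ?case
        using q ennreal_powr_inverse[of "1 / q"] by (simp add: Lp_norm_def)
    qed
    then show ?thesis by (rule order_trans[OF Liminf_mono]) (simp add: Liminf_const)
  qed
  finally have "Lp_norm q f \<le> ennreal_powr (ennreal_powr b q) (1 / q)"
    unfolding Lp_norm_def using q by (intro ennreal_powr_mono) auto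
  then show ?thesis using q by (simp add: ennreal_powr_inverse)
qed

text \<open>Fatou is used twice: in x it makes the distribution function lower semicontinuous, since
  a < liminf G_k forces a < G_k eventually; in the height it passes to the integral that defines the
  norm.\<close>

lemma Lorentz_norm_fatou:
  fixes G :: "nat \<Rightarrow> real^'d::finite \<Rightarrow> ennreal"
  assumes q: "q > 0" and f[measurable]: "f \<in> borel_measurable borel" and [measurable]: "\<And>k. G k \<in> borel_measurable borel"
    and le: "AE x in lborel. f x \<le> liminf (\<lambda>k. G k x)" and b: "\<forall>\<^sub>F k in sequentially. Lorentz_norm q 2 (G k) \<le> b"
  shows "Lorentz_norm q 2 f \<le> b"
proof -
  define \<Phi> where "\<Phi> a m = ennreal (a powr (2 - 1)) * ennreal_powr m (2 / q) * indicator {0<..} a" for a :: real and m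
  define I where "I f = (\<integral>\<^sup>+a. \<Phi> a (emeasure lborel {x. ennreal a < f x}) \<partial>lborel)" for f :: "real^'d \<Rightarrow> ennreal"
  have Lor: "Lorentz_norm q 2 f = ennreal_powr (ennreal q * I f) (1 / 2)" for f :: "real^'d \<Rightarrow> ennreal"
    by (simp add: Lorentz_norm_def I_def \<Phi>_def)
  have \<Phi>_mono: "\<Phi> a m \<le> \<Phi> a m'" if "m \<le> m'" for a m m'
    unfolding \<Phi>_def using that q by (intro mult_right_mono mult_left_mono ennreal_powr_mono) auto
  have \<Phi>_cont: "continuous_on UNIV (\<Phi> a)" for a
  proof -
    have "continuous_on UNIV (\<lambda>m. (ennreal (a powr (2 - 1)) * indicator {0<..} a) * ennreal_powr m (2 / q))"
      using q by (intro ennreal_continuous_on_cmult continuous_ennreal_powr) (auto split: split_indicator)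
    then show ?thesis unfolding \<Phi>_def[abs_def] by (simp add: mult_ac)
  qed
  \<comment> \<open>Exhibits the distribution function as an integral over x of a function jointly
    measurable in height and point, whence its measurability in the height.\<close>
  have em: "emeasure lborel {x. ennreal a < g x} = (\<integral>\<^sup>+x. indicator {0<..} (if ennreal a < g x then 1 else 0 :: real) \<partial>lborel)"
    if [measurable]: "g \<in> borel_measurable borel" for g :: "real^'d \<Rightarrow> ennreal" and a
  proof -
    have "emeasure lborel {x. ennreal a < g x} = (\<integral>\<^sup>+x. indicator {x. ennreal a < g x} x \<partial>lborel)"
      by (rule nn_integral_indicator[symmetric]) measurable
    also have "\<dots> = (\<integral>\<^sup>+x. indicator {0<..} (if ennreal a < g x then 1 else 0 :: real) \<partial>lborel)"
      by (intro nn_integral_cong) (simp split: split_indicator)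
    finally show ?thesis .
  qed
  have m: "(\<lambda>a. \<Phi> a (emeasure lborel {x. ennreal a < g x})) \<in> borel_measurable lborel"
    if [measurable]: "g \<in> borel_measurable borel" for g :: "real^'d \<Rightarrow> ennreal"
    unfolding \<Phi>_def em[OF that] by measurable
  have sets: "emeasure lborel {x. ennreal a < f x} \<le> liminf (\<lambda>k. emeasure lborel {x. ennreal a < G k x})" for a
  proof -
    have "emeasure lborel {x. ennreal a < f x} = (\<integral>\<^sup>+x. indicator {x. ennreal a < f x} x \<partial>lborel)"
      by (rule nn_integral_indicator[symmetric]) measurable
    also have "\<dots> \<le> (\<integral>\<^sup>+x. liminf (\<lambda>k. indicator {x. ennreal a < G k x} x) \<partial>lborel)"
      using le
    proof (intro nn_integral_mono_AE, eventually_elim)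
      case (elim x)
      show ?case
      proof (cases "ennreal a < f x")
        case True
        then have "ennreal a < liminf (\<lambda>k. G k x)" using elim by simp
        then have "\<forall>\<^sub>F k in sequentially. ennreal a < G k x" by (rule less_LiminfD)
        then have "\<forall>\<^sub>F k in sequentially. (1::ennreal) \<le> indicator {x. ennreal a < G k x} x" by eventually_elim simp
        then have "(1::ennreal) \<le> liminf (\<lambda>k. indicator {x. ennreal a < G k x} x)" by (rule Liminf_bounded)
        then show ?thesis using True by simp
      qed simp
    qed
    also have "\<dots> \<le> liminf (\<lambda>k. \<integral>\<^sup>+x. indicator {x. ennreal a < G k x} x \<partial>lborel)"
      by (rule nn_integral_liminf) measurable
    also have "\<dots> = liminf (\<lambda>k. emeasure lborel {x. ennreal a < G k x})" by simp
    finally show ?thesis .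
  qed
  have "I f \<le> (\<integral>\<^sup>+a. liminf (\<lambda>k. \<Phi> a (emeasure lborel {x. ennreal a < G k x})) \<partial>lborel)"
    unfolding I_def
  proof (rule nn_integral_mono)
    fix a
    have "liminf (\<lambda>k. \<Phi> a (emeasure lborel {x. ennreal a < G k x})) = \<Phi> a (liminf (\<lambda>k. emeasure lborel {x. ennreal a < G k x}))"
      by (intro Liminf_compose_continuous_mono \<Phi>_cont monoI \<Phi>_mono) auto
    then show "\<Phi> a (emeasure lborel {x. ennreal a < f x}) \<le> liminf (\<lambda>k. \<Phi> a (emeasure lborel {x. ennreal a < G k x}))"
      using \<Phi>_mono[OF sets] by simp
  qed
  also have "\<dots> \<le> liminf (\<lambda>k. I (G k))"
    unfolding I_def by (rule nn_integral_liminf) (rule m, measurable)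
  finally have "ennreal q * I f \<le> ennreal q * liminf (\<lambda>k. I (G k))" by (rule mult_left_mono) simp
  also have "\<dots> = liminf (\<lambda>k. ennreal q * I (G k))"
    by (rule Liminf_compose_continuous_mono[symmetric]) (auto intro!: ennreal_continuous_on_cmult monoI mult_left_mono continuous_intros)
  also have "\<dots> \<le> b\<^sup>2"
  proof -
    have "\<forall>\<^sub>F k in sequentially. ennreal q * I (G k) \<le> b\<^sup>2"
      using b
    proof eventually_elim
      case (elim k)
      then have "(Lorentz_norm q 2 (G k))\<^sup>2 \<le> b\<^sup>2" by (intro power_mono) auto
      then show ?case by (simp only: Lor ennreal_powr_half_sq)
    qed
    then show ?thesis by (rule order_trans[OF Liminf_mono]) (simp add: Liminf_const)
  qed
  finally have "Lorentz_norm q 2 f \<le> ennreal_powr (b\<^sup>2) (1 / 2)" unfolding Lor by (intro ennreal_powr_mono) auto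
  then show ?thesis by (simp add: ennreal_powr_sq_half)
qed

lemma sup_time_wave_op: "sup_time (\<lambda>t. wave_op t f) = max_wave (spectrum f)"
  by (simp add: sup_time_def max_wave_def wave_op_eq_wave_int fun_eq_iff)

lemma spectrum_integrable: "schwartz f \<Longrightarrow> integrable lborel (spectrum f)"
  using weighted_spectrum(4)[of f 1] by simp

lemma sup_time_wave_op_measurable:
  "schwartz f \<Longrightarrow> sup_time (\<lambda>t. wave_op t f) \<in> borel_measurable borel"
  unfolding sup_time_wave_op by (intro max_wave_measurable spectrum_integrable)

text \<open>\<open>Plancherel_ge\<close> with the factor (2 pi)^d >= 1 dropped. It links the Sobolev
  norm to the energy of the weighted spectrum, in terms of which the frequency estimates are
  expressed.\<close>

lemma Hdot_norm_spectrum: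
  fixes f :: "real^'d::finite \<Rightarrow> complex"
  assumes f: "schwartz f" and s: "s > 0"
  obtains n2 where "n2 \<ge> 0" "(\<integral>\<^sup>+\<xi>. ennreal ((norm (complex_of_real (norm \<xi> powr s) * spectrum f \<xi>))\<^sup>2) \<partial>lborel) = ennreal n2"
    "ennreal (sqrt n2) \<le> Hdot_norm s f"
proof -
  define g where "g = (\<lambda>\<xi>. complex_of_real (norm \<xi> powr s) * spectrum f \<xi>)"
  note W = weighted_spectrum[OF f s, folded g_def]
  obtain B where B: "\<And>\<xi>. norm (g \<xi>) \<le> B" using weighted_spectrum(3)[OF f s] unfolding g_def by blast
  have [measurable]: "g \<in> borel_measurable borel" using W(2) by (auto dest: borel_measurable_integrable)
  have B0: "B \<ge> 0" using B[of 0] norm_ge_zero order_trans by blast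
  have int: "integrable lborel (\<lambda>\<xi>. (norm (g \<xi>))\<^sup>2)"
  proof (rule Bochner_Integration.integrable_bound[OF integrable_mult_right[OF integrable_norm[OF W(2)], of B]])
    show "AE x in lborel. norm ((norm (g x))\<^sup>2) \<le> norm (B * norm (g x))"
      using B0 by (auto simp: power2_eq_square intro!: mult_right_mono B)
  qed measurable
  define n2 where "n2 = (LINT \<xi>|lborel. (norm (g \<xi>))\<^sup>2)"
  have n2: "n2 \<ge> 0" by (simp add: n2_def integral_nonneg_AE)
  have eq: "(\<integral>\<^sup>+\<xi>. ennreal ((norm (g \<xi>))\<^sup>2) \<partial>lborel) = ennreal n2"
    unfolding n2_def by (rule nn_integral_eq_integral[OF int]) simp
  have "(1::real) \<le> (2 * pi) ^ DIM(real^'d)" using pi_gt3 by (intro one_le_power) simp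
  then have "ennreal 1 * ennreal n2 \<le> ennreal ((2 * pi) ^ DIM(real^'d)) * ennreal n2"
    by (intro mult_right_mono ennreal_leI) auto
  also have "\<dots> \<le> (\<integral>\<^sup>+x. ennreal ((norm (ft g x))\<^sup>2) \<partial>lborel)"
    unfolding eq[symmetric] by (rule Plancherel_ge[OF W(2) B W(1)])
  finally have "ennreal_powr (ennreal n2) (1 / 2) \<le> ennreal_powr (\<integral>\<^sup>+x. ennreal ((norm (ft g x))\<^sup>2) \<partial>lborel) (1 / 2)"
    by (intro ennreal_powr_mono) auto
  then have "ennreal (sqrt n2) \<le> Hdot_norm s f"
    using n2 by (simp add: Hdot_norm_def Lp_norm_def laplacian_eq_ft g_def[symmetric] powr_half_sqrt)
  then show ?thesis using that[OF n2] eq by (simp add: g_def)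
qed

text \<open>This is where \<epsilon> is chosen. The condition on q gives s > d / (d + 1), the
  threshold of the high part, and d - 2 s = 2d / q > 0 is the margin of the low part.\<close>

lemma a_priori:
  fixes q s :: real
  assumes d: "CARD('d::finite) \<ge> 2" and q: "q > q_circ CARD('d)" and s: "s = s_crit q CARD('d)"
  obtains C1 C2 where "q > 2" "s > 0"
    "\<And>f :: real^'d \<Rightarrow> complex. schwartz f \<Longrightarrow> Lp_norm q (sup_time (\<lambda>t. wave_op t f)) \<le> ennreal C1 * Hdot_norm s f"
    "\<And>f :: real^'d \<Rightarrow> complex. schwartz f \<Longrightarrow> Lorentz_norm q 2 (sup_time (\<lambda>t. wave_op t f)) \<le> ennreal C2 * Hdot_norm s f"
proof -
  let ?d = "real CARD('d)"
  have d2: "?d \<ge> 2" using d by simp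
  have "2 * (?d - 1) < 2 * (?d + 1)" by simp
  then have "2 < q_circ CARD('d)" using d2 by (simp add: q_circ_def field_simps)
  then have q2: "q > 2" using q by simp
  have ds: "?d - 2 * s = 2 * ?d / q" by (simp add: s s_crit_def)
  \<comment> \<open>The margin above d / (d + 1), the critical Sobolev exponent at the endpoint
    \<open>q_circ\<close>.\<close>
  define \<delta> where "\<delta> = s - ?d / (?d + 1)"
  have \<delta>: "\<delta> > 0"
  proof -
    have "2 * (?d + 1) < q * (?d - 1)" using q d2 by (simp add: q_circ_def field_simps)
    then have "2 / q < (?d - 1) / (?d + 1)" using q2 d2 by (simp add: field_simps)
    then have "?d * (2 / q) < ?d * ((?d - 1) / (?d + 1))" using d2 by (intro mult_strict_left_mono) auto
    then have "2 * ?d / q < ?d * (?d - 1) / (?d + 1)" by (simp add: mult.commute)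
    also have "\<dots> = ?d - 2 * (?d / (?d + 1))" using d2 by (simp add: field_simps)
    finally show ?thesis using ds by (simp add: \<delta>_def)
  qed
  \<comment> \<open>Half the smaller of the two margins, so that both strict inequalities
    survive.\<close>
  define \<epsilon> where "\<epsilon> = min (?d / q) \<delta> / 2"
  have dq: "?d / q > 0" using q2 d2 by simp
  have "min a b / 2 > 0 \<and> min a b / 2 < a \<and> min a b / 2 < b" if "a > 0" "b > 0" for a b :: real
    using that by (auto simp: min_def)
  from this[OF dq \<delta>] have \<epsilon>: "\<epsilon> > 0" "\<epsilon> < ?d / q" "\<epsilon> < \<delta>" by (auto simp: \<epsilon>_def)
  have s0: "s > 0"
  proof -
    have "?d / (?d + 1) > 0" using d2 by simp
    then show ?thesis using \<delta> unfolding \<delta>_def by linarith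
  qed
  have e3: "2 * s + 2 * \<epsilon> < ?d" using ds \<epsilon>(2) by simp
  have e4: "2 * s - 2 * \<epsilon> > 2 * ?d / (?d + 1)" using \<epsilon>(3) by (simp add: \<delta>_def)
  have spec: "norm (spectrum f \<xi>) = norm \<xi> powr - s * norm (complex_of_real (norm \<xi> powr s) * spectrum f \<xi>)" if "\<xi> \<noteq> 0" for f \<xi>
  proof -
    have "norm \<xi> powr - s * norm \<xi> powr s = 1" using that by (simp flip: powr_add)
    then show ?thesis by (simp add: norm_mult flip: mult.assoc)
  qed
  show ?thesis
  proof (rule that[OF q2 s0])
    fix f :: "real^'d \<Rightarrow> complex" assume f: "schwartz f"
    obtain n2 where n2: "n2 \<ge> 0" "(\<integral>\<^sup>+\<xi>. ennreal ((norm (complex_of_real (norm \<xi> powr s) * spectrum f \<xi>))\<^sup>2) \<partial>lborel) = ennreal n2"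
      "ennreal (sqrt n2) \<le> Hdot_norm s f"
      using Hdot_norm_spectrum[OF f s0] by blast
    have gm: "(\<lambda>\<xi>. complex_of_real (norm \<xi> powr s) * spectrum f \<xi>) \<in> borel_measurable borel"
      using weighted_spectrum(2)[OF f s0] by (auto dest: borel_measurable_integrable)
    define c where "c = lebesgue_const CARD('d) q s \<epsilon> powr (1 / q)"
    have "Lp_norm q (sup_time (\<lambda>t. wave_op t f)) \<le> ennreal (c * sqrt n2)"
      unfolding sup_time_wave_op c_def
      by (rule Lp_max_wave_le[OF d spectrum_integrable[OF f] gm spec \<epsilon>(1) _ e3 e4 _ ds n2(2,1)]) (use s0 q2 in auto)
    also have "\<dots> = ennreal c * ennreal (sqrt n2)" using n2(1) by (intro ennreal_mult) (auto simp: c_def)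
    also have "\<dots> \<le> ennreal c * Hdot_norm s f" by (intro mult_left_mono n2(3)) simp
    finally show "Lp_norm q (sup_time (\<lambda>t. wave_op t f)) \<le> ennreal (lebesgue_const CARD('d) q s \<epsilon> powr (1 / q)) * Hdot_norm s f"
      by (simp only: c_def)
    define c' where "c' = sqrt (q * lorentz_const CARD('d) q s \<epsilon>)"
    have c': "c' \<ge> 0"
    proof -
      have "lorentz_const CARD('d) q s \<epsilon> \<ge> 0"
        unfolding lorentz_const_def using ball_const_pos[OF e3] overlap_const_nonneg[OF \<epsilon>(1)] by (intro mult_nonneg_nonneg) auto
      then show ?thesis using q2 by (simp add: c'_def)
    qed
    have "Lorentz_norm q 2 (sup_time (\<lambda>t. wave_op t f)) \<le> ennreal (c' * sqrt n2)"
      unfolding sup_time_wave_op c'_def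
      by (rule Lorentz_max_wave_le[OF d spectrum_integrable[OF f] gm spec \<epsilon>(1) _ e3 e4 _ ds n2(2,1)]) (use s0 q2 in auto)
    also have "\<dots> = ennreal c' * ennreal (sqrt n2)" using n2(1) c' by (intro ennreal_mult) auto
    also have "\<dots> \<le> ennreal c' * Hdot_norm s f" by (intro mult_left_mono n2(3)) simp
    finally show "Lorentz_norm q 2 (sup_time (\<lambda>t. wave_op t f)) \<le> ennreal (sqrt (q * lorentz_const CARD('d) q s \<epsilon>)) * Hdot_norm s f"
      by (simp only: c'_def)
  qed
qed


section \<open>Limits of norms and of evolutions in the completion\<close>

lemma laplacian_measurable:
  assumes "schwartz f" "s > 0"
  shows "laplacian_half_power s f \<in> borel_measurable borel"
proof -
  have [measurable]: "(\<lambda>\<xi>. complex_of_real (norm \<xi> powr s) * spectrum f \<xi>) \<in> borel_measurable borel"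
    using weighted_spectrum(2)[OF assms] by (auto dest: borel_measurable_integrable)
  show ?thesis unfolding laplacian_eq_ft[abs_def] by measurable
qed

lemma laplacian_diff:
  assumes f: "schwartz f" and g: "schwartz g" and s: "s > 0"
  shows "laplacian_half_power s (\<lambda>x. f x - g x) x = laplacian_half_power s f x - laplacian_half_power s g x"
proof -
  have int: "integrable lborel (\<lambda>y. cis (y \<bullet> x) * \<phi> y)" if "integrable lborel \<phi>" for \<phi>
    by (rule Bochner_Integration.integrable_bound[OF that])
       (use borel_measurable_integrable[OF that] in \<open>auto simp: norm_mult\<close>)
  show ?thesis
    unfolding laplacian_eq_ft ft_def spectrum_diff[OF f g] right_diff_distrib
    by (rule Bochner_Integration.integral_diff[OF int[OF weighted_spectrum(2)[OF f s]] int[OF weighted_spectrum(2)[OF g s]]])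
qed

lemma Hdot_norm_triangle:
  assumes f: "schwartz f" and g: "schwartz g" and s: "s > 0"
  shows "Hdot_norm s f \<le> Hdot_norm s g + Hdot_norm s (\<lambda>x. f x - g x)"
  unfolding Hdot_norm_def
proof (rule Lp_norm_2_triangle)
  have [measurable]: "laplacian_half_power s g \<in> borel_measurable borel" "laplacian_half_power s (\<lambda>x. f x - g x) \<in> borel_measurable borel"
    by (intro laplacian_measurable schwartz_diff f g s)+
  show "(\<lambda>x. ennreal (cmod (laplacian_half_power s g x))) \<in> borel_measurable borel"
    "(\<lambda>x. ennreal (cmod (laplacian_half_power s (\<lambda>x. f x - g x) x))) \<in> borel_measurable borel" by measurable
  fix x
  have "cmod (laplacian_half_power s f x) \<le> cmod (laplacian_half_power s g x) + cmod (laplacian_half_power s (\<lambda>x. f x - g x) x)"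
    unfolding laplacian_diff[OF f g s] by (metis add_diff_cancel_left' norm_triangle_sub add.commute diff_add_cancel)
  then show "ennreal (cmod (laplacian_half_power s f x)) \<le> ennreal (cmod (laplacian_half_power s g x)) + ennreal (cmod (laplacian_half_power s (\<lambda>x. f x - g x) x))"
    by (simp flip: ennreal_plus add: ennreal_leI)
qed

text \<open>Since values may be infinite, differences are avoided: the one-sided inequality, for all
  late pairs in either order, squeezes the upper limit under the lower one.\<close>

lemma almost_Cauchy_ennreal_tendsto:
  fixes X :: "nat \<Rightarrow> ennreal"
  assumes "\<And>e::real. e > 0 \<Longrightarrow> \<exists>N. \<forall>m\<ge>N. \<forall>n\<ge>N. X m \<le> X n + ennreal e"
  shows "X \<longlonglongrightarrow> lim X"
proof -
  have "limsup X \<le> liminf X"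
  proof (rule ennreal_le_epsilon)
    fix e :: real assume e: "e > 0"
    obtain N where N: "\<And>m n. m \<ge> N \<Longrightarrow> n \<ge> N \<Longrightarrow> X m \<le> X n + ennreal e" using assms[OF e] by blast
    have "limsup X \<le> X n + ennreal e" if "n \<ge> N" for n
      using N that by (intro Limsup_bounded) (auto simp: eventually_sequentially)
    then have "limsup X \<le> liminf (\<lambda>n. X n + ennreal e)"
      by (intro Liminf_bounded) (auto simp: eventually_sequentially)
    also have "\<dots> = liminf X + ennreal e"
      by (rule Liminf_compose_continuous_mono) (auto intro!: continuous_intros monoI add_right_mono)
    finally show "limsup X \<le> liminf X + ennreal e" .
  qed
  then have "liminf X = limsup X" using Liminf_le_Limsup[of sequentially X] by simp
  then have "X \<longlonglongrightarrow> limsup X" by (intro Liminf_eq_Limsup) auto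
  then show ?thesis by (simp add: limI)
qed

text \<open>The triangle inequality gives the one-sided Cauchy property, so the \<open>lim\<close>
  in \<open>Hdot_limit_norm\<close> is a genuine limit and may be taken along subsequences.\<close>

lemma Hdot_limit:
  assumes F: "Hdot_Cauchy s F" and s: "s > 0"
  shows "(\<lambda>n. Hdot_norm s (F n)) \<longlonglongrightarrow> Hdot_limit_norm s F"
  unfolding Hdot_limit_norm_def
proof (rule almost_Cauchy_ennreal_tendsto)
  fix e :: real assume "e > 0"
  then obtain N where N: "\<forall>m\<ge>N. \<forall>n\<ge>N. Hdot_norm s (\<lambda>x. F m x - F n x) < ennreal e"
    using F unfolding Hdot_Cauchy_def by blast
  have "Hdot_norm s (F m) \<le> Hdot_norm s (F n) + ennreal e" if "m \<ge> N" "n \<ge> N" for m n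
  proof -
    have "Hdot_norm s (F m) \<le> Hdot_norm s (F n) + Hdot_norm s (\<lambda>x. F m x - F n x)"
      using F s by (intro Hdot_norm_triangle) (auto simp: Hdot_Cauchy_def)
    also have "\<dots> \<le> Hdot_norm s (F n) + ennreal e" using N that by (intro add_left_mono) (auto intro: less_imp_le)
    finally show ?thesis .
  qed
  then show "\<exists>N. \<forall>m\<ge>N. \<forall>n\<ge>N. Hdot_norm s (F m) \<le> Hdot_norm s (F n) + ennreal e" by blast
qed

lemma wave_op_diff:
  assumes f: "schwartz f" and g: "schwartz g"
  shows "wave_op t (\<lambda>x. f x - g x) x = wave_op t f x - wave_op t g x"
  unfolding wave_op_eq_wave_int wave_int_def spectrum_diff[OF f g] right_diff_distrib
  by (rule Bochner_Integration.integral_diff) (intro integrable_wave spectrum_integrable f g)+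

lemma sup_time_le_liminf:
  assumes "\<And>t. (\<lambda>k. v k t x) \<longlonglongrightarrow> w t x"
  shows "sup_time w x \<le> liminf (\<lambda>k. sup_time (v k) x)"
  unfolding sup_time_def
proof (rule SUP_least)
  fix t
  have "ennreal (cmod (w t x)) = liminf (\<lambda>k. ennreal (cmod (v k t x)))"
    by (intro lim_imp_Liminf[symmetric] tendsto_ennrealI tendsto_norm assms) simp
  also have "\<dots> \<le> liminf (\<lambda>k. SUP t. ennreal (cmod (v k t x)))"
    by (intro Liminf_mono always_eventually allI SUP_upper) simp
  finally show "ennreal (cmod (w t x)) \<le> liminf (\<lambda>k. SUP t. ennreal (cmod (v k t x)))" .
qed

lemma rapid_subsequence:
  assumes F: "Hdot_Cauchy s F" and \<eta>: "\<And>k::nat. \<eta> k > (0::real)"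
  obtains r where "strict_mono r" "\<And>k. Hdot_norm s (\<lambda>x. F (r (Suc k)) x - F (r k) x) < ennreal (\<eta> k)"
proof -
  have "\<forall>k. \<exists>N. \<forall>m\<ge>N. \<forall>n\<ge>N. Hdot_norm s (\<lambda>x. F m x - F n x) < ennreal (\<eta> k)"
    using F \<eta> unfolding Hdot_Cauchy_def by blast
  then obtain N where N: "\<And>k m n. m \<ge> N k \<Longrightarrow> n \<ge> N k \<Longrightarrow> Hdot_norm s (\<lambda>x. F m x - F n x) < ennreal (\<eta> k)"
    by metis
  \<comment> \<open>The sum is at least \<open>N k\<close> and nondecreasing in k; the added k makes
    the sequence strictly increasing.\<close>
  define r where "r k = k + (\<Sum>i\<le>k. N i)" for k
  have r1: "r k < r (Suc k)" for k by (simp add: r_def)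
  have r2: "N k \<le> r k" for k unfolding r_def by (rule trans_le_add2) (rule member_le_sum, auto)
  show ?thesis
  proof (rule that)
    show "strict_mono r" using r1 by (simp add: strict_mono_Suc_iff)
    show "Hdot_norm s (\<lambda>x. F (r (Suc k)) x - F (r k) x) < ennreal (\<eta> k)" for k
      using r1[of k] r2[of k] by (intro N) auto
  qed
qed

text \<open>The completeness argument for L^q. Along a rapid subsequence the a priori estimate makes
  the maximal increments summable even after multiplication by 2^k, so for almost every x the
  evolutions converge uniformly in time and the limit inherits continuity. The subsequence is
  returned because the final bounds are lower limits along it.\<close>

lemma wave_extension_exists:
  fixes F :: "nat \<Rightarrow> real^'d::finite \<Rightarrow> complex"
  assumes q: "q \<ge> 1" and C: "C \<ge> 0" and s: "s > 0" and F: "Hdot_Cauchy s F"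
    and ap: "\<And>f :: real^'d \<Rightarrow> complex. schwartz f \<Longrightarrow> Lp_norm q (sup_time (\<lambda>t. wave_op t f)) \<le> ennreal C * Hdot_norm s f"
  obtains u r where "wave_extension q F u" "strict_mono r" "sup_time u \<in> borel_measurable borel"
    "AE x in lborel. sup_time u x \<le> liminf (\<lambda>k. sup_time (\<lambda>t. wave_op t (F (r k))) x)"
proof -
  have Fs: "schwartz (F n)" for n using F by (simp add: Hdot_Cauchy_def)
  have FD: "schwartz (\<lambda>x. F m x - F n x)" for m n by (rule schwartz_diff[OF Fs Fs])
  \<comment> \<open>With increments below 4^-k a factor 2^k can be inserted and a geometric series
    is left.\<close>
  obtain r where r: "strict_mono r" "\<And>k. Hdot_norm s (\<lambda>x. F (r (Suc k)) x - F (r k) x) < ennreal ((1 / 4) ^ k)"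
    by (rule rapid_subsequence[OF F, of "\<lambda>k. (1 / 4) ^ k"]) auto
  define v where "v k t x = wave_op t (F (r k)) x" for k t x
  have v_meas[measurable]: "v k t \<in> borel_measurable borel" for k t
  proof -
    have [measurable]: "spectrum (F (r k)) \<in> borel_measurable borel"
      using spectrum_integrable[OF Fs] by (auto dest: borel_measurable_integrable)
    show ?thesis unfolding v_def[abs_def] wave_op_eq_wave_int by measurable
  qed
  have v_cont: "continuous_on UNIV (\<lambda>t. v k t x)" for k x
    unfolding v_def wave_op_eq_wave_int by (rule continuous_wave_int[OF spectrum_integrable[OF Fs]])
  define D where "D k = sup_time (\<lambda>t. wave_op t (\<lambda>x. F (r (Suc k)) x - F (r k) x))" for k
  have [measurable]: "D k \<in> borel_measurable borel" for k
    unfolding D_def by (rule sup_time_wave_op_measurable[OF FD])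
  define P where "P k x = ennreal_powr (ennreal (2 ^ k) * D k x) q" for k x
  have [measurable]: "P k \<in> borel_measurable borel" for k unfolding P_def[abs_def] by measurable
  have P_int: "(\<integral>\<^sup>+x. P k x \<partial>lborel) \<le> ennreal (C powr q * (1 / 2) ^ k)" for k
  proof -
    have scale: "ennreal_powr (ennreal a * y) q = ennreal (a powr q) * ennreal_powr y q" if "a > 0" for a y
      using that q by (cases y) (auto simp: powr_mult ennreal_mult_top simp flip: ennreal_mult)
    have "Lp_norm q (D k) \<le> ennreal C * ennreal ((1 / 4) ^ k)"
      unfolding D_def using r(2)[of k] by (intro order_trans[OF ap[OF FD]] mult_left_mono) auto
    also have "\<dots> = ennreal (C * (1 / 4) ^ k)" using C by (simp add: ennreal_mult)
    finally have "ennreal_powr (Lp_norm q (D k)) q \<le> ennreal_powr (ennreal (C * (1 / 4) ^ k)) q"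
      using q by (intro ennreal_powr_mono) auto
    then have D: "(\<integral>\<^sup>+x. ennreal_powr (D k x) q \<partial>lborel) \<le> ennreal ((C * (1 / 4) ^ k) powr q)"
      using q C ennreal_powr_inverse[of "1 / q"] by (simp add: Lp_norm_def)
    have "(\<integral>\<^sup>+x. P k x \<partial>lborel) = ennreal ((2 ^ k) powr q) * (\<integral>\<^sup>+x. ennreal_powr (D k x) q \<partial>lborel)"
      unfolding P_def by (subst scale) (auto intro!: nn_integral_cmult)
    also have "\<dots> \<le> ennreal ((2 ^ k) powr q) * ennreal ((C * (1 / 4) ^ k) powr q)" by (intro mult_left_mono D) simp
    also have "\<dots> = ennreal ((2 ^ k * (C * (1 / 4) ^ k)) powr q)"
      using C by (simp add: powr_mult flip: ennreal_mult)
    also have "2 ^ k * (C * (1 / 4) ^ k) = C * (1 / 2) ^ k"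
      by (simp add: mult.left_commute flip: power_mult_distrib)
    also have "(C * (1 / 2) ^ k) powr q = C powr q * ((1 / 2) ^ k) powr q" using C by (simp add: powr_mult)
    \<comment> \<open>As q >= 1, the q-th power of a number in [0,1] is at most that number, so the
      series keeps the ratio 1/2.\<close>
    also have "ennreal (C powr q * ((1 / 2) ^ k) powr q) \<le> ennreal (C powr q * (1 / 2) ^ k)"
    proof (intro ennreal_leI mult_left_mono)
      have "((1 / 2 :: real) ^ k) powr q \<le> ((1 / 2) ^ k) powr 1" using q by (intro powr_mono') (auto simp: power_le_one)
      then show "((1 / 2 :: real) ^ k) powr q \<le> (1 / 2) ^ k" by simp
    qed simp
    finally show ?thesis .
  qed
  have "(\<integral>\<^sup>+x. (\<Sum>k. P k x) \<partial>lborel) = (\<Sum>k. \<integral>\<^sup>+x. P k x \<partial>lborel)" by (rule nn_integral_suminf) measurable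
  also have "\<dots> \<le> (\<Sum>k. ennreal (C powr q * (1 / 2) ^ k))" by (intro suminf_le summableI P_int)
  also have "\<dots> = ennreal (C powr q / (1 - 1 / 2))" by (rule suminf_ennreal_geometric) auto
  also have "\<dots> < \<infinity>" by simp
  finally have "AE x in lborel. (\<Sum>k. P k x) \<noteq> \<infinity>" by (intro nn_integral_noteq_infinite) auto
  \<comment> \<open>The good points. Off this set \<open>u\<close> is put equal to 0, so that
    measurability in x and continuity in t hold everywhere, as \<open>wave_extension\<close>
    asks.\<close>
  define Gd where "Gd = {x. (\<Sum>k. P k x) \<noteq> \<infinity>}"
  have Gd_meas[measurable]: "Gd \<in> sets borel" unfolding Gd_def by measurable
  have Gd_AE: "AE x in lborel. x \<in> Gd" using \<open>AE x in lborel. (\<Sum>k. P k x) \<noteq> \<infinity>\<close> by (simp add: Gd_def)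
  have conv: "\<exists>l. uniform_limit UNIV (\<lambda>k t. v k t x) l sequentially" if x: "x \<in> Gd" for x
  proof -
    obtain S where S: "(\<Sum>k. P k x) = ennreal S" "S \<ge> 0" using x by (cases "\<Sum>k. P k x") (auto simp: Gd_def)
    define c where "c = S powr (1 / q)"
    have step: "norm (v (Suc k) t x - v k t x) \<le> c * (1 / 2) ^ k" for k t
    proof -
      have "P k x \<le> ennreal S" unfolding S(1)[symmetric] by (rule ennreal_term_le_suminf)
      then have "ennreal_powr (P k x) (1 / q) \<le> ennreal_powr (ennreal S) (1 / q)" using q by (intro ennreal_powr_mono) auto
      then have "ennreal (2 ^ k) * D k x \<le> ennreal c" using q S(2) by (simp add: P_def ennreal_powr_inverse c_def)
      moreover have "ennreal (norm (v (Suc k) t x - v k t x)) \<le> D k x"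
        unfolding D_def sup_time_def v_def wave_op_diff[OF Fs Fs, symmetric] by (rule SUP_upper) simp
      ultimately have "ennreal (2 ^ k) * ennreal (norm (v (Suc k) t x - v k t x)) \<le> ennreal c"
        by (meson mult_left_mono order_trans zero_le)
      then have "2 ^ k * norm (v (Suc k) t x - v k t x) \<le> c"
        by (simp add: c_def ennreal_le_iff flip: ennreal_mult)
      then show ?thesis by (simp add: field_simps power_divide)
    qed
    have "uniformly_convergent_on UNIV (\<lambda>n t. \<Sum>k<n. v (Suc k) t x - v k t x)"
      by (rule Weierstrass_m_test'[OF step]) (auto intro!: summable_mult summable_geometric)
    then obtain l where l: "uniform_limit UNIV (\<lambda>n t. \<Sum>k<n. v (Suc k) t x - v k t x) l sequentially"
      unfolding uniformly_convergent_on_def by blast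
    have "uniform_limit UNIV (\<lambda>n t. (\<Sum>k<n. v (Suc k) t x - v k t x) + v 0 t x) (\<lambda>t. l t + v 0 t x) sequentially"
      by (intro uniform_limit_add l uniform_limit_const)
    moreover have "(\<Sum>k<n. v (Suc k) t x - v k t x) = v n t x - v 0 t x" for n t
      by (rule sum_lessThan_telescope)
    ultimately show ?thesis by auto
  qed
  \<comment> \<open>The limit is picked by choice at each point; measurability is recovered from the
    approximants cut off to \<open>Gd\<close>.\<close>
  define l where "l x = (SOME l. uniform_limit UNIV (\<lambda>k t. v k t x) l sequentially)" for x
  have l: "uniform_limit UNIV (\<lambda>k t. v k t x) (l x) sequentially" if "x \<in> Gd" for x
    unfolding l_def using conv[OF that] by (rule someI_ex)
  define u where "u t x = (if x \<in> Gd then l x t else 0)" for t x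
  have lim: "(\<lambda>k. v k t x) \<longlonglongrightarrow> u t x" if "x \<in> Gd" for t x
    using tendsto_uniform_limitI[OF l[OF that], of t] that by (simp add: u_def)
  have u_meas[measurable]: "u t \<in> borel_measurable borel" for t
  proof (rule borel_measurable_LIMSEQ_metric)
    show "(\<lambda>x. indicator Gd x *\<^sub>R v k t x) \<in> borel_measurable borel" for k by measurable
    show "(\<lambda>k. indicator Gd x *\<^sub>R v k t x) \<longlonglongrightarrow> u t x" for x
      using lim[of x t] by (cases "x \<in> Gd") (auto simp: u_def)
  qed
  have u_cont: "continuous_on UNIV (\<lambda>t. u t x)" for x
  proof (cases "x \<in> Gd")
    case True
    then show ?thesis unfolding u_def
      using uniform_limit_theorem[OF _ l[OF True]] v_cont by simp
  qed (simp add: u_def)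
  have F_cont: "continuous_on UNIV (\<lambda>t. wave_op t (F n) x)" for n x
    unfolding wave_op_eq_wave_int by (rule continuous_wave_int[OF spectrum_integrable[OF Fs]])
  have small: "\<exists>N. \<forall>n\<ge>N. Lp_norm q (sup_time (\<lambda>t x. wave_op t (F n) x - u t x)) \<le> ennreal e" if e: "e > 0" for e
  proof -
    \<comment> \<open>C + 1 keeps the quotient defined when C = 0.\<close>
    define e' where "e' = e / (C + 1)"
    have e': "e' > 0" "C * e' \<le> e" using e C by (auto simp: e'_def field_simps)
    obtain N where N: "\<And>m n. m \<ge> N \<Longrightarrow> n \<ge> N \<Longrightarrow> Hdot_norm s (\<lambda>x. F m x - F n x) < ennreal e'"
      using F e'(1) unfolding Hdot_Cauchy_def by blast
    \<comment> \<open>For fixed n the evolutions of F n - F (r k) have small norm for all large k,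
      and on the good set they converge to the difference of the evolution of F n and
      \<open>u\<close> at every time.\<close>
    have "Lp_norm q (sup_time (\<lambda>t x. wave_op t (F n) x - u t x)) \<le> ennreal e" if n: "n \<ge> N" for n
    proof (rule Lp_norm_fatou[where G="\<lambda>k. sup_time (\<lambda>t. wave_op t (\<lambda>x. F n x - F (r k) x))"])
      show "q > 0" using q by simp
      show "sup_time (\<lambda>t. wave_op t (\<lambda>x. F n x - F (r k) x)) \<in> borel_measurable borel" for k
        by (rule sup_time_wave_op_measurable[OF FD])
      show "AE x in lborel. sup_time (\<lambda>t x. wave_op t (F n) x - u t x) x \<le> liminf (\<lambda>k. sup_time (\<lambda>t. wave_op t (\<lambda>x. F n x - F (r k) x)) x)"
        using Gd_AE
      proof eventually_elim
        case (elim x)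
        show ?case
          by (rule sup_time_le_liminf) (auto simp: wave_op_diff[OF Fs Fs] v_def[symmetric] intro!: tendsto_diff lim elim)
      qed
      have "Lp_norm q (sup_time (\<lambda>t. wave_op t (\<lambda>x. F n x - F (r k) x))) \<le> ennreal e" if k: "k \<ge> N" for k
      proof -
        have "r k \<ge> N" using k seq_suble[OF r(1), of k] by simp
        then have "Lp_norm q (sup_time (\<lambda>t. wave_op t (\<lambda>x. F n x - F (r k) x))) \<le> ennreal C * ennreal e'"
          using N[OF n, of "r k"] by (intro order_trans[OF ap[OF FD]] mult_left_mono) auto
        also have "\<dots> \<le> ennreal e" using e' C by (simp add: ennreal_leI flip: ennreal_mult)
        finally show ?thesis .
      qed
      then show "\<forall>\<^sub>F k in sequentially. Lp_norm q (sup_time (\<lambda>t. wave_op t (\<lambda>x. F n x - F (r k) x))) \<le> ennreal e"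
        by (auto simp: eventually_sequentially)
    qed
    then show ?thesis by blast
  qed
  show ?thesis
  proof (rule that[OF _ r(1)])
    show "wave_extension q F u"
      unfolding wave_extension_def
    proof (intro conjI allI)
      show "u t \<in> borel_measurable lborel" for t by simp
      show "continuous_on UNIV (\<lambda>t. u t x)" for x by (rule u_cont)
      show "(\<lambda>n. Lp_norm q (sup_time (\<lambda>t x. wave_op t (F n) x - u t x))) \<longlonglongrightarrow> 0"
      proof (rule order_tendstoI)
        fix y :: ennreal assume "0 < y"
        \<comment> \<open>The threshold y may be infinite, so a finite positive one below it is
          chosen.\<close>
        then obtain z where z: "0 < z" "z < y" using dense by blast
        then obtain e where "z = ennreal e" "e \<ge> 0" by (cases z) auto
        then have e: "0 < e" "ennreal e < y" using z by auto
        obtain N where "\<forall>n\<ge>N. Lp_norm q (sup_time (\<lambda>t x. wave_op t (F n) x - u t x)) \<le> ennreal e" using small[OF e(1)] by blast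
        then show "\<forall>\<^sub>F n in sequentially. Lp_norm q (sup_time (\<lambda>t x. wave_op t (F n) x - u t x)) < y"
          using e(2) by (auto simp: eventually_sequentially intro: le_less_trans)
      qed simp
    qed
    show "sup_time u \<in> borel_measurable borel"
      unfolding sup_time_def[abs_def] by (rule borel_measurable_SUP_time[OF u_meas u_cont])
    show "AE x in lborel. sup_time u x \<le> liminf (\<lambda>k. sup_time (\<lambda>t. wave_op t (F (r k))) x)"
      using Gd_AE
    proof eventually_elim
      case (elim x)
      show ?case
        by (rule sup_time_le_liminf) (auto simp: v_def[symmetric] intro!: lim elim)
    qed
  qed
qed

text \<open>The second hypothesis speaks of arbitrary eventual bounds b, which is the shape of the
  Fatou lemmas. Every y above the limit is such a bound, and density of the order concludes.\<close>

lemma limit_bound: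
  fixes X :: "nat \<Rightarrow> ennreal"
  assumes X: "X \<longlonglongrightarrow> L" and le: "\<And>b. \<forall>\<^sub>F k in sequentially. ennreal C * X k \<le> b \<Longrightarrow> Z \<le> b"
  shows "Z \<le> ennreal C * L"
proof (rule dense_ge)
  fix y assume "ennreal C * L < y"
  moreover have "(\<lambda>k. ennreal C * X k) \<longlonglongrightarrow> ennreal C * L" by (rule ennreal_tendsto_cmult[OF _ X]) simp
  ultimately have "\<forall>\<^sub>F k in sequentially. ennreal C * X k < y" by (rule order_tendstoD(2)[rotated])
  then show "Z \<le> y" by (intro le) (auto elim: eventually_mono)
qed

theorem theorem1p7:
  fixes q s :: real
  assumes d: "CARD('d::finite) \<ge> 2"
    and q: "q > q_circ CARD('d)"
    and s: "s = s_crit q CARD('d)"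
  shows "(\<exists>C::real.
      (\<forall>f :: real^'d \<Rightarrow> complex. schwartz f \<longrightarrow>
         Lp_norm q (sup_time (\<lambda>t. wave_op t f)) \<le> ennreal C * Hdot_norm s f) \<and>
      (\<forall>F :: nat \<Rightarrow> real^'d \<Rightarrow> complex. Hdot_Cauchy s F \<longrightarrow>
         (\<exists>u. wave_extension q F u \<and>
           Lp_norm q (sup_time u) \<le> ennreal C * Hdot_limit_norm s F))) \<and>
    (\<exists>C::real.
      (\<forall>f :: real^'d \<Rightarrow> complex. schwartz f \<longrightarrow>
         Lorentz_norm q 2 (sup_time (\<lambda>t. wave_op t f)) \<le> ennreal C * Hdot_norm s f) \<and>
      (\<forall>F :: nat \<Rightarrow> real^'d \<Rightarrow> complex. Hdot_Cauchy s F \<longrightarrow>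
         (\<exists>u. wave_extension q F u \<and>
           Lorentz_norm q 2 (sup_time u) \<le> ennreal C * Hdot_limit_norm s F)))"
proof -
  obtain C1 C2 where q2: "q > 2" and s0: "s > 0"
    and ap1: "\<And>f :: real^'d \<Rightarrow> complex. schwartz f \<Longrightarrow> Lp_norm q (sup_time (\<lambda>t. wave_op t f)) \<le> ennreal C1 * Hdot_norm s f"
    and ap2: "\<And>f :: real^'d \<Rightarrow> complex. schwartz f \<Longrightarrow> Lorentz_norm q 2 (sup_time (\<lambda>t. wave_op t f)) \<le> ennreal C2 * Hdot_norm s f"
    using a_priori[OF d q s] by blast
  \<comment> \<open>The extension is built with a nonnegative constant; \<open>ennreal\<close> sends
    negative reals to 0, so the maximum changes nothing.\<close>
  have ap1': "Lp_norm q (sup_time (\<lambda>t. wave_op t f)) \<le> ennreal (max 0 C1) * Hdot_norm s f" if "schwartz f" for f :: "real^'d \<Rightarrow> complex"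
  proof -
    have "ennreal C1 \<le> ennreal (max 0 C1)" by (rule ennreal_leI) simp
    then show ?thesis using ap1[OF that] by (meson mult_right_mono order_trans zero_le)
  qed
  \<comment> \<open>One extension \<open>u\<close> and one subsequence serve both norms, because the
    comparison of \<open>sup_time u\<close> with the lower limit holds almost everywhere and refers
    to neither norm.\<close>
  have ext: "\<exists>u. wave_extension q F u \<and> Lp_norm q (sup_time u) \<le> ennreal C1 * Hdot_limit_norm s F
      \<and> Lorentz_norm q 2 (sup_time u) \<le> ennreal C2 * Hdot_limit_norm s F" if F: "Hdot_Cauchy s F" for F :: "nat \<Rightarrow> real^'d \<Rightarrow> complex"
  proof -
    obtain u r where u: "wave_extension q F u" "strict_mono r" "sup_time u \<in> borel_measurable borel"
      "AE x in lborel. sup_time u x \<le> liminf (\<lambda>k. sup_time (\<lambda>t. wave_op t (F (r k))) x)"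
      by (rule wave_extension_exists[OF _ _ s0 F ap1']) (use q2 in auto)
    have Fs: "schwartz (F n)" for n using F by (simp add: Hdot_Cauchy_def)
    have L: "(\<lambda>k. Hdot_norm s (F (r k))) \<longlonglongrightarrow> Hdot_limit_norm s F"
      using LIMSEQ_subseq_LIMSEQ[OF Hdot_limit[OF F s0] u(2)] by (simp add: comp_def)
    have q0: "q > 0" using q2 by simp
    have "Lp_norm q (sup_time u) \<le> ennreal C1 * Hdot_limit_norm s F"
    proof (rule limit_bound[OF L])
      fix b assume "\<forall>\<^sub>F k in sequentially. ennreal C1 * Hdot_norm s (F (r k)) \<le> b"
      then have "\<forall>\<^sub>F k in sequentially. Lp_norm q (sup_time (\<lambda>t. wave_op t (F (r k)))) \<le> b"
        by eventually_elim (rule order_trans[OF ap1[OF Fs]])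
      then show "Lp_norm q (sup_time u) \<le> b"
        by (rule Lp_norm_fatou[OF q0 sup_time_wave_op_measurable[OF Fs] u(4)])
    qed
    moreover have "Lorentz_norm q 2 (sup_time u) \<le> ennreal C2 * Hdot_limit_norm s F"
    proof (rule limit_bound[OF L])
      fix b assume "\<forall>\<^sub>F k in sequentially. ennreal C2 * Hdot_norm s (F (r k)) \<le> b"
      then have "\<forall>\<^sub>F k in sequentially. Lorentz_norm q 2 (sup_time (\<lambda>t. wave_op t (F (r k)))) \<le> b"
        by eventually_elim (rule order_trans[OF ap2[OF Fs]])
      then show "Lorentz_norm q 2 (sup_time u) \<le> b"
        by (rule Lorentz_norm_fatou[OF q0 u(3) sup_time_wave_op_measurable[OF Fs] u(4)])
    qed
    ultimately show ?thesis using u(1) by blast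
  qed
  show ?thesis
  proof (rule conjI)
    show "\<exists>C::real. (\<forall>f :: real^'d \<Rightarrow> complex. schwartz f \<longrightarrow> Lp_norm q (sup_time (\<lambda>t. wave_op t f)) \<le> ennreal C * Hdot_norm s f) \<and>
      (\<forall>F :: nat \<Rightarrow> real^'d \<Rightarrow> complex. Hdot_Cauchy s F \<longrightarrow> (\<exists>u. wave_extension q F u \<and> Lp_norm q (sup_time u) \<le> ennreal C * Hdot_limit_norm s F))"
      using ap1 ext by (intro exI[of _ C1]) blast
    show "\<exists>C::real. (\<forall>f :: real^'d \<Rightarrow> complex. schwartz f \<longrightarrow> Lorentz_norm q 2 (sup_time (\<lambda>t. wave_op t f)) \<le> ennreal C * Hdot_norm s f) \<and>
      (\<forall>F :: nat \<Rightarrow> real^'d \<Rightarrow> complex. Hdot_Cauchy s F \<longrightarrow> (\<exists>u. wave_extension q F u \<and> Lorentz_norm q 2 (sup_time u) \<le> ennreal C * Hdot_limit_norm s F))"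
      using ap2 ext by (intro exI[of _ C2]) blast
  qed
qed

end
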